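(* Work in the saturated Gaussian one-way layout with $p$ factor levels, with the monotone shrinkage (MS), soft-thresholding (ST) and hybrid shrinkage (HS) candidate estimators, their losses $L$, risks $R$ and estimated risks $\hat r$ as defined in the context. For any vector $h\in\mathbb{R}^p$ let $\|h\|=\max_{1\le i\le p}|h_i|$. Let $\mathcal{F}$ be either $\mathcal{F}_{\mathrm{MS}}$ or $\mathcal{F}_{\mathrm{ST}}$ (the subscript $\mathcal{F}$ on an estimator or estimated risk stands for MS or ST accordingly). Suppose that $\hat\sigma^2$ is consistent in that, for every $c>0$ and $\sigma^2>0$, $$\lim_{p\to\infty}\ \sup_{\|\xi\|\le c}\mathrm{E}|\hat\sigma^2-\sigma^2|=0 .$$ (a) Let $V(f)$ denote either the loss $L(\hat\eta_{\mathcal{F}}(D,f),\eta)$ or the estimated risk $\hat r_{\mathcal{F}}(D,f)$. Then, for every penalty matrix $D$, every $c>0$ and every $\sigma^2>0$, $$\lim_{p\to\infty}\ \sup_{\|\xi\|\le c}\mathrm{E}\sup_{f\in\mathcal{F}}\bigl|V(f)-R(\hat\eta_{\mathcal{F}}(D,f),\eta,\sigma^2)\bigr|=0 .\qquad\text{(A)}$$ (b) If $\hat f=\arg\min_{f\in\mathcal{F}}\hat r_{\mathcal{F}}(D,f)$, then (for $D$, $c$, $\sigma^2$ as in (a)) $$\lim_{p\to\infty}\ \sup_{\|\xi\|\le c}\Bigl|R(\hat\eta_{\mathcal{F}}(D,\hat f),\eta,\sigma^2)-\min_{f\in\mathcal{F}}R(\hat\eta_{\mathcal{F}}(D,f),\eta,\sigma^2)\Bigr|=0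 .\qquad\text{(B)}$$ (c) For $W$ equal to either $L(\hat\eta_{\mathcal{F}}(D,\hat f),\eta)$ or $R(\hat\eta_{\mathcal{F}}(D,\hat f),\eta,\sigma^2)$, $$\lim_{p\to\infty}\ \sup_{\|\xi\|\le c}\mathrm{E}\bigl|\hat r_{\mathcal{F}}(D,\hat f)-W\bigr|=0 .\qquad\text{(C)}$$ (d) Let $\#\mathcal{D}$ denote the cardinality of a set $\mathcal{D}$ of candidate penalty matrices. The convergences (A) to (C) hold for the fully adaptive MS estimator $\hat\eta_{\mathcal{D},\mathrm{MS}}=\hat\eta_{\mathrm{MS}}(\hat D,\hat f)$, where $(\hat D,\hat f)=\arg\min_{D\in\mathcal{D},\,f\in\mathcal{F}_{\mathrm{MS}}}\hat r_{\mathrm{MS}}(D,f)$, if $(\#\mathcal{D})\,p^{-1/2}$ and $(\#\mathcal{D})\,\mathrm{E}|\hat\sigma^2-\sigma^2|$ both tend to zero as $p\to\infty$. They hold for the fully adaptive ST estimator $\hat\eta_{\mathcal{D},\mathrm{ST}}$ (defined in the same way with $\mathcal{F}_{\mathrm{ST}}$ and $\hat r_{\mathrm{ST}}$ in place of $\mathcal{F}_{\mathrm{MS}}$ and $\hat r_{\mathrm{MS}}$) if $(\#\mathcal{D})\,p^{-1/2}(\log(p))^{1/4}$ and $(\#\mathcal{D})\,\mathrm{E}|\hat\sigma^2-\sigma^2|$ both tend to zero as $p\to\infty$. (e) Let $\mathcal{A}\subset[0,1]$ be a set of candidate split fractions, with cardinality $\#\mathcal{A}$. The convergences (A) to (C)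 hold for the fully adaptive HS estimator $\hat\eta_{\mathcal{D},\mathcal{A},\mathrm{HS}}=\hat\eta_{\mathrm{HS}}(\hat D,\hat\alpha,\hat f)$, where $(\hat D,\hat\alpha,\hat f)=\arg\min_{D\in\mathcal{D},\,\alpha\in\mathcal{A},\,f\in\mathcal{F}_{\mathrm{HS}}}\hat r_{\mathrm{HS}}(D,\alpha,f)$, if $\max\{\#\mathcal{A},\#\mathcal{D}\}\,p^{-1/2}(\log(p))^{1/4}$ and $\max\{\#\mathcal{A},\#\mathcal{D}\}\,\mathrm{E}|\hat\sigma^2-\sigma^2|$ both tend to zero as $p\to\infty$. (In (d) and (e), the optimization over $f$ in (A) to (C) is replaced by joint optimization over the pair $(D,f)$, respectively the triple $(D,\alpha,f)$, that the fully adaptive estimator selects.)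
   Context: **Model.** There are $p$ factor levels, with $n_i$ observations at level $i$ and $n=\sum_{i=1}^p n_i$. The observation vector $y\in\mathbb{R}^n$ satisfies $y\sim N(\eta,\sigma^2I_n)$ with $\eta=X\mu$, where $\mu\in\mathbb{R}^p$ is unknown and unrestricted, $\sigma^2>0$ is unknown, and $X$ is the $n\times p$ incidence matrix linking observations to factor levels (column $i$ contains $n_i$ ones, in the rows of the observations at level $i$, and zeros elsewhere). $\hat\sigma^2$ is an estimator of $\sigma^2$. Expectations are under this model. **Penalty basis.** A penalty matrix $D$ is any matrix with $p$ columns. Let $R_0=X'X$ (diagonal), and let $R_0^{-1/2}D'DR_0^{-1/2}=\Gamma\Lambda\Gamma'$ be the spectral representation, with $\Gamma$ orthogonal and $\Lambda=\mathrm{diag}\{\lambda_i\}$, $0\le\lambda_1\le\dots\le\lambda_p$. The penalty basis matrix is $U=XR_0^{-1/2}\Gamma$, whose columns form an orthonormal basis of the column space of $X$. Set $z=U'y$ and $\xi=U'\eta$, so that $z\sim N_p(\xi,\sigma^2I_p)$ and $\eta=U\xi$. **Loss and risk.** For an estimator $\hat\eta$ of $\eta$, $L(\hat\eta,\eta)=p^{-1}|\hat\eta-\eta|^2$ ($|\cdot|$ is the Euclidean norm) and $R(\hat\eta,\eta,\sigma^2)=\mathrm{E}L(\hat\eta,\eta)$. Operations on vectors are componentwise, and $\mathrm{ave}(x)$ is the average of the components of $x$. **MS estimators.** $\mathcal{F}_{\mathrm{MS}}=\mathcal{F}_{\mathrm{MS}}(p)=\{f\in[0,1]^p: f_1\ge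 f_2\ge\dots\ge f_p\}$. The candidate estimators are $\hat\eta_{\mathrm{MS}}(D,f)=U\,\mathrm{diag}\{f\}U'y$, $f\in\mathcal{F}_{\mathrm{MS}}$. Their risk is $r_{\mathrm{MS}}(f,\xi,\sigma^2)=\mathrm{ave}[f^2\sigma^2+(1-f)^2\xi^2]$ and their estimated risk is $$\hat r_{\mathrm{MS}}(D,f)=\mathrm{ave}[f^2\hat\sigma^2+(1-f)^2(z^2-\hat\sigma^2)].$$ **ST estimators.** For $t\ge0$ and $1\le i\le p$ let $h_i(t,z)=[1-t/|z_i|]_+$. $\mathcal{F}_{\mathrm{ST}}=\mathcal{F}_{\mathrm{ST}}(p)=\{f\in[0,1]^p: f_i=h_i(t,z)\text{ for }t\ge0\text{ and }1\le i\le p\}$, a data-dependent class indexed by the threshold $t$. The candidate estimators are $\hat\eta_{\mathrm{ST}}(D,f)=U\,\mathrm{diag}\{f\}U'y$, $f\in\mathcal{F}_{\mathrm{ST}}$. Let $\hat G$ be the empirical cumulative distribution function of $\{|z_i|:1\le i\le p\}$, let $G=\mathrm{E}(\hat G)$, and let $\wedge$ denote minimum. The risk of the candidate with threshold $t$ is $r_{\mathrm{ST}}(f,\xi,\sigma^2)=\sigma^2[1-2G(t)]+\int_0^\infty(u^2\wedge t^2)\,dG(u)$ and its estimated risk is $$\hat r_{\mathrm{ST}}(D,f)=\hat\sigma^2[1-2\hat G(t)]+\int_0^\infty(u\wedge t)^2\,d\hat G(u).$$ **HS estimators.** For a split fraction $\alpha\in[0,1]$ let $p_1=\lfloor\alpha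 p\rfloor$ and $p_2=p-p_1$; for $k\in\mathbb{R}^p$ let $k_{(1)}=(k_1,\dots,k_{p_1})$ and $k_{(2)}=(k_{p_1+1},\dots,k_p)$. $\mathcal{F}_{\mathrm{HS}}=\{f: f_{(1)}\in\mathcal{F}_{\mathrm{MS}}(p_1),\ f_{(2)}\in\mathcal{F}_{\mathrm{ST}}(p_2)\}$, where $\mathcal{F}_{\mathrm{ST}}(p_2)$ is formed from the subvector $z_{(2)}$. The candidate estimators are $\hat\eta_{\mathrm{HS}}(D,\alpha,f)=U\,\mathrm{diag}\{f\}U'y$, $f\in\mathcal{F}_{\mathrm{HS}}$. Their risk is $p^{-1}[p_1r_{\mathrm{MS}}(f_{(1)},\xi_{(1)},\sigma^2)+p_2r_{\mathrm{ST}}(f_{(2)},\xi_{(2)},\sigma^2)]$ and their estimated risk is $$\hat r_{\mathrm{HS}}(D,\alpha,f)=p^{-1}[p_1\hat r_{\mathrm{MS}}(D,f_{(1)})+p_2\hat r_{\mathrm{ST}}(D,f_{(2)})],$$ where $\hat r_{\mathrm{MS}}(D,f_{(1)})$ is the MS formula computed on $z_{(1)}$ and $\hat r_{\mathrm{ST}}(D,f_{(2)})$ is the ST formula computed on $z_{(2)}$. **Adaptive estimators.** The risk $R$ of an estimator that uses the data-selected $\hat f$, $(\hat D,\hat f)$ or $(\hat D,\hat\alpha,\hat f)$ is its expected loss. *)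

theory Defs
  imports "HOL-Probability.Probability" "Jordan_Normal_Form.Matrix"
begin

text \<open>
  Vectors and matrices are those of \<open>Jordan_Normal_Form\<close>, since the dimensions \<open>n\<close> and \<open>p\<close> vary.
  The context fixes, for every \<open>p\<close>, one layout with \<open>p\<close> factor levels; all limits are taken along
  this sequence. Indices start at 0, and the parameter \<open>s2\<close> always stands for the variance
  \<open>\<sigma>\<^sup>2\<close>, not for the standard deviation.
\<close>

unbundle no vec_syntax

section \<open>The model\<close>

text \<open>\<open>lev j\<close> is the factor level of observation \<open>j\<close>. Surjectivity onto the levels says that every
  \<open>n\<^sub>i\<close> is positive, without which \<open>R\<^sub>0\<^sup>-\<^sup>1\<^sup>/\<^sup>2\<close> does not exist.\<close>

definition incidence_matrix :: "nat \<Rightarrow> real mat \<Rightarrow> bool" where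
  "incidence_matrix p X \<longleftrightarrow>
     (\<exists>lev. lev ` {..<dim_row X} = {..<p} \<and>
        X = Matrix.mat (dim_row X) p (\<lambda>(j, i). if lev j = i then 1 else 0))"

definition inv_sqrt_diag :: "real mat \<Rightarrow> real mat" where
  "inv_sqrt_diag A = mat_diag (dim_row A) (\<lambda>i. 1 / sqrt (A $$ (i, i)))"

definition spectral_representation :: "real mat \<Rightarrow> real mat \<Rightarrow> (nat \<Rightarrow> real) \<Rightarrow> bool" where
  "spectral_representation A G lam \<longleftrightarrow>
     (let p = dim_row A in
       G \<in> carrier_mat p p \<and> transpose_mat G * G = 1\<^sub>m p \<and>
       A = G * mat_diag p lam * transpose_mat G \<and>
       (\<forall>i<p. 0 \<le> lam i) \<and> (\<forall>i j. i \<le> j \<and> j < p \<longrightarrow> lam i \<le> lam j))"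

text \<open>The spectral representation, hence the penalty basis, need not be unique; this is a relation
  satisfied by every admissible choice of \<open>U\<close>.\<close>

definition penalty_basis :: "real mat \<Rightarrow> real mat \<Rightarrow> real mat \<Rightarrow> bool" where
  "penalty_basis X D U \<longleftrightarrow>
     (let S = inv_sqrt_diag (transpose_mat X * X) in
       \<exists>G lam. spectral_representation (S * (transpose_mat D * D) * S) G lam \<and> U = X * S * G)"

text \<open>The law \<open>N(\<eta>, \<sigma>\<^sup>2 I\<^sub>n)\<close>: independent coordinates. The sample space consists of functions on
  \<open>{..<n}\<close>, and the observation vector is \<open>vec n \<omega>\<close>.\<close>

definition gauss_law :: "real vec \<Rightarrow> real \<Rightarrow> (nat \<Rightarrow> real) measure" where
  "gauss_law \<eta> s2 =
     (\<Pi>\<^sub>M j\<in>{..<dim_vec \<eta>}. density lborel (\<lambda>x. ennreal (normal_density (\<eta> $ j) (sqrt s2) x)))"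

text \<open>Expectation of a nonnegative, possibly non-integrable function of \<open>y\<close>.\<close>

definition expect :: "real vec \<Rightarrow> real \<Rightarrow> (real vec \<Rightarrow> ennreal) \<Rightarrow> ennreal" where
  "expect \<eta> s2 g = (\<integral>\<^sup>+ \<omega>. g (Matrix.vec (dim_vec \<eta>) \<omega>) \<partial>gauss_law \<eta> s2)"

text \<open>Measurable real-valued functions of the observation vector.\<close>

definition statistic :: "nat \<Rightarrow> (real vec \<Rightarrow> real) \<Rightarrow> bool" where
  "statistic n g \<longleftrightarrow> (\<lambda>\<omega>. g (Matrix.vec n \<omega>)) \<in> borel_measurable (\<Pi>\<^sub>M j\<in>{..<n}. borel)"

definition loss :: "nat \<Rightarrow> real vec \<Rightarrow> real vec \<Rightarrow> real" where
  "loss p est \<eta> = (\<Sum>j<dim_vec \<eta>. (est $ j - \<eta> $ j)\<^sup>2) / real p"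

text \<open>The estimators considered below shrink \<open>U'y\<close> with weights in \<open>[0,1]\<close>, so that their losses are
  bounded by a quadratic function of \<open>y\<close> and the Bochner integral exists.\<close>

definition risk :: "nat \<Rightarrow> real vec \<Rightarrow> real \<Rightarrow> (real vec \<Rightarrow> real vec) \<Rightarrow> real" where
  "risk p \<eta> s2 est = (\<integral>\<omega>. loss p (est (Matrix.vec (dim_vec \<eta>) \<omega>)) \<eta> \<partial>gauss_law \<eta> s2)"

definition max_norm :: "real vec \<Rightarrow> real" where
  "max_norm h = Max ((\<lambda>i. \<bar>h $ i\<bar>) ` {..<dim_vec h})"

text \<open>The means \<open>\<eta> = X\<mu>\<close> with \<open>\<parallel>\<xi>\<parallel> \<le> c\<close>. Since \<open>\<xi> = U'\<eta>\<close> depends on the penalty basis, the bound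
  is imposed for every candidate basis in \<open>Us\<close>.\<close>

definition means :: "real mat \<Rightarrow> real mat set \<Rightarrow> real \<Rightarrow> real vec set" where
  "means X Us c = {X *\<^sub>v \<mu> | \<mu>. \<mu> \<in> carrier_vec (dim_col X) \<and>
                     (\<forall>U\<in>Us. max_norm (transpose_mat U *\<^sub>v (X *\<^sub>v \<mu>)) \<le> c)}"

section \<open>Candidate estimators and estimated risks\<close>

definition shrink :: "real mat \<Rightarrow> real vec \<Rightarrow> real vec \<Rightarrow> real vec" where
  "shrink U f y = U *\<^sub>v (mat_diag (dim_col U) (\<lambda>i. f $ i) *\<^sub>v (transpose_mat U *\<^sub>v y))"

definition F_MS :: "nat \<Rightarrow> real vec set" where
  "F_MS p = {f \<in> carrier_vec p. (\<forall>i<p. 0 \<le> f $ i \<and> f $ i \<le> 1) \<and>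
                               (\<forall>i j. i \<le> j \<and> j < p \<longrightarrow> f $ j \<le> f $ i)}"

definition est_MS :: "real mat \<Rightarrow> real vec \<Rightarrow> real vec \<Rightarrow> real vec" where
  "est_MS U f y = shrink U f y"

text \<open>In the estimated risks, \<open>s\<close> is the value of the variance estimator and \<open>z = U'y\<close>.\<close>

definition rhat_MS :: "real \<Rightarrow> real vec \<Rightarrow> real vec \<Rightarrow> real" where
  "rhat_MS s f z =
     (\<Sum>i<dim_vec z. (f $ i)\<^sup>2 * s + (1 - f $ i)\<^sup>2 * ((z $ i)\<^sup>2 - s)) / real (dim_vec z)"

text \<open>The class \<open>\<F>\<^sub>S\<^sub>T\<close> is \<open>{h_ST t z | t. t \<ge> 0}\<close> and is indexed by \<open>t\<close> throughout. At \<open>x = 0\<close> the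
  quotient \<open>t / \<bar>x\<bar>\<close> is read as infinite.\<close>

definition soft_weight :: "real \<Rightarrow> real \<Rightarrow> real" where
  "soft_weight t x = (if x = 0 then 0 else max 0 (1 - t / \<bar>x\<bar>))"

definition h_ST :: "real \<Rightarrow> real vec \<Rightarrow> real vec" where
  "h_ST t z = Matrix.vec (dim_vec z) (\<lambda>i. soft_weight t (z $ i))"

definition est_ST :: "real mat \<Rightarrow> real \<Rightarrow> real vec \<Rightarrow> real vec" where
  "est_ST U t y = shrink U (h_ST t (transpose_mat U *\<^sub>v y)) y"

text \<open>The empirical distribution of the \<open>\<bar>z\<^sub>i\<bar>\<close>; meaningful only for nonempty
  \<open>z\<close>. For empty \<open>z\<close>, \<open>rhat_ST\<close> occurs only with the factor \<open>p\<^sub>2 = 0\<close>.\<close>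

definition empirical_abs :: "real vec \<Rightarrow> real pmf" where
  "empirical_abs z = map_pmf (\<lambda>i. \<bar>z $ i\<bar>) (pmf_of_set {..<dim_vec z})"

definition rhat_ST :: "real \<Rightarrow> real \<Rightarrow> real vec \<Rightarrow> real" where
  "rhat_ST s t z =
     s * (1 - 2 * cdf (measure_pmf (empirical_abs z)) t) +
     measure_pmf.expectation (empirical_abs z) (\<lambda>u. (min u t)\<^sup>2)"

definition split_index :: "nat \<Rightarrow> real \<Rightarrow> nat" where
  "split_index p \<alpha> = nat \<lfloor>\<alpha> * real p\<rfloor>"

text \<open>An element of \<open>\<F>\<^sub>H\<^sub>S\<close> is given by its monotone part \<open>f\<close> and the threshold \<open>t\<close> of its second part.\<close>

definition F_HS :: "nat \<Rightarrow> real \<Rightarrow> (real vec \<times> real) set" where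
  "F_HS p \<alpha> = F_MS (split_index p \<alpha>) \<times> {0..}"

definition est_HS :: "real mat \<Rightarrow> real \<Rightarrow> real vec \<Rightarrow> real \<Rightarrow> real vec \<Rightarrow> real vec" where
  "est_HS U \<alpha> f t y =
     (let z = transpose_mat U *\<^sub>v y; p = dim_vec z; p2 = p - split_index p \<alpha>
      in shrink U (f @\<^sub>v h_ST t (vec_last z p2)) y)"

definition rhat_HS :: "real \<Rightarrow> real \<Rightarrow> real vec \<Rightarrow> real \<Rightarrow> real vec \<Rightarrow> real" where
  "rhat_HS s \<alpha> f t z =
     (let p = dim_vec z; p1 = split_index p \<alpha>; p2 = p - p1
      in (real p1 * rhat_MS s f (vec_first z p1) + real p2 * rhat_ST s t (vec_last z p2)) / real p)"

section \<open>Asymptotic statements\<close>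

text \<open>
  Common arguments: \<open>H p c\<close> is the set of means over which suprema are taken; \<open>I p\<close> indexes the
  candidates, \<open>est p i\<close> is the candidate with index \<open>i\<close> and \<open>rhat p i y\<close> its estimated risk at \<open>y\<close>;
  \<open>sel p y\<close> is the index selected from the data \<open>y\<close>.
\<close>

definition weighted_consistent ::
  "(nat \<Rightarrow> nat) \<Rightarrow> (nat \<Rightarrow> real \<Rightarrow> real vec set) \<Rightarrow> (nat \<Rightarrow> real vec \<Rightarrow> real) \<Rightarrow> bool" where
  "weighted_consistent w H sig2 \<longleftrightarrow>
     (\<forall>c>0. \<forall>s2>0.
        (\<lambda>p. of_nat (w p) * (SUP \<eta>\<in>H p c. expect \<eta> s2 (\<lambda>y. ennreal \<bar>sig2 p y - s2\<bar>)))
          \<longlonglongrightarrow> 0)"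

text \<open>The selected index need not be a measurable function of \<open>y\<close> (nor unique), but the resulting
  adaptive estimator has to be.\<close>

definition minimizes_estimated_risk ::
  "(nat \<Rightarrow> nat) \<Rightarrow> (nat \<Rightarrow> 'i set) \<Rightarrow> (nat \<Rightarrow> 'i \<Rightarrow> real vec \<Rightarrow> real vec) \<Rightarrow>
   (nat \<Rightarrow> 'i \<Rightarrow> real vec \<Rightarrow> real) \<Rightarrow> (nat \<Rightarrow> real vec \<Rightarrow> 'i) \<Rightarrow> bool" where
  "minimizes_estimated_risk n I est rhat sel \<longleftrightarrow>
     (\<forall>p>0. (\<forall>y\<in>carrier_vec (n p). is_arg_min (\<lambda>i. rhat p i y) (\<lambda>i. i \<in> I p) (sel p y)) \<and>
            (\<forall>j<n p. statistic (n p) (\<lambda>y. est p (sel p y) y $ j)))"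

definition convergence_A ::
  "(nat \<Rightarrow> real \<Rightarrow> real vec set) \<Rightarrow> (nat \<Rightarrow> 'i set) \<Rightarrow> (nat \<Rightarrow> 'i \<Rightarrow> real vec \<Rightarrow> real vec) \<Rightarrow>
   (nat \<Rightarrow> 'i \<Rightarrow> real vec \<Rightarrow> real) \<Rightarrow> bool" where
  "convergence_A H I est rhat \<longleftrightarrow>
     (\<forall>V \<in> {\<lambda>p i \<eta> y. loss p (est p i y) \<eta>, \<lambda>p i \<eta> y. rhat p i y}. \<forall>c>0. \<forall>s2>0.
        (\<lambda>p. SUP \<eta>\<in>H p c. expect \<eta> s2
               (\<lambda>y. SUP i\<in>I p. ennreal \<bar>V p i \<eta> y - risk p \<eta> s2 (est p i)\<bar>))
          \<longlonglongrightarrow> 0)"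

text \<open>The minimal risk is an infimum: over thresholds \<open>t \<in> [0,\<infinity>)\<close> it need not be attained
  (for \<open>\<xi> = 0\<close> the risk strictly decreases to 0).\<close>

definition convergence_B ::
  "(nat \<Rightarrow> real \<Rightarrow> real vec set) \<Rightarrow> (nat \<Rightarrow> 'i set) \<Rightarrow> (nat \<Rightarrow> 'i \<Rightarrow> real vec \<Rightarrow> real vec) \<Rightarrow>
   (nat \<Rightarrow> real vec \<Rightarrow> 'i) \<Rightarrow> bool" where
  "convergence_B H I est sel \<longleftrightarrow>
     (\<forall>c>0. \<forall>s2>0.
        (\<lambda>p. SUP \<eta>\<in>H p c.
               ennreal \<bar>risk p \<eta> s2 (\<lambda>y. est p (sel p y) y) - (INF i\<in>I p. risk p \<eta> s2 (est p i))\<bar>)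
          \<longlonglongrightarrow> 0)"

definition convergence_C ::
  "(nat \<Rightarrow> real \<Rightarrow> real vec set) \<Rightarrow> (nat \<Rightarrow> 'i \<Rightarrow> real vec \<Rightarrow> real vec) \<Rightarrow>
   (nat \<Rightarrow> 'i \<Rightarrow> real vec \<Rightarrow> real) \<Rightarrow> (nat \<Rightarrow> real vec \<Rightarrow> 'i) \<Rightarrow> bool" where
  "convergence_C H est rhat sel \<longleftrightarrow>
     (\<forall>W \<in> {\<lambda>p \<eta> s2 y. loss p (est p (sel p y) y) \<eta>,
            \<lambda>p \<eta> s2 y. risk p \<eta> s2 (\<lambda>y'. est p (sel p y') y')}. \<forall>c>0. \<forall>s2>0.
        (\<lambda>p. SUP \<eta>\<in>H p c. expect \<eta> s2 (\<lambda>y. ennreal \<bar>rhat p (sel p y) y - W p \<eta> s2 y\<bar>))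
          \<longlonglongrightarrow> 0)"

text \<open>The selection-dependent convergences are claimed for every admissible data-based selection.\<close>

definition convergences_ABC ::
  "(nat \<Rightarrow> nat) \<Rightarrow> (nat \<Rightarrow> real \<Rightarrow> real vec set) \<Rightarrow> (nat \<Rightarrow> 'i set) \<Rightarrow>
   (nat \<Rightarrow> 'i \<Rightarrow> real vec \<Rightarrow> real vec) \<Rightarrow> (nat \<Rightarrow> 'i \<Rightarrow> real vec \<Rightarrow> real) \<Rightarrow> bool" where
  "convergences_ABC n H I est rhat \<longleftrightarrow>
     convergence_A H I est rhat \<and>
     (\<forall>sel. minimizes_estimated_risk n I est rhat sel \<longrightarrow>
        convergence_B H I est sel \<and> convergence_C H est rhat sel)"

end

theory Submission
  imports Defs "Jordan_Normal_Form.Determinant" "HOL-Real_Asymp.Real_Asymp"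
begin

text \<open>
  The coordinates of \<open>z = U'y\<close> are pairwise independent with laws \<open>N(\<xi>\<^sub>i, \<sigma>\<^sup>2)\<close>, and all losses and estimated
  risks are averages over \<open>i\<close> of functions of \<open>(\<xi>\<^sub>i, z\<^sub>i)\<close>. A monotone weight vector is removed by summation
  by parts, which leaves partial sums; a threshold \<open>t\<close> is replaced by the nearest point of a finite grid,
  with an error of small expectation. Partial sums are in turn reduced to a fixed finite number of blocks,
  whose second moments are of order \<open>1 / p\<close>, so the supremum over \<open>\<D>\<close> costs only a factor \<open>#\<D>\<close>. Stein's
  identity shows that the estimated risk with \<open>\<sigma>\<^sup>2\<close> in place of its estimate is unbiased. Loss and
  estimated risk are thus uniformly close to the risk over all candidates and all split indices at once,
  and the statements on the minimizer follow.
\<close>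

section \<open>Moments under the normal law\<close>

text \<open>The loss is quadratic in the weight, so its deviation from the risk combines centred
  averages with coefficients \<open>f i\<close> and \<open>(f i)\<^sup>2\<close>. Both are
  decreasing sequences in [0,1], which is why summation by parts disposes of the whole monotone
  class at once. Thresholding resists this because the estimated risk jumps in t: moving t to a grid
  point causes an error that is small only in mean, and the bound for that mean comes from the
  boundedness of the normal density. Every grid and every number of blocks is fixed before p tends
  to infinity and depends on the accuracy alone; otherwise second moments could not pay for the
  maxima. Uniformity over the means comes from one class of functions with quartic growth around m,
  whose moment bounds do not depend on m. An abstract array separates all this from the matrices and
  retains three facts about the coordinates: they are normal, pairwise independent, and have means
  bounded by c. The growth conditions enter in the form
  \<open>card (\<D> p) / p \<longlonglongrightarrow> 0\<close>.\<close>

definition gauss :: "real \<Rightarrow> real \<Rightarrow> real measure" where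
  "gauss s2 m = density lborel (\<lambda>x. ennreal (normal_density m (sqrt s2) x))"

lemma sets_gauss [measurable_cong, simp]: "sets (gauss s2 m) = sets borel"
  by (simp add: gauss_def)

lemma space_gauss [simp]: "space (gauss s2 m) = UNIV"
  by (simp add: gauss_def)

lemma prob_space_gauss: "s2 > 0 \<Longrightarrow> prob_space (gauss s2 m)"
  unfolding gauss_def by (rule prob_space_normal_density) simp

lemma integrable_gauss_iff:
  fixes f :: "real \<Rightarrow> real"
  assumes "f \<in> borel_measurable borel"
  shows "integrable (gauss s2 m) f \<longleftrightarrow> integrable lborel (\<lambda>x. normal_density m (sqrt s2) x * f x)"
  unfolding gauss_def using assms by (subst integrable_density) auto

lemma integral_gauss:
  fixes f :: "real \<Rightarrow> real"
  assumes "f \<in> borel_measurable borel"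
  shows "integral\<^sup>L (gauss s2 m) f = (\<integral>x. normal_density m (sqrt s2) x * f x \<partial>lborel)"
  unfolding gauss_def using assms by (subst integral_density) auto

lemma integrable_gauss_power:
  assumes "s2 > 0"
  shows "integrable (gauss s2 m) (\<lambda>x. (x - m) ^ k)"
  using assms by (subst integrable_gauss_iff) (auto intro!: integrable_normal_moment)

lemma integral_gauss_even_power:
  assumes "s2 > 0"
  shows "(\<integral>x. (x - m) ^ (2 * k) \<partial>gauss s2 m) = fact (2 * k) / ((2 / s2) ^ k * fact k)"
  using assms by (subst integral_gauss) (auto simp: integral_normal_moment_even)

lemma integral_gauss_odd_power:
  assumes "s2 > 0"
  shows "(\<integral>x. (x - m) ^ (2 * k + 1) \<partial>gauss s2 m) = 0"
  using assms integral_normal_moment_odd[of "sqrt s2" m k] by (subst integral_gauss) auto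

text \<open>Suprema over uncountable index sets and data-selected indices need not be measurable, and the integral of
  a sum of non-measurable functions need not split. Hence everything is bounded by a measurable envelope.\<close>

definition small_envelope :: "'a measure \<Rightarrow> real \<Rightarrow> ('a \<Rightarrow> real) \<Rightarrow> bool" where
  "small_envelope M e B \<longleftrightarrow> B \<in> borel_measurable M \<and> (\<forall>x\<in>space M. 0 \<le> B x) \<and>
     (\<integral>\<^sup>+x. ennreal (B x) \<partial>M) \<le> ennreal e"

lemma small_envelope_add:
  assumes A: "small_envelope M a A" and B: "small_envelope M b B" and ab: "0 \<le> a" "0 \<le> b"
  shows "small_envelope M (a + b) (\<lambda>x. A x + B x)"
proof -
  have [measurable]: "A \<in> borel_measurable M" "B \<in> borel_measurable M"
    using A B by (auto simp: small_envelope_def)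
  have "(\<integral>\<^sup>+x. ennreal (A x + B x) \<partial>M) = (\<integral>\<^sup>+x. ennreal (A x) + ennreal (B x) \<partial>M)"
    using A B by (intro nn_integral_cong) (auto simp: small_envelope_def ennreal_plus)
  also have "\<dots> = (\<integral>\<^sup>+x. ennreal (A x) \<partial>M) + (\<integral>\<^sup>+x. ennreal (B x) \<partial>M)"
    by (simp add: nn_integral_add)
  also have "\<dots> \<le> ennreal a + ennreal b"
    using A B by (intro add_mono) (auto simp: small_envelope_def)
  also have "\<dots> = ennreal (a + b)" using ab by simp
  finally show ?thesis using A B by (auto simp: small_envelope_def)
qed

lemma (in prob_space) small_envelope_const: "0 \<le> a \<Longrightarrow> small_envelope M a (\<lambda>_. a)"
  by (simp add: small_envelope_def emeasure_space_1)

section \<open>Functions of quartic growth, with moments uniform in the mean\<close>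

locale gaussian_noise =
  fixes c s2 :: real
  assumes c_pos: "c > 0" and s2_pos: "s2 > 0"
begin

text \<open>Losses and estimated risks grow quadratically; the quartic bound leaves room for a
  further factor, such as an approximation error of order \<open>\<delta> * (1 + x\<^sup>2)\<close>.
  Centring the power at m makes its moments independent of m, so one constant serves all means with
  absolute value at most c.\<close>

definition tame :: "(real \<Rightarrow> real \<Rightarrow> real) \<Rightarrow> bool" where
  "tame \<phi> \<longleftrightarrow> (\<forall>m. \<phi> m \<in> borel_measurable borel) \<and>
     (\<exists>K\<ge>0. \<forall>m x. \<bar>m\<bar> \<le> c \<longrightarrow> \<bar>\<phi> m x\<bar> \<le> K * (1 + (x - m) ^ 4))"

definition mean :: "(real \<Rightarrow> real \<Rightarrow> real) \<Rightarrow> real \<Rightarrow> real" where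
  "mean \<phi> m = integral\<^sup>L (gauss s2 m) (\<phi> m)"

lemma tameI:
  assumes "\<And>m. \<phi> m \<in> borel_measurable borel"
    and "\<And>m x. \<bar>m\<bar> \<le> c \<Longrightarrow> \<bar>\<phi> m x\<bar> \<le> K * (1 + (x - m) ^ 4)"
  shows "tame \<phi>"
proof -
  have "\<bar>\<phi> m x\<bar> \<le> max K 0 * (1 + (x - m) ^ 4)" if "\<bar>m\<bar> \<le> c" for m x
  proof -
    have "K * (1 + (x - m) ^ 4) \<le> max K 0 * (1 + (x - m) ^ 4)"
      by (intro mult_right_mono) auto
    then show ?thesis using assms(2)[OF that, of x] by linarith
  qed
  then show ?thesis unfolding tame_def using assms(1) by (meson max.cobounded2)
qed

lemma tame_measurable: "tame \<phi> \<Longrightarrow> \<phi> m \<in> borel_measurable borel"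
  by (auto simp: tame_def)

lemma tameE:
  assumes "tame \<phi>"
  obtains K where "K \<ge> 0" "\<And>m x. \<bar>m\<bar> \<le> c \<Longrightarrow> \<bar>\<phi> m x\<bar> \<le> K * (1 + (x - m) ^ 4)"
  using assms by (auto simp: tame_def)

lemma integrable_weight: "integrable (gauss s2 m) (\<lambda>x. 1 + (x - m) ^ 4)"
proof -
  interpret prob_space "gauss s2 m" using s2_pos by (rule prob_space_gauss)
  show ?thesis using integrable_gauss_power[OF s2_pos, of m 4] by auto
qed

lemma weight_square: "(1 + (y::real) ^ 4)\<^sup>2 = 1 + 2 * y ^ 4 + y ^ 8"
  by (simp add: power2_eq_square algebra_simps flip: power_add)

lemma integrable_weight_square: "integrable (gauss s2 m) (\<lambda>x. (1 + (x - m) ^ 4)\<^sup>2)"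
proof -
  interpret prob_space "gauss s2 m" using s2_pos by (rule prob_space_gauss)
  show ?thesis
    unfolding weight_square
    using integrable_gauss_power[OF s2_pos, of m 4] integrable_gauss_power[OF s2_pos, of m 8] by auto
qed

lemma integral_weight: "(\<integral>x. 1 + (x - m) ^ 4 \<partial>gauss s2 m) = 1 + 3 * s2\<^sup>2"
proof -
  interpret prob_space "gauss s2 m" using s2_pos by (rule prob_space_gauss)
  have "(\<integral>x. 1 + (x - m) ^ 4 \<partial>gauss s2 m) = 1 + (\<integral>x. (x - m) ^ 4 \<partial>gauss s2 m)"
    using integrable_gauss_power[OF s2_pos, of m 4]
    by (subst Bochner_Integration.integral_add) (auto simp: prob_space[simplified])
  also have "(\<integral>x. (x - m) ^ 4 \<partial>gauss s2 m) = 3 * s2\<^sup>2"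
    using integral_gauss_even_power[OF s2_pos, of m 2]
    by (simp add: fact_numeral power2_eq_square field_simps)
  finally show ?thesis .
qed

text \<open>The fourth and eighth central moments are \<open>3 * s2\<^sup>2\<close> and
  \<open>105 * s2 ^ 4\<close>; the first of them occurs twice in the expanded square.\<close>

lemma integral_weight_square:
  "(\<integral>x. (1 + (x - m) ^ 4)\<^sup>2 \<partial>gauss s2 m) = 1 + 6 * s2\<^sup>2 + 105 * s2 ^ 4"
proof -
  interpret prob_space "gauss s2 m" using s2_pos by (rule prob_space_gauss)
  have "(\<integral>x. (1 + (x - m) ^ 4)\<^sup>2 \<partial>gauss s2 m) =
      1 + 2 * (\<integral>x. (x - m) ^ 4 \<partial>gauss s2 m) + (\<integral>x. (x - m) ^ 8 \<partial>gauss s2 m)"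
    unfolding weight_square
    using integrable_gauss_power[OF s2_pos, of m 4] integrable_gauss_power[OF s2_pos, of m 8]
    by (subst Bochner_Integration.integral_add; (subst Bochner_Integration.integral_add)?)
      (auto simp: prob_space[simplified])
  also have "(\<integral>x. (x - m) ^ 4 \<partial>gauss s2 m) = 3 * s2\<^sup>2"
    using integral_gauss_even_power[OF s2_pos, of m 2]
    by (simp add: fact_numeral power2_eq_square field_simps)
  also have "(\<integral>x. (x - m) ^ 8 \<partial>gauss s2 m) = 105 * s2 ^ 4"
    using integral_gauss_even_power[OF s2_pos, of m 4] s2_pos
    by (simp add: fact_numeral field_simps)
  finally show ?thesis by simp
qed

lemma tame_integrable:
  assumes "tame \<phi>" "\<bar>m\<bar> \<le> c"
  shows "integrable (gauss s2 m) (\<phi> m)"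
proof -
  obtain K where K: "K \<ge> 0" "\<And>m x. \<bar>m\<bar> \<le> c \<Longrightarrow> \<bar>\<phi> m x\<bar> \<le> K * (1 + (x - m) ^ 4)"
    using tameE[OF assms(1)] by blast
  show ?thesis
  proof (rule Bochner_Integration.integrable_bound)
    show "integrable (gauss s2 m) (\<lambda>x. K * (1 + (x - m) ^ 4))"
      using integrable_weight by (rule integrable_mult_right)
    show "\<phi> m \<in> borel_measurable (gauss s2 m)"
      using tame_measurable[OF assms(1)] by simp
    show "AE x in gauss s2 m. norm (\<phi> m x) \<le> norm (K * (1 + (x - m) ^ 4))"
      using K assms(2) by (intro AE_I2) (force intro: order_trans[OF _ abs_ge_self])
  qed
qed

lemma tame_square_integrable:
  assumes "tame \<phi>" "\<bar>m\<bar> \<le> c"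
  shows "integrable (gauss s2 m) (\<lambda>x. (\<phi> m x)\<^sup>2)"
proof -
  obtain K where K: "K \<ge> 0" "\<And>m x. \<bar>m\<bar> \<le> c \<Longrightarrow> \<bar>\<phi> m x\<bar> \<le> K * (1 + (x - m) ^ 4)"
    using tameE[OF assms(1)] by blast
  note [measurable] = tame_measurable[OF assms(1)]
  show ?thesis
  proof (rule Bochner_Integration.integrable_bound)
    show "integrable (gauss s2 m) (\<lambda>x. K\<^sup>2 * (1 + (x - m) ^ 4)\<^sup>2)"
      using integrable_weight_square by (rule integrable_mult_right)
    show "(\<lambda>x. (\<phi> m x)\<^sup>2) \<in> borel_measurable (gauss s2 m)" by measurable
    show "AE x in gauss s2 m. norm ((\<phi> m x)\<^sup>2) \<le> norm (K\<^sup>2 * (1 + (x - m) ^ 4)\<^sup>2)"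
      using K(2)[OF assms(2)]
      by (intro AE_I2) (auto simp flip: power_mult_distrib simp: abs_le_square_iff[symmetric] intro: order_trans[OF _ abs_ge_self])
  qed
qed

lemma tame_square_bound:
  assumes "tame \<phi>"
  obtains C where "C \<ge> 0" "\<And>m. \<bar>m\<bar> \<le> c \<Longrightarrow> (\<integral>x. (\<phi> m x)\<^sup>2 \<partial>gauss s2 m) \<le> C"
proof -
  obtain K where K: "K \<ge> 0" "\<And>m x. \<bar>m\<bar> \<le> c \<Longrightarrow> \<bar>\<phi> m x\<bar> \<le> K * (1 + (x - m) ^ 4)"
    using tameE[OF assms(1)] by blast
  have "(\<integral>x. (\<phi> m x)\<^sup>2 \<partial>gauss s2 m) \<le> K\<^sup>2 * (1 + 6 * s2\<^sup>2 + 105 * s2 ^ 4)" if "\<bar>m\<bar> \<le> c" for m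
  proof -
    have "(\<integral>x. (\<phi> m x)\<^sup>2 \<partial>gauss s2 m) \<le> (\<integral>x. K\<^sup>2 * (1 + (x - m) ^ 4)\<^sup>2 \<partial>gauss s2 m)"
      using K(2)[OF that]
      by (intro integral_mono tame_square_integrable assms that integrable_mult_right integrable_weight_square)
        (auto simp flip: power_mult_distrib simp: abs_le_square_iff[symmetric] intro: order_trans[OF _ abs_ge_self])
    also have "\<dots> = K\<^sup>2 * (1 + 6 * s2\<^sup>2 + 105 * s2 ^ 4)"
      by (simp add: integral_weight_square)
    finally show ?thesis .
  qed
  moreover have "K\<^sup>2 * (1 + 6 * s2\<^sup>2 + 105 * s2 ^ 4) \<ge> 0" by simp
  ultimately show thesis using that by blast
qed

lemma tame_mean_bound:
  assumes "tame \<phi>"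
  obtains C where "C \<ge> 0" "\<And>m. \<bar>m\<bar> \<le> c \<Longrightarrow> (\<integral>x. \<bar>\<phi> m x\<bar> \<partial>gauss s2 m) \<le> C"
    "\<And>m. \<bar>m\<bar> \<le> c \<Longrightarrow> \<bar>mean \<phi> m\<bar> \<le> C"
proof -
  obtain K where K: "K \<ge> 0" "\<And>m x. \<bar>m\<bar> \<le> c \<Longrightarrow> \<bar>\<phi> m x\<bar> \<le> K * (1 + (x - m) ^ 4)"
    using tameE[OF assms(1)] by blast
  have *: "(\<integral>x. \<bar>\<phi> m x\<bar> \<partial>gauss s2 m) \<le> K * (1 + 3 * s2\<^sup>2)" if "\<bar>m\<bar> \<le> c" for m
  proof -
    have "(\<integral>x. \<bar>\<phi> m x\<bar> \<partial>gauss s2 m) \<le> (\<integral>x. K * (1 + (x - m) ^ 4) \<partial>gauss s2 m)"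
      using K(2)[OF that]
      by (intro integral_mono integrable_abs tame_integrable assms that integrable_mult_right integrable_weight)
    also have "\<dots> = K * (1 + 3 * s2\<^sup>2)"
      by (simp only: integral_mult_right_zero integral_weight)
    finally show ?thesis .
  qed
  have "\<bar>mean \<phi> m\<bar> \<le> (\<integral>x. \<bar>\<phi> m x\<bar> \<partial>gauss s2 m)" for m
    unfolding mean_def by (rule integral_abs_bound)
  then have "\<bar>mean \<phi> m\<bar> \<le> K * (1 + 3 * s2\<^sup>2)" if "\<bar>m\<bar> \<le> c" for m
    using *[OF that] order_trans by blast
  moreover have "K * (1 + 3 * s2\<^sup>2) \<ge> 0" using K by simp
  ultimately show thesis using that * by blast
qed

lemma tame_const: "tame (\<lambda>m x. k)"
proof (rule tameI)
  fix m x :: real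
  have "\<bar>k\<bar> * 1 \<le> \<bar>k\<bar> * (1 + (x - m) ^ 4)" by (intro mult_left_mono) auto
  then show "\<bar>k\<bar> \<le> \<bar>k\<bar> * (1 + (x - m) ^ 4)" by simp
qed auto

lemma tame_cmult:
  assumes "tame \<phi>"
  shows "tame (\<lambda>m x. k * \<phi> m x)"
proof -
  obtain K where K: "K \<ge> 0" "\<And>m x. \<bar>m\<bar> \<le> c \<Longrightarrow> \<bar>\<phi> m x\<bar> \<le> K * (1 + (x - m) ^ 4)"
    using tameE[OF assms(1)] by blast
  show ?thesis
    using K tame_measurable[OF assms]
    by (intro tameI[where K="\<bar>k\<bar> * K"]) (auto simp: abs_mult mult.assoc intro!: mult_left_mono)
qed

lemma tame_add:
  assumes "tame \<phi>" "tame \<psi>"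
  shows "tame (\<lambda>m x. \<phi> m x + \<psi> m x)"
proof -
  obtain K where K: "K \<ge> 0" "\<And>m x. \<bar>m\<bar> \<le> c \<Longrightarrow> \<bar>\<phi> m x\<bar> \<le> K * (1 + (x - m) ^ 4)"
    using tameE[OF assms(1)] by blast
  obtain L where L: "L \<ge> 0" "\<And>m x. \<bar>m\<bar> \<le> c \<Longrightarrow> \<bar>\<psi> m x\<bar> \<le> L * (1 + (x - m) ^ 4)"
    using tameE[OF assms(2)] by blast
  show ?thesis
  proof (rule tameI[where K="K + L"])
    show "(\<lambda>x. \<phi> m x + \<psi> m x) \<in> borel_measurable borel" for m
      using tame_measurable[OF assms(1)] tame_measurable[OF assms(2)] by measurable
    show "\<bar>\<phi> m x + \<psi> m x\<bar> \<le> (K + L) * (1 + (x - m) ^ 4)" if "\<bar>m\<bar> \<le> c" for m x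
      using K(2)[OF that, of x] L(2)[OF that, of x] unfolding distrib_right by linarith
  qed
qed

lemma tame_dominated:
  assumes "tame \<psi>" "\<And>m. \<phi> m \<in> borel_measurable borel"
    "\<And>m x. \<bar>m\<bar> \<le> c \<Longrightarrow> \<bar>\<phi> m x\<bar> \<le> \<bar>\<psi> m x\<bar>"
  shows "tame \<phi>"
proof -
  obtain K where K: "K \<ge> 0" "\<And>m x. \<bar>m\<bar> \<le> c \<Longrightarrow> \<bar>\<psi> m x\<bar> \<le> K * (1 + (x - m) ^ 4)"
    using tameE[OF assms(1)] by blast
  show ?thesis
    using K(2) assms(2,3) by (intro tameI[where K=K]) (meson order_trans)+
qed

lemma mean_add: "tame \<phi> \<Longrightarrow> tame \<psi> \<Longrightarrow> \<bar>m\<bar> \<le> c \<Longrightarrow>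
    mean (\<lambda>m x. \<phi> m x + \<psi> m x) m = mean \<phi> m + mean \<psi> m"
  unfolding mean_def by (intro Bochner_Integration.integral_add tame_integrable)

lemma mean_cmult: "mean (\<lambda>m x. k * \<phi> m x) m = k * mean \<phi> m"
  unfolding mean_def by simp

text \<open>The mean is bounded uniformly on \<bar>m\<bar> \<le> c and the quartic weight is at
  least 1, so centring stays inside the class and the second-moment bound applies to
  deviations.\<close>

lemma tame_minus_mean:
  assumes "tame \<phi>" 
  shows "tame (\<lambda>m x. \<phi> m x - mean \<phi> m)"
proof -
  obtain C where C: "C \<ge> 0" "\<And>m. \<bar>m\<bar> \<le> c \<Longrightarrow> \<bar>mean \<phi> m\<bar> \<le> C"
    using tame_mean_bound[OF assms] by metis
  obtain K where K: "K \<ge> 0" "\<And>m x. \<bar>m\<bar> \<le> c \<Longrightarrow> \<bar>\<phi> m x\<bar> \<le> K * (1 + (x - m) ^ 4)"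
    using tameE[OF assms(1)] by blast
  show ?thesis
  proof (rule tameI[where K="K + C"])
    show "(\<lambda>x. \<phi> m x - mean \<phi> m) \<in> borel_measurable borel" for m
      using tame_measurable[OF assms(1)] by measurable
    show "\<bar>\<phi> m x - mean \<phi> m\<bar> \<le> (K + C) * (1 + (x - m) ^ 4)" if "\<bar>m\<bar> \<le> c" for m x
    proof -
      have "C * 1 \<le> C * (1 + (x - m) ^ 4)" using C by (intro mult_left_mono) auto
      then show ?thesis using K(2)[OF that, of x] C(2)[OF that] unfolding distrib_right by linarith
    qed
  qed
qed

end

section \<open>Uniformly negligible families\<close>

text \<open>Only second moments of sums are used, so pairwise independence suffices.\<close>

locale gaussian_array = gaussian_noise c s2 for c s2 :: real +
  fixes M :: "nat \<Rightarrow> 'h \<Rightarrow> 'a measure" and H :: "nat \<Rightarrow> 'h set" and Ds :: "nat \<Rightarrow> 'd set"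
    and Z :: "nat \<Rightarrow> 'd \<Rightarrow> nat \<Rightarrow> 'a \<Rightarrow> real" and xi :: "nat \<Rightarrow> 'h \<Rightarrow> 'd \<Rightarrow> nat \<Rightarrow> real"
  assumes prob: "p > 0 \<Longrightarrow> h \<in> H p \<Longrightarrow> prob_space (M p h)"
    and Z_measurable: "p > 0 \<Longrightarrow> h \<in> H p \<Longrightarrow> D \<in> Ds p \<Longrightarrow> i < p \<Longrightarrow> Z p D i \<in> borel_measurable (M p h)"
    and Z_law: "p > 0 \<Longrightarrow> h \<in> H p \<Longrightarrow> D \<in> Ds p \<Longrightarrow> i < p \<Longrightarrow>
      distr (M p h) borel (Z p D i) = gauss s2 (xi p h D i)"
    and Z_indep: "p > 0 \<Longrightarrow> h \<in> H p \<Longrightarrow> D \<in> Ds p \<Longrightarrow> i < p \<Longrightarrow> j < p \<Longrightarrow> i \<noteq> j \<Longrightarrow>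
      prob_space.indep_var (M p h) borel (Z p D i) borel (Z p D j)"
    and xi_bound: "p > 0 \<Longrightarrow> h \<in> H p \<Longrightarrow> D \<in> Ds p \<Longrightarrow> i < p \<Longrightarrow> \<bar>xi p h D i\<bar> \<le> c"
    and Ds_finite: "finite (Ds p)"
    and Ds_card: "(\<lambda>p. real (card (Ds p)) / real p) \<longlonglongrightarrow> 0"
begin

definition dev :: "(real \<Rightarrow> real \<Rightarrow> real) \<Rightarrow> nat \<Rightarrow> 'h \<Rightarrow> 'd \<Rightarrow> nat \<Rightarrow> 'a \<Rightarrow> real" where
  "dev \<phi> p h D i x = \<phi> (xi p h D i) (Z p D i x) - mean \<phi> (xi p h D i)"

text \<open>This encodes that the supremum over h of the expected supremum over i of \<bar>F\<bar>
  tends to 0. The envelope may depend on p and h but not on the index i, and p is chosen before h,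
  which gives uniformity over the means.\<close>

definition negl :: "(nat \<Rightarrow> 'i set) \<Rightarrow> (nat \<Rightarrow> 'h \<Rightarrow> 'i \<Rightarrow> 'a \<Rightarrow> real) \<Rightarrow> bool" where
  "negl I F \<longleftrightarrow> (\<forall>e>0. \<forall>\<^sub>F p in sequentially. \<forall>h\<in>H p. \<exists>B. small_envelope (M p h) e B \<and>
     (\<forall>x\<in>space (M p h). \<forall>i\<in>I p. \<bar>F p h i x\<bar> \<le> B x))"

lemma expectation_Z:
  assumes "p > 0" "h \<in> H p" "D \<in> Ds p" "i < p" "f \<in> borel_measurable borel"
  shows "(\<integral>x. f (Z p D i x) \<partial>M p h) = integral\<^sup>L (gauss s2 (xi p h D i)) (f :: real \<Rightarrow> real)"
  using assms by (subst Z_law[symmetric]) (auto intro!: integral_distr[symmetric] Z_measurable)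

lemma integrable_Z:
  assumes "p > 0" "h \<in> H p" "D \<in> Ds p" "i < p" "f \<in> borel_measurable borel"
    "integrable (gauss s2 (xi p h D i)) (f :: real \<Rightarrow> real)"
  shows "integrable (M p h) (\<lambda>x. f (Z p D i x))"
  using assms Z_law[OF assms(1-4)] integrable_distr_eq[of "Z p D i" "M p h" borel f] Z_measurable
  by auto

lemma tame_integrable_Z:
  assumes "p > 0" "h \<in> H p" "D \<in> Ds p" "i < p" "tame \<phi>"
  shows "integrable (M p h) (\<lambda>x. \<phi> (xi p h D i) (Z p D i x))"
  using assms by (intro integrable_Z tame_measurable tame_integrable xi_bound)

lemma tame_expectation_Z:
  assumes "p > 0" "h \<in> H p" "D \<in> Ds p" "i < p" "tame \<phi>"
  shows "(\<integral>x. \<phi> (xi p h D i) (Z p D i x) \<partial>M p h) = mean \<phi> (xi p h D i)"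
  using assms unfolding mean_def by (intro expectation_Z tame_measurable)

text \<open>Pairwise independence and centring annihilate the off-diagonal products, so only the
  diagonal remains. The constant is fixed before p, h, D and the block B, as the later suprema
  require.\<close>

lemma sum_dev_second_moment:
  assumes "tame \<phi>"
  obtains C where "C \<ge> 0"
    "\<And>p h D B. p > 0 \<Longrightarrow> h \<in> H p \<Longrightarrow> D \<in> Ds p \<Longrightarrow> B \<subseteq> {..<p} \<Longrightarrow>
       integrable (M p h) (\<lambda>x. (\<Sum>i\<in>B. dev \<phi> p h D i x)\<^sup>2) \<and>
       (\<integral>x. (\<Sum>i\<in>B. dev \<phi> p h D i x)\<^sup>2 \<partial>M p h) \<le> real p * C"
proof -
  define \<psi> where "\<psi> = (\<lambda>m x. \<phi> m x - mean \<phi> m)"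
  have tame: "tame \<psi>" unfolding \<psi>_def using assms by (rule tame_minus_mean)
  have dev: "dev \<phi> p h D i x = \<psi> (xi p h D i) (Z p D i x)" for p h D i x
    by (simp add: dev_def \<psi>_def)
  obtain C where C: "C \<ge> 0" "\<And>m. \<bar>m\<bar> \<le> c \<Longrightarrow> (\<integral>x. (\<psi> m x)\<^sup>2 \<partial>gauss s2 m) \<le> C"
    using tame_square_bound[OF tame] by blast
  have "integrable (M p h) (\<lambda>x. (\<Sum>i\<in>B. dev \<phi> p h D i x)\<^sup>2) \<and>
       (\<integral>x. (\<Sum>i\<in>B. dev \<phi> p h D i x)\<^sup>2 \<partial>M p h) \<le> real p * C"
    if p: "p > 0" and h: "h \<in> H p" and D: "D \<in> Ds p" and B: "B \<subseteq> {..<p}" for p h D B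
  proof -
    interpret prob_space "M p h" using p h by (rule prob)
    note [measurable] = tame_measurable[OF tame]
    have fin: "finite B" using B finite_subset by blast
    have sq: "(\<Sum>i\<in>B. dev \<phi> p h D i x)\<^sup>2 =
        (\<Sum>i\<in>B. \<Sum>j\<in>B. dev \<phi> p h D i x * dev \<phi> p h D j x)" for x
      by (simp add: power2_eq_square sum_product)
    have mean0: "(\<integral>x. dev \<phi> p h D i x \<partial>M p h) = 0" if "i \<in> B" for i
      using that B tame_expectation_Z[OF p h D _ assms, of i] tame_integrable_Z[OF p h D _ assms, of i]
      unfolding dev_def by (subst Bochner_Integration.integral_diff) (auto simp: prob_space)
    have int1: "integrable (M p h) (dev \<phi> p h D i)" if "i \<in> B" for i
      unfolding dev using that B p h D tame by (auto intro!: tame_integrable_Z)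
    have off: "integrable (M p h) (\<lambda>x. dev \<phi> p h D i x * dev \<phi> p h D j x) \<and>
        (\<integral>x. dev \<phi> p h D i x * dev \<phi> p h D j x \<partial>M p h) = 0" if "i \<in> B" "j \<in> B" "i \<noteq> j" for i j
    proof -
      have "indep_var borel (\<psi> (xi p h D i) \<circ> Z p D i) borel (\<psi> (xi p h D j) \<circ> Z p D j)"
        using that B p h D by (intro indep_var_compose[OF Z_indep]) auto
      then have ind: "indep_var borel (dev \<phi> p h D i) borel (dev \<phi> p h D j)"
        by (simp add: dev[abs_def] comp_def)
      show ?thesis
        using indep_var_lebesgue_integral[OF ind int1 int1] indep_var_integrable[OF ind int1 int1] that mean0
        by auto
    qed
    have diag: "integrable (M p h) (\<lambda>x. dev \<phi> p h D i x * dev \<phi> p h D i x) \<and>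
        (\<integral>x. dev \<phi> p h D i x * dev \<phi> p h D i x \<partial>M p h) \<le> C" if "i \<in> B" for i
    proof -
      have i: "i < p" using that B by auto
      have m: "\<bar>xi p h D i\<bar> \<le> c" using p h D i by (rule xi_bound)
      have "integrable (M p h) (\<lambda>x. (\<lambda>x. (\<psi> (xi p h D i) x)\<^sup>2) (Z p D i x))"
        using p h D i m tame by (intro integrable_Z tame_square_integrable) auto
      moreover have "(\<integral>x. (\<lambda>x. (\<psi> (xi p h D i) x)\<^sup>2) (Z p D i x) \<partial>M p h) \<le> C"
        using p h D i C(2)[OF m] by (subst expectation_Z) auto
      ultimately show ?thesis by (simp add: dev power2_eq_square)
    qed
    have int: "integrable (M p h) (\<lambda>x. dev \<phi> p h D i x * dev \<phi> p h D j x)" if "i \<in> B" "j \<in> B" for i j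
      using off[OF that] diag that by (cases "i = j") auto
    have "(\<integral>x. (\<Sum>i\<in>B. dev \<phi> p h D i x)\<^sup>2 \<partial>M p h) =
        (\<Sum>i\<in>B. \<Sum>j\<in>B. \<integral>x. dev \<phi> p h D i x * dev \<phi> p h D j x \<partial>M p h)"
      unfolding sq using int by (simp add: Bochner_Integration.integral_sum)
    also have "\<dots> = (\<Sum>i\<in>B. \<Sum>j\<in>B. if i = j then \<integral>x. dev \<phi> p h D i x * dev \<phi> p h D i x \<partial>M p h else 0)"
      using off by (intro sum.cong refl) auto
    also have "\<dots> = (\<Sum>i\<in>B. \<integral>x. dev \<phi> p h D i x * dev \<phi> p h D i x \<partial>M p h)"
      using fin by simp
    also have "\<dots> \<le> (\<Sum>i\<in>B. C)" using diag by (intro sum_mono) auto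
    also have "\<dots> \<le> real p * C"
      using C(1) card_mono[OF _ B] by (auto intro!: mult_right_mono)
    finally show ?thesis unfolding sq using int by auto
  qed
  with C(1) that show thesis by blast
qed

lemma neglE:
  assumes "negl I F" "e > 0"
  shows "\<forall>\<^sub>F p in sequentially. \<forall>h\<in>H p. \<exists>B. small_envelope (M p h) e B \<and>
     (\<forall>x\<in>space (M p h). \<forall>i\<in>I p. \<bar>F p h i x\<bar> \<le> B x)"
  using assms unfolding negl_def by blast

text \<open>The comparison family G and its index set may be chosen anew for each accuracy e.
  Therefore a grid whose size depends on e can be kept fixed while p grows.\<close>

lemma negl_approx:
  assumes "\<And>e. e > 0 \<Longrightarrow> \<exists>J G. negl (J :: nat \<Rightarrow> 'j set) G \<and>
    (\<forall>\<^sub>F p in sequentially. \<forall>h\<in>H p. \<forall>x\<in>space (M p h). \<forall>i\<in>I p. \<exists>j\<in>J p. \<bar>F p h i x\<bar> \<le> \<bar>G p h j x\<bar> + e)"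
  shows "negl I F"
  unfolding negl_def
proof (intro allI impI)
  fix e :: real assume "e > 0"
  then have e2: "e / 2 > 0" by simp
  obtain J :: "nat \<Rightarrow> 'j set" and G where JG: "negl J G" and
    ev: "\<forall>\<^sub>F p in sequentially. \<forall>h\<in>H p. \<forall>x\<in>space (M p h). \<forall>i\<in>I p. \<exists>j\<in>J p. \<bar>F p h i x\<bar> \<le> \<bar>G p h j x\<bar> + e / 2"
    using assms[OF e2] by blast
  show "\<forall>\<^sub>F p in sequentially. \<forall>h\<in>H p. \<exists>B. small_envelope (M p h) e B \<and>
     (\<forall>x\<in>space (M p h). \<forall>i\<in>I p. \<bar>F p h i x\<bar> \<le> B x)"
    using ev neglE[OF JG e2] eventually_gt_at_top[of 0]
  proof eventually_elim
    case (elim p)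
    show ?case
    proof
      fix h assume h: "h \<in> H p"
      interpret prob_space "M p h" using elim(3) h by (rule prob)
      obtain B where B: "small_envelope (M p h) (e / 2) B"
        "\<forall>x\<in>space (M p h). \<forall>j\<in>J p. \<bar>G p h j x\<bar> \<le> B x"
        using elim(2) h by blast
      have "small_envelope (M p h) e (\<lambda>x. B x + e / 2)"
        using small_envelope_add[OF B(1) small_envelope_const[of "e / 2"]] e2 by simp
      moreover have "\<forall>x\<in>space (M p h). \<forall>i\<in>I p. \<bar>F p h i x\<bar> \<le> B x + e / 2"
        using elim(1) h B(2) by fastforce
      ultimately show "\<exists>B. small_envelope (M p h) e B \<and>
     (\<forall>x\<in>space (M p h). \<forall>i\<in>I p. \<bar>F p h i x\<bar> \<le> B x)" by (intro exI conjI)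
    qed
  qed
qed

lemma negl_dominated:
  assumes "negl (J :: nat \<Rightarrow> 'j set) G"
    and "\<forall>\<^sub>F p in sequentially. \<forall>h\<in>H p. \<forall>x\<in>space (M p h). \<forall>i\<in>I p. \<exists>j\<in>J p. \<bar>F p h i x\<bar> \<le> \<bar>G p h j x\<bar>"
  shows "negl I F"
proof (rule negl_approx)
  fix e :: real assume e: "e > 0"
  have "\<forall>\<^sub>F p in sequentially. \<forall>h\<in>H p. \<forall>x\<in>space (M p h). \<forall>i\<in>I p. \<exists>j\<in>J p. \<bar>F p h i x\<bar> \<le> \<bar>G p h j x\<bar> + e"
    using assms(2) by eventually_elim (use e in \<open>meson add_increasing2 less_imp_le\<close>)
  then show "\<exists>J G. negl (J :: nat \<Rightarrow> 'j set) G \<and>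
    (\<forall>\<^sub>F p in sequentially. \<forall>h\<in>H p. \<forall>x\<in>space (M p h). \<forall>i\<in>I p. \<exists>j\<in>J p. \<bar>F p h i x\<bar> \<le> \<bar>G p h j x\<bar> + e)"
    using assms(1) by blast
qed

lemma negl_add:
  assumes "negl I F" "negl I G"
  shows "negl I (\<lambda>p h i x. F p h i x + G p h i x)"
  unfolding negl_def
proof (intro allI impI)
  fix e :: real assume "e > 0"
  then have e2: "e / 2 > 0" by simp
  show "\<forall>\<^sub>F p in sequentially. \<forall>h\<in>H p. \<exists>B. small_envelope (M p h) e B \<and>
     (\<forall>x\<in>space (M p h). \<forall>i\<in>I p. \<bar>F p h i x + G p h i x\<bar> \<le> B x)"
    using neglE[OF assms(1) e2] neglE[OF assms(2) e2]
  proof eventually_elim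
    case (elim p)
    show ?case
    proof
      fix h assume h: "h \<in> H p"
      obtain A where A: "small_envelope (M p h) (e / 2) A"
        "\<forall>x\<in>space (M p h). \<forall>j\<in>I p. \<bar>F p h j x\<bar> \<le> A x"
        using elim(1) h by blast
      obtain B where B: "small_envelope (M p h) (e / 2) B"
        "\<forall>x\<in>space (M p h). \<forall>j\<in>I p. \<bar>G p h j x\<bar> \<le> B x"
        using elim(2) h by blast
      have "small_envelope (M p h) e (\<lambda>x. A x + B x)"
        using small_envelope_add[OF A(1) B(1)] e2 by simp
      moreover have "\<forall>x\<in>space (M p h). \<forall>i\<in>I p. \<bar>F p h i x + G p h i x\<bar> \<le> A x + B x"
        using A(2) B(2) by (auto intro!: order_trans[OF abs_triangle_ineq] add_mono)
      ultimately show "\<exists>B. small_envelope (M p h) e B \<and>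
         (\<forall>x\<in>space (M p h). \<forall>i\<in>I p. \<bar>F p h i x + G p h i x\<bar> \<le> B x)" by (intro exI conjI)
    qed
  qed
qed

lemma negl_abs: "negl I F \<Longrightarrow> negl I (\<lambda>p h i x. \<bar>F p h i x\<bar>)"
  unfolding negl_def by simp

lemma negl_zero: "negl I (\<lambda>p h i x. 0)"
  unfolding negl_def by (intro allI impI always_eventually ballI exI[of _ "\<lambda>x. 0"]) (auto simp: small_envelope_def)

lemma negl_sum:
  assumes "finite K" "\<And>k. k \<in> K \<Longrightarrow> negl I (F k)"
  shows "negl I (\<lambda>p h i x. \<Sum>k\<in>K. F k p h i x)"
  using assms by (induction K) (auto simp: negl_zero intro!: negl_add)

text \<open>K does not vary with p, so a maximum over K can be replaced by the sum of the absolute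
  values. All maxima over grid points are taken in this way.\<close>

lemma negl_finite_Union:
  assumes "finite K" "\<And>k. k \<in> K \<Longrightarrow> negl I (F k)"
  shows "negl (\<lambda>p. I p \<times> K) (\<lambda>p h (i, k). F k p h i)"
proof (rule negl_dominated)
  show "negl I (\<lambda>p h i x. \<Sum>k\<in>K. \<bar>F k p h i x\<bar>)"
    using assms by (intro negl_sum negl_abs)
  show "\<forall>\<^sub>F p in sequentially. \<forall>h\<in>H p. \<forall>x\<in>space (M p h). \<forall>i\<in>I p \<times> K. \<exists>j\<in>I p.
      \<bar>(case i of (i, k) \<Rightarrow> F k p h i) x\<bar> \<le> \<bar>\<Sum>k\<in>K. \<bar>F k p h j x\<bar>\<bar>"
  proof (intro always_eventually allI ballI)
    fix p h x ik assume "ik \<in> I p \<times> K"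
    then obtain i k where ik: "ik = (i, k)" "i \<in> I p" "k \<in> K" by auto
    have "\<bar>F k p h i x\<bar> \<le> (\<Sum>k\<in>K. \<bar>F k p h i x\<bar>)"
      using ik assms(1) by (intro member_le_sum) auto
    then show "\<exists>j\<in>I p. \<bar>(case ik of (i, k) \<Rightarrow> F k p h i) x\<bar> \<le> \<bar>\<Sum>k\<in>K. \<bar>F k p h j x\<bar>\<bar>"
      using ik by (intro bexI[of _ i]) auto
  qed
qed

text \<open>The supremum over \<open>D\<close> is taken through \<open>\<bar>x\<bar> \<le> \<delta> + x\<^sup>2 / \<delta>\<close> and a sum of second moments, each of order
  \<open>1 / p\<close>; this is why \<open>#\<D> / p \<longrightarrow> 0\<close> is all that is needed of the number of candidate matrices.\<close>

lemma negl_block: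
  assumes "tame \<phi>" and Bl: "\<And>p. Bl p \<subseteq> {..<p}"
  shows "negl Ds (\<lambda>p h D x. (\<Sum>i\<in>Bl p. dev \<phi> p h D i x) / real p)"
  unfolding negl_def
proof (intro allI impI)
  fix e :: real assume e: "e > 0"
  define \<delta> where "\<delta> = e / 2"
  have \<delta>: "\<delta> > 0" using e by (simp add: \<delta>_def)
  obtain C where C: "C \<ge> 0"
    "\<And>p h D B. p > 0 \<Longrightarrow> h \<in> H p \<Longrightarrow> D \<in> Ds p \<Longrightarrow> B \<subseteq> {..<p} \<Longrightarrow>
       integrable (M p h) (\<lambda>x. (\<Sum>i\<in>B. dev \<phi> p h D i x)\<^sup>2) \<and>
       (\<integral>x. (\<Sum>i\<in>B. dev \<phi> p h D i x)\<^sup>2 \<partial>M p h) \<le> real p * C"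
    using sum_dev_second_moment[OF assms(1)] by metis
  \<comment> \<open>The expected sum of second moments is at most
    \<open>(card (Ds p) / p) * (C / \<delta>)\<close>; this threshold brings it below \<delta>, the
    other \<delta> being the constant part of the envelope. The summand 1 covers the case C =
    0.\<close>
  have "\<forall>\<^sub>F p in sequentially. real (card (Ds p)) / real p < \<delta>\<^sup>2 / (C + 1)"
    using C(1) \<delta> by (intro order_tendstoD[OF Ds_card]) auto
  then show "\<forall>\<^sub>F p in sequentially. \<forall>h\<in>H p. \<exists>B. small_envelope (M p h) e B \<and>
     (\<forall>x\<in>space (M p h). \<forall>D\<in>Ds p. \<bar>(\<Sum>i\<in>Bl p. dev \<phi> p h D i x) / real p\<bar> \<le> B x)"
    using eventually_gt_at_top[of 0]
  proof eventually_elim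
    case (elim p)
    show ?case
    proof
      fix h assume h: "h \<in> H p"
      interpret prob_space "M p h" using elim(2) h by (rule prob)
      define S where "S = (\<lambda>D x. \<Sum>i\<in>Bl p. dev \<phi> p h D i x)"
      define B where "B = (\<lambda>x. \<delta> + (\<Sum>D\<in>Ds p. (S D x)\<^sup>2 / ((real p)\<^sup>2 * \<delta>)))"
      have S_int: "integrable (M p h) (\<lambda>x. (S D x)\<^sup>2 / ((real p)\<^sup>2 * \<delta>))"
        and S_le: "(\<integral>x. (S D x)\<^sup>2 / ((real p)\<^sup>2 * \<delta>) \<partial>M p h) \<le> C / (real p * \<delta>)" if "D \<in> Ds p" for D
      proof -
        have *: "integrable (M p h) (\<lambda>x. (S D x)\<^sup>2)" "(\<integral>x. (S D x)\<^sup>2 \<partial>M p h) \<le> real p * C"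
          using C(2)[OF elim(2) h that Bl[of p]] by (auto simp: S_def)
        from *(1) show "integrable (M p h) (\<lambda>x. (S D x)\<^sup>2 / ((real p)\<^sup>2 * \<delta>))"
          by simp
        show "(\<integral>x. (S D x)\<^sup>2 / ((real p)\<^sup>2 * \<delta>) \<partial>M p h) \<le> C / (real p * \<delta>)"
          using *(2) elim(2) \<delta> by (simp add: field_simps power2_eq_square)
      qed
      have B_int: "integrable (M p h) B"
        unfolding B_def using S_int by auto
      have "(\<integral>x. B x \<partial>M p h) = \<delta> + (\<Sum>D\<in>Ds p. \<integral>x. (S D x)\<^sup>2 / ((real p)\<^sup>2 * \<delta>) \<partial>M p h)"
        unfolding B_def using S_int
        by (subst Bochner_Integration.integral_add, simp, simp, subst Bochner_Integration.integral_sum)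
          (auto simp: prob_space)
      also have "\<dots> \<le> \<delta> + (\<Sum>D\<in>Ds p. C / (real p * \<delta>))"
        using S_le by (intro add_left_mono sum_mono) auto
      also have "\<dots> = \<delta> + (real (card (Ds p)) / real p) * (C / \<delta>)" by simp
      also have "\<dots> \<le> \<delta> + (\<delta>\<^sup>2 / (C + 1)) * (C / \<delta>)"
        using elim(1) C(1) \<delta> by (intro add_left_mono mult_right_mono) auto
      also have "\<dots> \<le> \<delta> + \<delta>"
      proof (intro add_left_mono)
        have "(\<delta>\<^sup>2 / (C + 1)) * (C / \<delta>) = \<delta> * (C / (C + 1))" using \<delta> by (simp add: power2_eq_square)
        also have "\<dots> \<le> \<delta> * 1" using \<delta> C(1) by (intro mult_left_mono) auto
        finally show "(\<delta>\<^sup>2 / (C + 1)) * (C / \<delta>) \<le> \<delta>" by simp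
      qed
      finally have le: "(\<integral>x. B x \<partial>M p h) \<le> e" by (simp add: \<delta>_def)
      have B_nonneg: "0 \<le> B x" for x
        unfolding B_def using \<delta> by (auto intro!: add_nonneg_nonneg sum_nonneg)
      have "(\<integral>\<^sup>+x. ennreal (B x) \<partial>M p h) = ennreal (\<integral>x. B x \<partial>M p h)"
        using B_int B_nonneg by (intro nn_integral_eq_integral) auto
      also have "\<dots> \<le> ennreal e" using le by (rule ennreal_leI)
      finally have 1: "(\<integral>\<^sup>+x. ennreal (B x) \<partial>M p h) \<le> ennreal e" .
      have 2: "\<bar>S D x / real p\<bar> \<le> B x" if "D \<in> Ds p" for D x
      proof -
        define r where "r = \<bar>S D x / real p\<bar>"
        have "r \<le> \<delta> + r\<^sup>2 / \<delta>"
        proof (cases "r \<le> \<delta>")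
          case True then show ?thesis using \<delta> by (simp add: add_increasing2)
        next
          case False
          then have "r * \<delta> \<le> r * r" using \<delta> by (intro mult_left_mono) auto
          then have "r \<le> r\<^sup>2 / \<delta>" using \<delta> by (simp add: field_simps power2_eq_square)
          then show ?thesis using \<delta> by simp
        qed
        also have "r\<^sup>2 / \<delta> = (S D x)\<^sup>2 / ((real p)\<^sup>2 * \<delta>)" by (simp add: r_def power_divide)
        also have "\<dots> \<le> (\<Sum>D\<in>Ds p. (S D x)\<^sup>2 / ((real p)\<^sup>2 * \<delta>))"
          using that Ds_finite \<delta> by (intro member_le_sum) auto
        finally show ?thesis by (simp add: B_def r_def)
      qed
      show "\<exists>B. small_envelope (M p h) e B \<and>
         (\<forall>x\<in>space (M p h). \<forall>D\<in>Ds p. \<bar>(\<Sum>i\<in>Bl p. dev \<phi> p h D i x) / real p\<bar> \<le> B x)"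
        using 1 2 B_nonneg B_int by (intro exI[of _ B]) (auto simp: S_def small_envelope_def)
    qed
  qed
qed

end

section \<open>Summation by parts against decreasing weights\<close>

lemma abel_sum_bound:
  fixes w Y :: "nat \<Rightarrow> real"
  assumes w: "\<And>i. i < k \<Longrightarrow> 0 \<le> w i \<and> w i \<le> 1" and dec: "\<And>i j. i \<le> j \<Longrightarrow> j < k \<Longrightarrow> w j \<le> w i"
    and S: "\<And>j. j \<le> k \<Longrightarrow> \<bar>\<Sum>i<j. Y i\<bar> \<le> B"
  shows "\<bar>\<Sum>i<k. w i * Y i\<bar> \<le> B"
proof (cases k)
  case 0
  then show ?thesis using S[of 0] by simp
next
  case (Suc k')
  have "B \<ge> 0" using S[of 0] by simp
  \<comment> \<open>Abel summation by induction: after removal of the last weight times the last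
    partial sum, what remains combines earlier partial sums with the coefficients
    \<open>w i - w (Suc i)\<close>, which are nonnegative and telescope to \<open>w 0 - w l\<close>.
    The removed term adds \<open>w l\<close>, so the total weight is \<open>w 0\<close>, at most
    1.\<close>
  have *: "\<bar>(\<Sum>i<Suc l. w i * Y i) - w l * (\<Sum>i<Suc l. Y i)\<bar> \<le> B * (w 0 - w l)" if "l < k" for l
    using that
  proof (induction l)
    case 0
    then show ?case by simp
  next
    case (Suc l)
    have eq: "(\<Sum>i<Suc (Suc l). w i * Y i) - w (Suc l) * (\<Sum>i<Suc (Suc l). Y i) =
        ((\<Sum>i<Suc l. w i * Y i) - w l * (\<Sum>i<Suc l. Y i)) + (w l - w (Suc l)) * (\<Sum>i<Suc l. Y i)"
      by (simp only: sum.lessThan_Suc[of _ "Suc l"]) (simp add: algebra_simps)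
    have "\<bar>(w l - w (Suc l)) * (\<Sum>i<Suc l. Y i)\<bar> \<le> (w l - w (Suc l)) * B"
      using dec[of l "Suc l"] Suc.prems S[of "Suc l"] by (auto simp: abs_mult simp del: sum.lessThan_Suc intro!: mult_left_mono)
    moreover have "\<bar>(\<Sum>i<Suc l. w i * Y i) - w l * (\<Sum>i<Suc l. Y i)\<bar> \<le> B * (w 0 - w l)"
      using Suc by simp
    ultimately have "\<bar>(\<Sum>i<Suc (Suc l). w i * Y i) - w (Suc l) * (\<Sum>i<Suc (Suc l). Y i)\<bar> \<le>
        B * (w 0 - w l) + (w l - w (Suc l)) * B"
      unfolding eq by linarith
    then show ?case by (simp add: algebra_simps)
  qed
  have 1: "\<bar>(\<Sum>i<k. w i * Y i) - w k' * (\<Sum>i<k. Y i)\<bar> \<le> B * (w 0 - w k')"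
    using *[of k'] Suc by simp
  have "\<bar>w k' * (\<Sum>i<k. Y i)\<bar> \<le> w k' * B"
    using S[of k] w[of k'] Suc by (auto simp: abs_mult intro!: mult_left_mono)
  with 1 have "\<bar>\<Sum>i<k. w i * Y i\<bar> \<le> B * w 0" by (simp add: algebra_simps)
  also have "\<dots> \<le> B * 1" using w[of 0] \<open>B \<ge> 0\<close> Suc by (intro mult_left_mono) auto
  finally show ?thesis by simp
qed

text \<open>Domination of families asks for an index at which the bound is reached; the largest of
  the finitely many partial sums provides it.\<close>

lemma abel_sum_attained:
  fixes w Y :: "nat \<Rightarrow> real"
  assumes w: "\<And>i. i < k \<Longrightarrow> 0 \<le> w i \<and> w i \<le> 1" and dec: "\<And>i j. i \<le> j \<Longrightarrow> j < k \<Longrightarrow> w j \<le> w i"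
  obtains j where "j \<le> k" "\<bar>\<Sum>i<k. w i * Y i\<bar> \<le> \<bar>\<Sum>i<j. Y i\<bar>"
proof -
  define B where "B = Max ((\<lambda>j. \<bar>\<Sum>i<j. Y i\<bar>) ` {..k})"
  have "\<bar>\<Sum>i<k. w i * Y i\<bar> \<le> B"
    using w dec by (rule abel_sum_bound) (auto simp: B_def)
  moreover have "B \<in> (\<lambda>j. \<bar>\<Sum>i<j. Y i\<bar>) ` {..k}" unfolding B_def by (rule Max_in) auto
  ultimately show thesis using that by auto
qed

context gaussian_array
begin

definition psum :: "(real \<Rightarrow> real \<Rightarrow> real) \<Rightarrow> nat \<Rightarrow> 'h \<Rightarrow> 'd \<times> nat \<Rightarrow> 'a \<Rightarrow> real" where
  "psum \<phi> p h = (\<lambda>(D, k) x. (\<Sum>i<k. dev \<phi> p h D i x) / real p)"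

text \<open>All partial sums are controlled by those at \<open>m + 1\<close> grid points, \<open>m\<close> fixed, and by the sums of absolute
  values over the blocks in between, whose expectations are of order \<open>p / m\<close>.\<close>

lemma negl_psum:
  assumes tame: "tame \<phi>"
  shows "negl (\<lambda>p. Ds p \<times> {..p}) (psum \<phi>)"
proof (rule negl_approx)
  fix e :: real assume e: "e > 0"
  \<comment> \<open>A partial sum may stop inside a block. Absolute values allow the incomplete
    block to be enlarged to the complete one; the price is a nonzero mean, bounded by the constant C
    obtained next.\<close>
  define \<psi> where "\<psi> = (\<lambda>m x. \<bar>\<phi> m x - mean \<phi> m\<bar>)"
  have tame\<psi>: "tame \<psi>"
    unfolding \<psi>_def using tame_minus_mean[OF tame] tame_measurable[OF tame] by (rule_tac tame_dominated) auto
  obtain C where C: "C \<ge> 0" "\<And>m. \<bar>m\<bar> \<le> c \<Longrightarrow> \<bar>mean \<psi> m\<bar> \<le> C"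
    using tame_mean_bound[OF tame\<psi>] by metis
  \<comment> \<open>The means on one block contribute at most \<open>(p / m + 2) * C / p\<close>.
    This choice gives \<open>C / m \<le> e / 2\<close>, and \<open>2 * C / p \<le> e / 2\<close>
    holds for large p.\<close>
  define m where "m = nat \<lceil>2 * C / e\<rceil> + 1"
  have m: "m > 0" "2 * C / e \<le> real m" unfolding m_def by linarith+
  define Bl1 where "Bl1 = (\<lambda>j p. {..<min p (j * p div m)})"
  \<comment> \<open>The 2 pays for rounding down in both \<open>j * p div m\<close> and
    \<open>p div m\<close>, so that the block that starts at grid point j reaches beyond every k
    assigned to j. The minimum with p keeps the block inside the array.\<close>
  define Bl2 where "Bl2 = (\<lambda>j p. {j * p div m..<min p (j * p div m + (p div m + 2))})"
  define G where "G = (\<lambda>j p h D x. \<bar>(\<Sum>i\<in>Bl1 j p. dev \<phi> p h D i x) / real p\<bar> + \<bar>(\<Sum>i\<in>Bl2 j p. dev \<psi> p h D i x) / real p\<bar>)"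
  have "negl Ds (G j)" for j
    unfolding G_def by (intro negl_add negl_abs negl_block tame tame\<psi>) (auto simp: Bl1_def Bl2_def)
  then have negl: "negl (\<lambda>p. Ds p \<times> {..m}) (\<lambda>p h (D, j). G j p h D)"
    by (intro negl_finite_Union) auto
  have "\<forall>\<^sub>F p in sequentially. 4 * C / e \<le> real p"
    using filterlim_real_sequentially by (auto simp: filterlim_at_top)
  then have "\<forall>\<^sub>F p in sequentially. \<forall>h\<in>H p. \<forall>x\<in>space (M p h). \<forall>i\<in>Ds p \<times> {..p}. \<exists>j\<in>Ds p \<times> {..m}.
      \<bar>psum \<phi> p h i x\<bar> \<le> \<bar>(case j of (D, j) \<Rightarrow> G j p h D) x\<bar> + e"
    using eventually_gt_at_top[of 0]
  proof eventually_elim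
    case (elim p)
    show ?case
    proof (intro ballI)
      fix h x i assume h: "h \<in> H p" and "x \<in> space (M p h)" and "i \<in> Ds p \<times> {..p}"
      then obtain D k where i: "i = (D, k)" and D: "D \<in> Ds p" and k: "k \<le> p" by auto
      define j where "j = k * m div p"
      have jm: "j \<le> m" unfolding j_def using k elim(2)
        by (metis div_le_mono mult.commute mult_le_mono2 nonzero_mult_div_cancel_right less_numeral_extra(3))
      have jk: "j * p div m \<le> k"
      proof -
        have "j * p \<le> k * m" unfolding j_def by simp
        then have "j * p div m \<le> k * m div m" by (rule div_le_mono)
        then show ?thesis using m by simp
      qed
      have kj: "k < j * p div m + (p div m + 2)"
      proof -
        have a: "k * m < (j + 1) * p" unfolding j_def
          using elim(2) by (metis Suc_eq_plus1 dividend_less_div_times add.commute mult_Suc)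
        have "j * p < (j * p div m + 1) * m" "p < (p div m + 1) * m"
          using m by (metis Suc_eq_plus1 dividend_less_div_times add.commute mult_Suc)+
        then have "(j + 1) * p < (j * p div m + p div m + 2) * m" by (simp add: algebra_simps)
        with a have "k * m < (j * p div m + p div m + 2) * m" by (rule less_trans)
        then have "k < j * p div m + p div m + 2" by (rule mult_less_cancel2[THEN iffD1, THEN conjunct2])
        then show ?thesis by simp
      qed
      have B1: "Bl1 j p = {..<j * p div m}" using jk k by (auto simp: Bl1_def)
      have sub: "{j * p div m..<k} \<subseteq> Bl2 j p" using kj k by (auto simp: Bl2_def)
      have split: "(\<Sum>i<k. dev \<phi> p h D i x) = (\<Sum>i\<in>Bl1 j p. dev \<phi> p h D i x) + (\<Sum>i\<in>{j * p div m..<k}. dev \<phi> p h D i x)"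
        unfolding B1 using jk by (simp add: sum.atLeastLessThan_concat lessThan_atLeast0)
      have mean_le: "\<bar>mean \<psi> (xi p h D i)\<bar> \<le> C" if "i \<in> Bl2 j p" for i
        using that elim(2) h D by (intro C xi_bound) (auto simp: Bl2_def)
      have "\<bar>\<Sum>i\<in>{j * p div m..<k}. dev \<phi> p h D i x\<bar> \<le> (\<Sum>i\<in>{j * p div m..<k}. \<bar>dev \<phi> p h D i x\<bar>)"
        by (rule sum_abs)
      also have "\<dots> \<le> (\<Sum>i\<in>Bl2 j p. \<bar>dev \<phi> p h D i x\<bar>)"
        using sub by (intro sum_mono2) (auto simp: Bl2_def)
      also have "\<dots> = (\<Sum>i\<in>Bl2 j p. dev \<psi> p h D i x + mean \<psi> (xi p h D i))"
        by (simp add: dev_def \<psi>_def)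
      also have "\<dots> \<le> (\<Sum>i\<in>Bl2 j p. dev \<psi> p h D i x + C)"
        using mean_le by (intro sum_mono) (force simp: abs_le_iff)
      also have "\<dots> = (\<Sum>i\<in>Bl2 j p. dev \<psi> p h D i x) + real (card (Bl2 j p)) * C"
        by (simp add: sum.distrib)
      also have "real (card (Bl2 j p)) * C \<le> (real p / real m + 2) * C"
      proof (intro mult_right_mono C)
        have "real (card (Bl2 j p)) \<le> real (p div m + 2)" unfolding Bl2_def of_nat_le_iff by simp
        also have "\<dots> \<le> real p / real m + 2" using of_nat_div_le_of_nat[of p m, where ?'a = real] by simp
        finally show "real (card (Bl2 j p)) \<le> real p / real m + 2" .
      qed
      finally have le: "\<bar>\<Sum>i\<in>{j * p div m..<k}. dev \<phi> p h D i x\<bar> \<le>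
          \<bar>\<Sum>i\<in>Bl2 j p. dev \<psi> p h D i x\<bar> + (real p / real m + 2) * C" by linarith
      have small: "(real p / real m + 2) * C / real p \<le> e"
      proof -
        have "C / real m \<le> e / 2" using m e by (simp add: field_simps)
        moreover have "2 * C / real p \<le> e / 2" using elim e by (simp add: field_simps)
        moreover have "(real p / real m + 2) * C / real p = C / real m + 2 * C / real p"
          using elim(2) by (simp add: field_simps)
        ultimately show ?thesis by linarith
      qed
      have "\<bar>psum \<phi> p h i x\<bar> = \<bar>(\<Sum>i<k. dev \<phi> p h D i x)\<bar> / real p" by (simp add: psum_def i)
      also have "\<dots> \<le> (\<bar>\<Sum>i\<in>Bl1 j p. dev \<phi> p h D i x\<bar> + (\<bar>\<Sum>i\<in>Bl2 j p. dev \<psi> p h D i x\<bar> + (real p / real m + 2) * C)) / real p"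
        unfolding split using le by (intro divide_right_mono) auto
      also have "\<dots> = G j p h D x + (real p / real m + 2) * C / real p"
        by (simp add: G_def add_divide_distrib)
      also have "\<dots> \<le> \<bar>G j p h D x\<bar> + e" using small by linarith
      finally show "\<exists>j\<in>Ds p \<times> {..m}. \<bar>psum \<phi> p h i x\<bar> \<le> \<bar>(case j of (D, j) \<Rightarrow> G j p h D) x\<bar> + e"
        using D jm by (intro bexI[of _ "(D, j)"]) auto
    qed
  qed
  with negl show "\<exists>J G. negl (J :: nat \<Rightarrow> ('d \<times> nat) set) G \<and> (\<forall>\<^sub>F p in sequentially. \<forall>h\<in>H p. \<forall>x\<in>space (M p h).
      \<forall>i\<in>Ds p \<times> {..p}. \<exists>j\<in>J p. \<bar>psum \<phi> p h i x\<bar> \<le> \<bar>G p h j x\<bar> + e)"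
    by (intro exI conjI)
qed

text \<open>A finite net is enough if the distance of \<open>A t\<close> from its net point has an
  integrable bound of small mean; no pointwise smallness is asked for. The bound \<open>g j\<close>
  has deviations of its own, and these are negligible as well.\<close>

lemma negl_psum_bracketed:
  fixes A :: "'t \<Rightarrow> real \<Rightarrow> real \<Rightarrow> real"
  assumes tame: "\<And>t. t \<in> T \<Longrightarrow> tame (A t)"
    and bracket: "\<And>e. e > 0 \<Longrightarrow> \<exists>J g. finite J \<and> J \<subseteq> T \<and>
      (\<forall>j\<in>J. tame (g j) \<and> (\<forall>m. \<bar>m\<bar> \<le> c \<longrightarrow> mean (g j) m \<le> e)) \<and>
      (\<forall>t\<in>T. \<exists>j\<in>J. \<forall>m x. \<bar>m\<bar> \<le> c \<longrightarrow> \<bar>A t m x - A j m x\<bar> \<le> g j m x)"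
  shows "negl (\<lambda>p. (Ds p \<times> {..p}) \<times> T) (\<lambda>p h (i, t). psum (A t) p h i)"
proof (rule negl_approx)
  fix e :: real assume e: "e > 0"
  then have e2: "e / 2 > 0" by simp
  obtain J g where J: "finite J" "J \<subseteq> T"
    and g: "\<And>j. j \<in> J \<Longrightarrow> tame (g j)" "\<And>j m. j \<in> J \<Longrightarrow> \<bar>m\<bar> \<le> c \<Longrightarrow> mean (g j) m \<le> e / 2"
    and br: "\<And>t. t \<in> T \<Longrightarrow> \<exists>j\<in>J. \<forall>m x. \<bar>m\<bar> \<le> c \<longrightarrow> \<bar>A t m x - A j m x\<bar> \<le> g j m x"
    using bracket[OF e2] by metis
  have "negl (\<lambda>p. Ds p \<times> {..p}) (\<lambda>p h i x. \<bar>psum (A j) p h i x\<bar> + \<bar>psum (g j) p h i x\<bar>)" if "j \<in> J" for j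
    using that J g tame by (intro negl_add negl_abs negl_psum) auto
  then have negl: "negl (\<lambda>p. (Ds p \<times> {..p}) \<times> J) (\<lambda>p h (i, j) x. \<bar>psum (A j) p h i x\<bar> + \<bar>psum (g j) p h i x\<bar>)"
    using negl_finite_Union[OF J(1), of "\<lambda>p. Ds p \<times> {..p}" "\<lambda>j p h i x. \<bar>psum (A j) p h i x\<bar> + \<bar>psum (g j) p h i x\<bar>"]
    by simp
  have "\<forall>\<^sub>F p in sequentially. \<forall>h\<in>H p. \<forall>x\<in>space (M p h). \<forall>i\<in>(Ds p \<times> {..p}) \<times> T. \<exists>j\<in>(Ds p \<times> {..p}) \<times> J.
      \<bar>(case i of (i, t) \<Rightarrow> psum (A t) p h i) x\<bar> \<le>
      \<bar>(case j of (i, j) \<Rightarrow> \<lambda>x. \<bar>psum (A j) p h i x\<bar> + \<bar>psum (g j) p h i x\<bar>) x\<bar> + e"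
    using eventually_gt_at_top[of 0]
  proof eventually_elim
    case (elim p)
    show ?case
    proof (intro ballI)
      fix h x i assume h: "h \<in> H p" and "x \<in> space (M p h)" and "i \<in> (Ds p \<times> {..p}) \<times> T"
      then obtain D k t where i: "i = ((D, k), t)" and D: "D \<in> Ds p" and k: "k \<le> p" and t: "t \<in> T" by auto
      obtain j where j: "j \<in> J" and le: "\<And>m x. \<bar>m\<bar> \<le> c \<Longrightarrow> \<bar>A t m x - A j m x\<bar> \<le> g j m x"
        using br[OF t] by blast
      have jT: "j \<in> T" using J j by auto
      have mean_le: "\<bar>mean (A t) m - mean (A j) m\<bar> \<le> mean (g j) m" if "\<bar>m\<bar> \<le> c" for m
      proof -
        have "mean (A t) m - mean (A j) m = (\<integral>x. A t m x - A j m x \<partial>gauss s2 m)"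
          unfolding mean_def using tame t jT that by (subst Bochner_Integration.integral_diff) (auto intro: tame_integrable)
        also have "\<bar>\<dots>\<bar> \<le> (\<integral>x. \<bar>A t m x - A j m x\<bar> \<partial>gauss s2 m)" by (rule integral_abs_bound)
        also have "\<dots> \<le> (\<integral>x. g j m x \<partial>gauss s2 m)"
          using le that tame t jT g(1)[OF j] by (intro integral_mono integrable_abs Bochner_Integration.integrable_diff tame_integrable) auto
        finally show ?thesis unfolding mean_def .
      qed
      \<comment> \<open>\<open>g j\<close> exceeds its deviation by \<open>mean (g j)\<close>, and
        the difference of the two means adds \<open>mean (g j)\<close> once more. This is why
        brackets of mean e / 2 are taken for accuracy e.\<close>
      have diff_le: "\<bar>dev (A t) p h D i x - dev (A j) p h D i x\<bar> \<le> dev (g j) p h D i x + e" if "i < k" for i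
      proof -
        have m: "\<bar>xi p h D i\<bar> \<le> c" using elim h D that k by (intro xi_bound) auto
        show "\<bar>dev (A t) p h D i x - dev (A j) p h D i x\<bar> \<le> dev (g j) p h D i x + e"
          unfolding dev_def using le[OF m, of "Z p D i x"] mean_le[OF m] g(2)[OF j m] by linarith
      qed
      have "\<bar>(\<Sum>i<k. dev (A t) p h D i x) - (\<Sum>i<k. dev (A j) p h D i x)\<bar> \<le>
          (\<Sum>i<k. dev (g j) p h D i x + e)"
        unfolding sum_subtractf[symmetric] using diff_le by (intro order_trans[OF sum_abs] sum_mono) auto
      also have "\<dots> = (\<Sum>i<k. dev (g j) p h D i x) + real k * e" by (simp add: sum.distrib)
      also have "\<dots> \<le> \<bar>\<Sum>i<k. dev (g j) p h D i x\<bar> + real p * e"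
        using k e by (intro add_mono mult_right_mono) auto
      finally have "\<bar>\<Sum>i<k. dev (A t) p h D i x\<bar> \<le>
          \<bar>\<Sum>i<k. dev (A j) p h D i x\<bar> + \<bar>\<Sum>i<k. dev (g j) p h D i x\<bar> + real p * e" by linarith
      then have "\<bar>\<Sum>i<k. dev (A t) p h D i x\<bar> / real p \<le>
          (\<bar>\<Sum>i<k. dev (A j) p h D i x\<bar> + \<bar>\<Sum>i<k. dev (g j) p h D i x\<bar> + real p * e) / real p"
        by (intro divide_right_mono) auto
      then have "\<bar>psum (A t) p h (D, k) x\<bar> \<le> \<bar>psum (A j) p h (D, k) x\<bar> + \<bar>psum (g j) p h (D, k) x\<bar> + e"
        using elim by (simp add: psum_def add_divide_distrib)
      then show "\<exists>j\<in>(Ds p \<times> {..p}) \<times> J. \<bar>(case i of (i, t) \<Rightarrow> psum (A t) p h i) x\<bar> \<le>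
          \<bar>(case j of (i, j) \<Rightarrow> \<lambda>x. \<bar>psum (A j) p h i x\<bar> + \<bar>psum (g j) p h i x\<bar>) x\<bar> + e"
        using D k j by (intro bexI[of _ "((D, k), j)"]) (auto simp: i)
    qed
  qed
  with negl show "\<exists>J G. negl (J :: nat \<Rightarrow> (('d \<times> nat) \<times> 't) set) G \<and> (\<forall>\<^sub>F p in sequentially. \<forall>h\<in>H p. \<forall>x\<in>space (M p h).
      \<forall>i\<in>(Ds p \<times> {..p}) \<times> T. \<exists>j\<in>J p. \<bar>(case i of (i, t) \<Rightarrow> psum (A t) p h i) x\<bar> \<le> \<bar>G p h j x\<bar> + e)"
    by (intro exI conjI)
qed

end

section \<open>Stein's identity and the threshold grid\<close>

text \<open>This is the part of x that soft thresholding removes. It replaces the quotient t /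
  \<bar>x\<bar>, and with it the exceptional point x = 0, by a bounded and piecewise linear
  function.\<close>

definition clip :: "real \<Rightarrow> real \<Rightarrow> real" where
  "clip t x = max (- t) (min t x)"

lemma clip_measurable [measurable]: "clip t \<in> borel_measurable borel"
  unfolding clip_def[abs_def] by measurable

lemma continuous_clip: "continuous_on A (clip t)"
  unfolding clip_def[abs_def] by (intro continuous_intros)

lemma abs_clip_le: "t \<ge> 0 \<Longrightarrow> \<bar>clip t x\<bar> \<le> t"
  by (auto simp: clip_def)

lemma soft_weight_mult: "t \<ge> 0 \<Longrightarrow> soft_weight t x * x = x - clip t x"
  by (auto simp: soft_weight_def clip_def max_def min_def field_simps abs_if split: if_splits)

lemma clip_square: "t \<ge> 0 \<Longrightarrow> (clip t x)\<^sup>2 = (min \<bar>x\<bar> t)\<^sup>2"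
  by (auto simp: clip_def max_def min_def abs_if)

lemma clip_has_derivative:
  assumes "t \<ge> 0" "x \<noteq> t" "x \<noteq> - t"
  shows "(clip t has_real_derivative indicator {-t..t} x) (at x)"
proof -
  consider "x < - t" | "- t < x" "x < t" | "x > t" using assms by linarith
  then show ?thesis
  proof cases
    case 1
    have "(clip t has_real_derivative 0) (at x) \<longleftrightarrow> ((\<lambda>_. - t) has_real_derivative 0) (at x)"
      using 1 assms by (intro DERIV_cong_ev eventually_mono[OF eventually_nhds_in_open[of "{..<-t}"]]) (auto simp: clip_def)
    then show ?thesis using 1 by simp
  next
    case 2
    have "(clip t has_real_derivative 1) (at x) \<longleftrightarrow> ((\<lambda>x. x) has_real_derivative 1) (at x)"
      using 2 assms by (intro DERIV_cong_ev eventually_mono[OF eventually_nhds_in_open[of "{-t<..<t}"]]) (auto simp: clip_def)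
    then show ?thesis using 2 by simp
  next
    case 3
    have "(clip t has_real_derivative 0) (at x) \<longleftrightarrow> ((\<lambda>_. t) has_real_derivative 0) (at x)"
      using 3 assms by (intro DERIV_cong_ev eventually_mono[OF eventually_nhds_in_open[of "{t<..}"]]) (auto simp: clip_def)
    then show ?thesis using 3 by simp
  qed
qed

lemma normal_density_has_derivative:
  assumes "\<sigma> > 0"
  shows "(normal_density m \<sigma> has_real_derivative - ((x - m) / \<sigma>\<^sup>2) * normal_density m \<sigma> x) (at x)"
proof -
  have "((\<lambda>x. - (x - m)\<^sup>2 / (2 * \<sigma>\<^sup>2)) has_real_derivative - ((x - m) / \<sigma>\<^sup>2)) (at x)"
    using assms by (auto intro!: derivative_eq_intros simp: field_simps)
  from DERIV_cmult[OF DERIV_fun_exp[OF this], of "1 / sqrt (2 * pi * \<sigma>\<^sup>2)"] show ?thesis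
    unfolding normal_density_def[abs_def] by (simp only: mult_ac)
qed

lemma normal_density_le:
  assumes "s2 > 0"
  shows "normal_density m (sqrt s2) x \<le> 1 / sqrt (2 * pi * s2)"
  unfolding normal_density_def using assms by (auto simp: divide_right_mono)

lemma normal_density_tendsto:
  assumes "s2 > 0"
  shows "(normal_density m (sqrt s2) \<longlongrightarrow> 0) at_top" "(normal_density m (sqrt s2) \<longlongrightarrow> 0) at_bot"
  unfolding normal_density_def[abs_def] using assms by real_asymp+

lemma (in gaussian_noise) integrable_stein_clip:
  assumes t: "t \<ge> 0"
  shows "integrable (gauss s2 m) (\<lambda>x. (x - m) * clip t x - s2 * indicator {-t..t} x)"
proof (rule Bochner_Integration.integrable_diff)
  interpret prob_space "gauss s2 m" using s2_pos by (rule prob_space_gauss)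
  show "integrable (gauss s2 m) (\<lambda>x. s2 * indicator {-t..t} x :: real)"
    by (intro integrable_mult_right) (simp add: emeasure_eq_measure)
  show "integrable (gauss s2 m) (\<lambda>x. (x - m) * clip t x)"
  proof (rule Bochner_Integration.integrable_bound)
    show "integrable (gauss s2 m) (\<lambda>x. t * \<bar>(x - m) ^ 1\<bar>)"
      by (intro integrable_mult_right integrable_abs integrable_gauss_power s2_pos)
    show "AE x in gauss s2 m. norm ((x - m) * clip t x) \<le> norm (t * \<bar>(x - m) ^ 1\<bar>)"
      using t abs_clip_le[OF t] by (intro AE_I2) (auto simp: abs_mult mult.commute[of t] intro!: mult_left_mono)
  qed simp
qed

text \<open>The normal density \<phi> satisfies s2 \<phi>' = - (x - m) \<phi>. Hence the integrand
  times \<phi> is the derivative of - s2 clip \<phi> except at the kinks t and -t. The fundamental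
  theorem with these exceptional points applies on [-N, N], and the boundary terms vanish because
  clip is bounded and \<phi> decays.\<close>

lemma (in gaussian_noise) stein_clip:
  assumes t: "t \<ge> 0"
  shows "(\<integral>x. (x - m) * clip t x - s2 * indicator {-t..t} x \<partial>gauss s2 m) = 0"
proof -
  define f where "f = (\<lambda>x. normal_density m (sqrt s2) x * ((x - m) * clip t x - s2 * indicator {-t..t} x))"
  define F where "F = (\<lambda>x. - s2 * (clip t x * normal_density m (sqrt s2) x))"
  have "integrable (gauss s2 m) (\<lambda>x. (x - m) * clip t x - s2 * indicator {-t..t} x)"
    using t by (rule integrable_stein_clip)
  then have f_int: "integrable lborel f"
    unfolding f_def by (subst (asm) integrable_gauss_iff) auto
  have deriv: "(F has_vector_derivative f x) (at x)" if "x \<notin> {-t, t}" for x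
  proof -
    have "((\<lambda>x. clip t x * normal_density m (sqrt s2) x) has_real_derivative
       (indicator {-t..t} x * normal_density m (sqrt s2) x +
         (- ((x - m) / (sqrt s2)\<^sup>2) * normal_density m (sqrt s2) x) * clip t x)) (at x)"
      using that s2_pos t by (intro DERIV_mult clip_has_derivative normal_density_has_derivative) auto
    then have "(F has_real_derivative - s2 * (indicator {-t..t} x * normal_density m (sqrt s2) x +
         (- ((x - m) / (sqrt s2)\<^sup>2) * normal_density m (sqrt s2) x) * clip t x)) (at x)"
      unfolding F_def by (rule DERIV_cmult)
    moreover have "- s2 * (indicator {-t..t} x * normal_density m (sqrt s2) x +
         (- ((x - m) / (sqrt s2)\<^sup>2) * normal_density m (sqrt s2) x) * clip t x) = f x"
      using s2_pos by (simp add: f_def field_simps)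
    ultimately show ?thesis by (simp add: has_real_derivative_iff_has_vector_derivative)
  qed
  have cont: "continuous_on A F" for A
  proof -
    have "continuous_on A (normal_density m (sqrt s2))"
      using normal_density_has_derivative[of "sqrt s2" m] s2_pos
      by (intro DERIV_continuous_on) (auto intro: has_field_derivative_at_within)
    then show ?thesis unfolding F_def by (intro continuous_intros continuous_clip)
  qed
  have part: "(\<integral>x. indicator {-real N..real N} x * f x \<partial>lborel) = F (real N) - F (- real N)" for N
  proof -
    have "(f has_integral (F (real N) - F (- real N))) {- real N..real N}"
      using deriv cont by (intro fundamental_theorem_of_calculus_interior_strong[of "{-t, t}"]) auto
    moreover have "set_integrable lborel {- real N..real N} f"
      unfolding set_integrable_def using f_int by (intro integrable_mult_indicator) auto
    ultimately show ?thesis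
      using set_borel_integral_eq_integral(2) unfolding set_lebesgue_integral_def
      by (metis (no_types, lifting) Bochner_Integration.integral_cong integral_unique real_scaleR_def)
  qed
  have lim1: "(\<lambda>N. \<integral>x. indicator {-real N..real N} x * f x \<partial>lborel) \<longlonglongrightarrow> (\<integral>x. f x \<partial>lborel)"
  proof (rule integral_dominated_convergence[where w="\<lambda>x. \<bar>f x\<bar>"])
    show "AE x in lborel. (\<lambda>N. indicator {-real N..real N} x * f x) \<longlonglongrightarrow> f x"
    proof (intro AE_I2 tendsto_eventually)
      fix x :: real
      have "\<forall>\<^sub>F N in sequentially. \<bar>x\<bar> \<le> real N"
        using filterlim_real_sequentially by (auto simp: filterlim_at_top)
      then show "\<forall>\<^sub>F N in sequentially. indicator {-real N..real N} x * f x = f x"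
        by eventually_elim (auto simp: indicator_def)
    qed
  qed (use f_int in \<open>auto simp: indicator_def\<close>)
  have F_le: "\<bar>F x\<bar> \<le> s2 * t * normal_density m (sqrt s2) x" for x
    unfolding F_def using s2_pos abs_clip_le[OF t, of x] normal_density_nonneg[of m "sqrt s2" x]
    by (auto simp: abs_mult mult.assoc intro!: mult_left_mono mult_right_mono)
  have top: "(F \<longlongrightarrow> 0) at_top"
    using F_le by (intro Lim_null_comparison[OF _ tendsto_mult_right_zero[OF normal_density_tendsto(1)[OF s2_pos, of m], of "s2 * t"]]) auto
  have bot: "(F \<longlongrightarrow> 0) at_bot"
    using F_le by (intro Lim_null_comparison[OF _ tendsto_mult_right_zero[OF normal_density_tendsto(2)[OF s2_pos, of m], of "s2 * t"]]) auto
  have "filterlim (\<lambda>N. - real N) at_bot sequentially"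
    by (simp add: filterlim_uminus_at_bot filterlim_real_sequentially)
  from tendsto_diff[OF filterlim_compose[OF top filterlim_real_sequentially] filterlim_compose[OF bot this]]
  have "(\<lambda>N. F (real N) - F (- real N)) \<longlonglongrightarrow> 0" by simp
  then have "(\<integral>x. f x \<partial>lborel) = 0"
    using lim1 unfolding part by (metis LIMSEQ_unique)
  then show ?thesis unfolding f_def by (subst integral_gauss) auto
qed

section \<open>Coordinatewise soft thresholding: unbiased risk and brackets\<close>

context gaussian_noise
begin

definition st_loss :: "real \<Rightarrow> real \<Rightarrow> real \<Rightarrow> real" where
  "st_loss t m x = (soft_weight t x * x - m)\<^sup>2"

text \<open>The true variance stands here in place of its estimate, which leaves a function of a
  single coordinate. The cost of the substitution is settled by
  \<open>array_rhat_lipschitz\<close>.\<close>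

definition st_rhat :: "real \<Rightarrow> real \<Rightarrow> real \<Rightarrow> real" where
  "st_rhat t m x = s2 * (1 - 2 * indicator {-t..t} x) + (min \<bar>x\<bar> t)\<^sup>2"

lemma soft_weight_measurable [measurable]: "soft_weight t \<in> borel_measurable borel"
  unfolding soft_weight_def[abs_def] by measurable

lemma st_loss_measurable: "st_loss t m \<in> borel_measurable borel"
  unfolding st_loss_def[abs_def] by measurable

lemma st_rhat_measurable: "st_rhat t m \<in> borel_measurable borel"
  unfolding st_rhat_def[abs_def] by measurable

text \<open>The quantity v = (1 + c) (1 + \<bar>x - m\<bar>) dominates 1, \<bar>x\<bar> and
  \<bar>m\<bar> at once, so quadratic and cubic bounds in these can be replaced by multiples of v ^
  4. The factor 8 comes from applying (1 + y)^2 \<le> 2 (1 + y^2) twice.\<close>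

lemma poly_weight_bound:
  assumes "\<bar>m\<bar> \<le> c"
  obtains v where "1 \<le> v" "\<bar>x\<bar> \<le> v" "\<bar>m\<bar> \<le> v" "v\<^sup>2 \<le> v ^ 4" "v ^ 3 \<le> v ^ 4" "1 \<le> v ^ 4" 
    "v ^ 4 \<le> 8 * (1 + c) ^ 4 * (1 + (x - m) ^ 4)"
proof -
  define v where "v = (1 + c) * (1 + \<bar>x - m\<bar>)"
  have c: "c > 0" by (rule c_pos)
  have prod: "v = 1 + c + \<bar>x - m\<bar> + c * \<bar>x - m\<bar>" by (simp add: v_def algebra_simps)
  have nn: "c * \<bar>x - m\<bar> \<ge> 0" using c by simp
  have v1: "1 \<le> v" unfolding prod using c nn by linarith
  moreover have "\<bar>x\<bar> \<le> v" "\<bar>m\<bar> \<le> v" unfolding prod using c nn assms by linarith+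
  moreover have "v\<^sup>2 \<le> v ^ 4" "v ^ 3 \<le> v ^ 4" "1 \<le> v ^ 4"
    using v1 by (auto intro!: power_increasing simp del: power_one_right)
  moreover have "v ^ 4 \<le> 8 * (1 + c) ^ 4 * (1 + (x - m) ^ 4)"
  proof -
    define e where "e = \<bar>x - m\<bar>"
    have sq: "(1 + y)\<^sup>2 \<le> 2 * (1 + y\<^sup>2)" for y :: real
      using zero_le_power2[of "1 - y"] by (simp add: power2_eq_square algebra_simps)
    have "(1 + e) ^ 4 = ((1 + e)\<^sup>2)\<^sup>2" by simp
    also have "\<dots> \<le> (2 * (1 + e\<^sup>2))\<^sup>2" using sq by (intro power_mono) auto
    also have "\<dots> = 4 * (1 + e\<^sup>2)\<^sup>2" unfolding power_mult_distrib by simp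
    also have "\<dots> \<le> 4 * (2 * (1 + (e\<^sup>2)\<^sup>2))" using sq[of "e\<^sup>2"] by (intro mult_left_mono) auto
    also have "\<dots> = 8 * (1 + (x - m) ^ 4)" by (simp add: e_def)
    finally have "(1 + c) ^ 4 * (1 + e) ^ 4 \<le> (1 + c) ^ 4 * (8 * (1 + (x - m) ^ 4))"
      using c by (intro mult_left_mono) auto
    then show ?thesis unfolding v_def e_def power_mult_distrib by (simp only: mult_ac)
  qed
  ultimately show thesis using that[of v] by simp
qed

lemma abs_soft_le: "t \<ge> 0 \<Longrightarrow> \<bar>soft_weight t x * x\<bar> \<le> \<bar>x\<bar>"
  unfolding soft_weight_mult clip_def by linarith

lemma tame_st_loss:
  assumes "t \<ge> 0"
  shows "tame (st_loss t)"
proof (rule tameI[where K="4 * (8 * (1 + c) ^ 4)"])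
  fix m x :: real assume m: "\<bar>m\<bar> \<le> c"
  obtain v where v: "1 \<le> v" "\<bar>x\<bar> \<le> v" "\<bar>m\<bar> \<le> v" "v\<^sup>2 \<le> v ^ 4"
    "v ^ 4 \<le> 8 * (1 + c) ^ 4 * (1 + (x - m) ^ 4)"
    using poly_weight_bound[OF m] by metis
  have "\<bar>st_loss t m x\<bar> = \<bar>soft_weight t x * x - m\<bar>\<^sup>2" by (simp add: st_loss_def)
  also have "\<dots> \<le> (2 * v)\<^sup>2"
    using abs_soft_le[OF assms, of x] v by (intro power_mono) auto
  also have "\<dots> = 4 * v\<^sup>2" by (simp add: power_mult_distrib)
  also have "\<dots> \<le> 4 * (8 * (1 + c) ^ 4 * (1 + (x - m) ^ 4))" using v by linarith
  finally show "\<bar>st_loss t m x\<bar> \<le> 4 * (8 * (1 + c) ^ 4) * (1 + (x - m) ^ 4)" by simp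
qed (rule st_loss_measurable)

lemma tame_st_rhat:
  assumes "t \<ge> 0"
  shows "tame (st_rhat t)"
proof (rule tameI[where K="(s2 + 1) * (8 * (1 + c) ^ 4)"])
  fix m x :: real assume m: "\<bar>m\<bar> \<le> c"
  obtain v where v: "1 \<le> v" "\<bar>x\<bar> \<le> v" "\<bar>m\<bar> \<le> v" "v\<^sup>2 \<le> v ^ 4" "1 \<le> v ^ 4"
    "v ^ 4 \<le> 8 * (1 + c) ^ 4 * (1 + (x - m) ^ 4)"
    using poly_weight_bound[OF m] by metis
  have "\<bar>s2 * (1 - 2 * indicator {-t..t} x)\<bar> = s2 * 1" using s2_pos by (auto simp: indicator_def)
  also have "\<dots> \<le> s2 * v ^ 4" using v s2_pos by (intro mult_left_mono) auto
  finally have 1: "\<bar>s2 * (1 - 2 * indicator {-t..t} x)\<bar> \<le> s2 * v ^ 4" .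
  have "(min \<bar>x\<bar> t)\<^sup>2 \<le> v\<^sup>2" using v assms by (intro power_mono) auto
  with v have 2: "\<bar>(min \<bar>x\<bar> t)\<^sup>2\<bar> \<le> v ^ 4" by simp
  have "\<bar>st_rhat t m x\<bar> \<le> (s2 + 1) * v ^ 4" unfolding st_rhat_def distrib_right mult_1 using 1 2 by linarith
  also have "\<dots> \<le> (s2 + 1) * (8 * (1 + c) ^ 4 * (1 + (x - m) ^ 4))"
    using v s2_pos by (intro mult_left_mono) auto
  finally show "\<bar>st_rhat t m x\<bar> \<le> (s2 + 1) * (8 * (1 + c) ^ 4) * (1 + (x - m) ^ 4)" by (simp add: mult.assoc)
qed (rule st_rhat_measurable)

text \<open>With x - clip for the thresholded value, the loss is (x - m)^2 - 2 (x - m) clip +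
  clip^2. Subtraction of the estimated risk cancels clip^2 and leaves (x - m)^2 - s2 minus twice the
  integrand of Stein's identity; both have mean 0.\<close>

lemma sure:
  assumes t: "t \<ge> 0" and m: "\<bar>m\<bar> \<le> c"
  shows "mean (st_loss t) m = mean (st_rhat t) m"
proof -
  interpret prob_space "gauss s2 m" using s2_pos by (rule prob_space_gauss)
  have "mean (st_loss t) m - mean (st_rhat t) m = (\<integral>x. st_loss t m x - st_rhat t m x \<partial>gauss s2 m)"
    unfolding mean_def using assms
    by (intro Bochner_Integration.integral_diff[symmetric] tame_integrable tame_st_loss tame_st_rhat)
  also have "(\<lambda>x. st_loss t m x - st_rhat t m x) =
      (\<lambda>x. ((x - m) ^ 2 - s2) - 2 * ((x - m) * clip t x - s2 * indicator {-t..t} x))"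
    by (simp add: fun_eq_iff st_loss_def st_rhat_def soft_weight_mult[OF t] clip_square[OF t, symmetric])
      (simp add: power2_eq_square algebra_simps)
  also have "(\<integral>x. ((x - m) ^ 2 - s2) - 2 * ((x - m) * clip t x - s2 * indicator {-t..t} x) \<partial>gauss s2 m) =
      (\<integral>x. (x - m) ^ 2 - s2 \<partial>gauss s2 m) - 2 * (\<integral>x. (x - m) * clip t x - s2 * indicator {-t..t} x \<partial>gauss s2 m)"
  proof -
    have diff: "(\<integral>x. u x - 2 * v x \<partial>gauss s2 m) = (\<integral>x. u x \<partial>gauss s2 m) - 2 * (\<integral>x. v x \<partial>gauss s2 m)"
      if "integrable (gauss s2 m) u" "integrable (gauss s2 m) v" for u v :: "real \<Rightarrow> real"
      using that by simp
    show ?thesis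
      by (intro diff integrable_stein_clip[OF t]) (use integrable_gauss_power[OF s2_pos, of m 2] in simp)
  qed
  also have "\<dots> = (\<integral>x. (x - m) ^ 2 - s2 \<partial>gauss s2 m)" using stein_clip[OF t] by simp
  also have "\<dots> = (\<integral>x. (x - m) ^ 2 \<partial>gauss s2 m) - s2"
    using integrable_gauss_power[OF s2_pos, of m 2]
    by (subst Bochner_Integration.integral_diff) (auto simp: prob_space[simplified])
  also have "\<dots> = 0" using integral_gauss_even_power[OF s2_pos, of m 1] by simp
  finally show ?thesis by simp
qed

text \<open>The density is bounded by its value at the mean, so a band of width \<delta> has
  probability of order \<delta> wherever it lies. This tames the jump of the indicator in t.\<close>

lemma gauss_interval_le:
  assumes "a \<le> b"
  shows "(\<integral>x. indicator {a..b} x \<partial>gauss s2 m) \<le> (b - a) / sqrt (2 * pi * s2)"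
proof -
  have "(\<integral>x. indicator {a..b} x \<partial>gauss s2 m) = (\<integral>x. normal_density m (sqrt s2) x * indicator {a..b} x \<partial>lborel)"
    by (rule integral_gauss) simp
  also have "\<dots> \<le> (\<integral>x. (1 / sqrt (2 * pi * s2)) * indicator {a..b} x \<partial>lborel)"
  proof (rule integral_mono)
    show "integrable lborel (\<lambda>x. normal_density m (sqrt s2) x * indicator {a..b} x)"
      using integrable_mult_indicator[of "{a..b}" lborel "normal_density m (sqrt s2)"] s2_pos
      by (simp add: mult.commute)
    show "integrable lborel (\<lambda>x. (1 / sqrt (2 * pi * s2)) * indicator {a..b} x)"
      by (intro integrable_mult_right integrable_real_indicator) (auto simp: emeasure_lborel_Icc_eq)
  qed (intro mult_right_mono normal_density_le s2_pos, simp)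
  also have "\<dots> = (b - a) / sqrt (2 * pi * s2)" using assms by simp
  finally show ?thesis .
qed

text \<open>Up to N \<delta> the grid point just below t serves: the thresholded values differ by at
  most \<delta>, and the indicators differ only on two bands of width \<delta>. Any larger t is sent
  to the last grid point T. A change then requires \<bar>x\<bar> > T \<ge> 1 / \<delta>, hence 1
  \<le> \<delta> \<bar>x\<bar>, and \<open>\<delta> * (1 + x\<^sup>2)\<close> absorbs it. A finite
  grid thus covers an unbounded range of thresholds.\<close>

lemma threshold_grid:
  assumes \<delta>: "0 < \<delta>" and N: "1 / \<delta> \<le> real N * \<delta>" and t: "t \<ge> 0"
  obtains j where "j \<le> N"
    "\<And>x. \<bar>soft_weight t x * x - soft_weight (real j * \<delta>) x * x\<bar> \<le> \<delta> * (1 + x\<^sup>2)"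
    "\<And>x. \<bar>indicator {-t..t} x - indicator {- (real j * \<delta>)..real j * \<delta>} x\<bar> \<le>
       indicator {real j * \<delta>..real j * \<delta> + \<delta>} x + indicator {- (real j * \<delta>) - \<delta>..- (real j * \<delta>)} x + \<delta> * (1 + x\<^sup>2)"
proof (cases "t \<le> real N * \<delta>")
  case True
  define j where "j = nat \<lfloor>t / \<delta>\<rfloor>"
  have "t / \<delta> \<ge> 0" using \<delta> t by simp
  then have fl: "real j \<le> t / \<delta>" "t / \<delta> < real j + 1" unfolding j_def by linarith+
  have j1: "real j * \<delta> \<le> t" using fl \<delta> by (simp add: field_simps)
  have j2: "t \<le> real j * \<delta> + \<delta>" using fl \<delta> by (simp add: field_simps)
  have "real j * \<delta> \<le> real N * \<delta>" using j1 True by linarith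
  then have jN: "j \<le> N" using \<delta> by simp
  have j0: "real j * \<delta> \<ge> 0" using \<delta> by simp
  have "\<bar>soft_weight t x * x - soft_weight (real j * \<delta>) x * x\<bar> \<le> \<delta> * (1 + x\<^sup>2)" for x
  proof -
    have "\<bar>soft_weight t x * x - soft_weight (real j * \<delta>) x * x\<bar> \<le> \<delta> * 1"
      unfolding soft_weight_mult[OF t] soft_weight_mult[OF j0] clip_def using j1 j2 by linarith
    also have "\<dots> \<le> \<delta> * (1 + x\<^sup>2)" using \<delta> by (intro mult_left_mono) auto
    finally show ?thesis .
  qed
  moreover have "\<bar>indicator {-t..t} x - indicator {- (real j * \<delta>)..real j * \<delta>} x\<bar> \<le>
     (indicator {real j * \<delta>..real j * \<delta> + \<delta>} x + indicator {- (real j * \<delta>) - \<delta>..- (real j * \<delta>)} x + \<delta> * (1 + x\<^sup>2) :: real)" for x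
    using j1 j2 j0 \<delta> by (auto simp: indicator_def)
  ultimately show thesis using jN that by blast
next
  case False
  define T where "T = real N * \<delta>"
  have T: "T \<le> t" "1 / \<delta> \<le> T" using False N by (auto simp: T_def)
  have T0: "T \<ge> 0" using \<delta> by (simp add: T_def)
  have big: "\<bar>x\<bar> \<le> \<delta> * x\<^sup>2 \<and> 1 \<le> \<delta> * (1 + x\<^sup>2)" if "\<bar>x\<bar> > T" for x
  proof -
    have a: "1 \<le> \<delta> * \<bar>x\<bar>" using that T \<delta> by (simp add: field_simps) (smt (verit) mult.commute mult_left_mono)
    then have "\<bar>x\<bar> * 1 \<le> \<bar>x\<bar> * (\<delta> * \<bar>x\<bar>)" by (intro mult_left_mono) auto
    then have b: "\<bar>x\<bar> \<le> \<delta> * x\<^sup>2" by (simp add: power2_eq_square mult_ac)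
    have "\<bar>x\<bar> \<le> 1 + x\<^sup>2" using zero_le_power2[of "\<bar>x\<bar> - 1"] by (simp add: power2_eq_square algebra_simps)
    then have "\<delta> * \<bar>x\<bar> \<le> \<delta> * (1 + x\<^sup>2)" using \<delta> by (intro mult_left_mono) auto
    with a b show ?thesis by linarith
  qed
  have soft: "\<bar>soft_weight t x * x - soft_weight T x * x\<bar> \<le> \<delta> * (1 + x\<^sup>2)" for x
  proof (cases "\<bar>x\<bar> > T")
    case True
    have "\<bar>soft_weight t x * x - soft_weight T x * x\<bar> \<le> \<bar>x\<bar>"
      unfolding soft_weight_mult[OF t] soft_weight_mult[OF T0] clip_def using T T0 by linarith
    then show ?thesis using big[OF True] \<delta> by (simp add: distrib_left)
  next
    case False
    then have "soft_weight t x * x - soft_weight T x * x = 0"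
      unfolding soft_weight_mult[OF t] soft_weight_mult[OF T0] clip_def using T T0 by linarith
    then show ?thesis using \<delta> by (simp only: abs_zero) simp
  qed
  have ind: "\<bar>indicator {-t..t} x - indicator {- T..T} x\<bar> \<le>
     (indicator {T..T + \<delta>} x + indicator {- T - \<delta>..- T} x + \<delta> * (1 + x\<^sup>2) :: real)" for x
  proof (cases "\<bar>x\<bar> > T")
    case True
    have "\<bar>indicator {-t..t} x - indicator {- T..T} x\<bar> \<le> (1 :: real)" by (auto simp: indicator_def)
    also have "\<dots> \<le> \<delta> * (1 + x\<^sup>2)" using big[OF True] by simp
    finally show ?thesis by (auto simp: indicator_def)
  next
    case False
    then show ?thesis using T \<delta> by (auto simp: indicator_def)
  qed
  show thesis using soft ind that[of N] by (simp add: T_def)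
qed

lemma mean_weight: "mean (\<lambda>m x. k * (1 + (x - m) ^ 4)) m = k * (1 + 3 * s2\<^sup>2)"
  unfolding mean_def integral_mult_right_zero integral_weight ..

lemma tame_weight: "tame (\<lambda>m x. k * (1 + (x - m) ^ 4))"
  by (rule tame_cmult, rule tameI[where K=1]) auto

text \<open>With s and s' the values of x thresholded at t and at the grid point, the losses differ
  by (s - s') (s + s' - 2 m). Since (min \<bar>x\<bar> t)^2 = (x - s)^2, the quadratic parts of the
  estimated risks differ by (s - s') (s + s' - 2 x). Both are small through the factor s - s'; only
  the jump of the indicator needs the bands.\<close>

lemma soft_threshold_bracket:
  assumes e: "e > 0" and A: "A = st_loss \<or> A = st_rhat"
  shows "\<exists>J g. finite J \<and> J \<subseteq> {0..} \<and>
      (\<forall>j\<in>J. tame (g j) \<and> (\<forall>m. \<bar>m\<bar> \<le> c \<longrightarrow> mean (g j) m \<le> e)) \<and>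
      (\<forall>t\<in>{0..}. \<exists>j\<in>J. \<forall>m x. \<bar>m\<bar> \<le> c \<longrightarrow> \<bar>A t m x - A j m x\<bar> \<le> g j m x)"
proof -
  \<comment> \<open>In K, 8 is the constant of \<open>prod\<close>, \<open>4 * s2\<close> is
    \<open>2 * s2\<close> times the indicator error \<open>2 * \<delta> * v ^ 4\<close>, and the
    last factor turns v ^ 4 into the quartic weight. R is the bound for the mean of g per unit of
    \<delta>, with two bands under a density of at most \<open>1 / sqrt (2 * pi * s2)\<close>; so
    \<delta> = e / R yields mean at most e.\<close>
  define K where "K = (8 + 4 * s2) * (8 * (1 + c) ^ 4)"
  define R where "R = K * (1 + 3 * s2\<^sup>2) + 2 * s2 * (2 / sqrt (2 * pi * s2))"
  define \<delta> where "\<delta> = e / R"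
  have K: "K > 0" using s2_pos c_pos by (simp add: K_def)
  have R: "R > 0" unfolding R_def using K s2_pos by (intro add_pos_nonneg mult_pos_pos) auto
  have \<delta>: "\<delta> > 0" using R e by (simp add: \<delta>_def)
  define N where "N = nat \<lceil>1 / \<delta> / \<delta>\<rceil>"
  have "1 / \<delta> / \<delta> \<le> real N" unfolding N_def by linarith
  then have N: "1 / \<delta> \<le> real N * \<delta>" using \<delta> by (simp add: field_simps)
  define I where "I = (\<lambda>t x. indicator {t..t + \<delta>} x + indicator {- t - \<delta>..- t} x :: real)"
  define g where "g = (\<lambda>t m x. \<delta> * K * (1 + (x - m) ^ 4) + 2 * s2 * I t x)"
  have I_nice: "tame (\<lambda>m x. I t x)" for t
    unfolding I_def by (intro tame_add; rule tame_dominated[OF tame_const[of 1]]) (auto simp: indicator_def)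
  have I_nonneg: "I t x \<ge> 0" for t x by (auto simp: I_def)
  have I_mean: "mean (\<lambda>m x. I t x) m \<le> \<delta> * (2 / sqrt (2 * pi * s2))" if "\<bar>m\<bar> \<le> c" for t m
  proof -
    have *: "tame (\<lambda>m x. indicator {a..b} x)" for a b :: real
      by (rule tame_dominated[OF tame_const[of 1]]) (auto simp: indicator_def)
    have "mean (\<lambda>m x. I t x) m = mean (\<lambda>m x. indicator {t..t + \<delta>} x) m + mean (\<lambda>m x. indicator {- t - \<delta>..- t} x) m"
      unfolding I_def by (rule mean_add[OF * * that])
    also have "\<dots> \<le> \<delta> / sqrt (2 * pi * s2) + \<delta> / sqrt (2 * pi * s2)"
      unfolding mean_def
      using gauss_interval_le[of t "t + \<delta>" m] gauss_interval_le[of "- t - \<delta>" "- t" m] \<delta>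
      by (intro add_mono) auto
    finally show ?thesis by (simp add: mult.commute)
  qed
  have g_nice: "tame (g t)" for t
    unfolding g_def by (intro tame_add tame_weight tame_cmult I_nice)
  have g_mean: "mean (g t) m \<le> e" if "\<bar>m\<bar> \<le> c" for t m
  proof -
    have "mean (g t) m = \<delta> * K * (1 + 3 * s2\<^sup>2) + 2 * s2 * mean (\<lambda>m x. I t x) m"
      unfolding g_def by (subst mean_add[OF tame_weight tame_cmult[OF I_nice] that]) (simp only: mean_weight mean_cmult)
    also have "\<dots> \<le> \<delta> * K * (1 + 3 * s2\<^sup>2) + 2 * s2 * (\<delta> * (2 / sqrt (2 * pi * s2)))"
      using I_mean[OF that] s2_pos by (intro add_left_mono mult_left_mono) auto
    also have "\<dots> = \<delta> * R" by (simp add: R_def algebra_simps)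
    also have "\<dots> = e" using R by (simp add: \<delta>_def)
    finally show ?thesis .
  qed
  have "\<exists>j\<in>(\<lambda>i. real i * \<delta>) ` {..N}. \<forall>m x. \<bar>m\<bar> \<le> c \<longrightarrow> \<bar>A t m x - A j m x\<bar> \<le> g j m x" if t: "t \<ge> 0" for t
  proof -
    obtain i where i: "i \<le> N"
      and soft: "\<And>x. \<bar>soft_weight t x * x - soft_weight (real i * \<delta>) x * x\<bar> \<le> \<delta> * (1 + x\<^sup>2)"
      and ind: "\<And>x. \<bar>indicator {-t..t} x - indicator {- (real i * \<delta>)..real i * \<delta>} x\<bar> \<le>
        indicator {real i * \<delta>..real i * \<delta> + \<delta>} x + indicator {- (real i * \<delta>) - \<delta>..- (real i * \<delta>)} x + \<delta> * (1 + x\<^sup>2)"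
      using threshold_grid[OF \<delta> N t] by blast
    define u where "u = real i * \<delta>"
    have u: "u \<ge> 0" using \<delta> by (simp add: u_def)
    have "\<bar>A t m x - A u m x\<bar> \<le> g u m x" if m: "\<bar>m\<bar> \<le> c" for m x
    proof -
      obtain v where v: "1 \<le> v" "\<bar>x\<bar> \<le> v" "\<bar>m\<bar> \<le> v" "v\<^sup>2 \<le> v ^ 4" "v ^ 3 \<le> v ^ 4"
        "v ^ 4 \<le> 8 * (1 + c) ^ 4 * (1 + (x - m) ^ 4)"
        using poly_weight_bound[OF m] by metis
      define s s' where "s = soft_weight t x * x" and "s' = soft_weight u x * x"
      have x2: "1 + x\<^sup>2 \<le> 2 * v\<^sup>2"
      proof -
        have "x\<^sup>2 \<le> v\<^sup>2" using v by (metis abs_ge_zero power2_abs power_mono)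
        moreover have "1 \<le> v\<^sup>2" using v by simp
        ultimately show ?thesis by linarith
      qed
      have "\<delta> * (1 + x\<^sup>2) \<le> \<delta> * (2 * v\<^sup>2)" using \<delta> x2 by (intro mult_left_mono) auto
      then have ss: "\<bar>s - s'\<bar> \<le> \<delta> * (2 * v\<^sup>2)" using soft[of x] unfolding s_def s'_def u_def by linarith
      have sle: "\<bar>s\<bar> \<le> v" "\<bar>s'\<bar> \<le> v" unfolding s_def s'_def
        using abs_soft_le[OF t, of x] abs_soft_le[OF u, of x] v by linarith+
      have w: "\<delta> * (8 + 4 * s2) * v ^ 4 \<le> \<delta> * K * (1 + (x - m) ^ 4)"
      proof -
        have "\<delta> * (8 + 4 * s2) * v ^ 4 \<le> \<delta> * (8 + 4 * s2) * (8 * (1 + c) ^ 4 * (1 + (x - m) ^ 4))"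
          using v \<delta> s2_pos by (intro mult_left_mono) auto
        then show ?thesis by (simp only: K_def mult_ac)
      qed
      have prod: "\<bar>(s - s') * y\<bar> \<le> 8 * \<delta> * v ^ 4" if "\<bar>y\<bar> \<le> 4 * v" for y
      proof -
        have "\<bar>(s - s') * y\<bar> \<le> \<delta> * (2 * v\<^sup>2) * (4 * v)"
          unfolding abs_mult using ss that \<delta> by (intro mult_mono) auto
        also have "\<dots> = 8 * \<delta> * v ^ 3" by (simp add: power2_eq_square power3_eq_cube)
        also have "\<dots> \<le> 8 * \<delta> * v ^ 4" using v \<delta> by (intro mult_left_mono) auto
        finally show ?thesis .
      qed
      show ?thesis using A
      proof
        assume "A = st_loss"
        then have "A t m x - A u m x = (s - s') * (s + s' - 2 * m)"
          by (simp add: st_loss_def s_def s'_def power2_eq_square algebra_simps)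
        moreover have "\<bar>s + s' - 2 * m\<bar> \<le> 4 * v" using sle v by linarith
        ultimately have "\<bar>A t m x - A u m x\<bar> \<le> 8 * \<delta> * v ^ 4" using prod by metis
        also have "\<dots> \<le> \<delta> * (8 + 4 * s2) * v ^ 4"
          using \<delta> s2_pos v by (intro mult_right_mono) (auto simp: distrib_left)
        also note w
        also have "\<delta> * K * (1 + (x - m) ^ 4) \<le> g u m x" using I_nonneg[of u x] s2_pos by (simp add: g_def)
        finally show ?thesis .
      next
        assume A': "A = st_rhat"
        define d where "d = indicator {-t..t} x - (indicator {- u..u} x :: real)"
        have cl: "(min \<bar>x\<bar> t)\<^sup>2 = (x - s)\<^sup>2" "(min \<bar>x\<bar> u)\<^sup>2 = (x - s')\<^sup>2"
          unfolding s_def s'_def by (simp_all add: soft_weight_mult t u clip_square)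
        have eq: "A t m x - A u m x = (s - s') * (s + s' - 2 * x) - 2 * s2 * d"
          unfolding A' st_rhat_def cl d_def by (simp add: power2_eq_square algebra_simps)
        have "\<bar>s + s' - 2 * x\<bar> \<le> 4 * v" using sle v by linarith
        then have 1: "\<bar>(s - s') * (s + s' - 2 * x)\<bar> \<le> 8 * \<delta> * v ^ 4" by (rule prod)
        have "\<bar>d\<bar> \<le> I u x + \<delta> * (2 * v\<^sup>2)"
          using ind[of x] \<open>\<delta> * (1 + x\<^sup>2) \<le> \<delta> * (2 * v\<^sup>2)\<close> unfolding d_def I_def u_def by linarith
        also have "\<delta> * (2 * v\<^sup>2) \<le> 2 * \<delta> * v ^ 4" using v \<delta> by simp
        finally have "\<bar>d\<bar> \<le> I u x + 2 * \<delta> * v ^ 4" by simp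
        then have "\<bar>2 * s2 * d\<bar> \<le> 2 * s2 * (I u x + 2 * \<delta> * v ^ 4)"
          using s2_pos by (simp add: abs_mult)
        with 1 have "\<bar>A t m x - A u m x\<bar> \<le> \<delta> * (8 + 4 * s2) * v ^ 4 + 2 * s2 * I u x"
          unfolding eq by (simp add: algebra_simps)
        also have "\<dots> \<le> g u m x" using w by (simp add: g_def)
        finally show ?thesis .
      qed
    qed
    then show ?thesis using i by (auto simp: u_def)
  qed
  then show ?thesis
    using g_nice g_mean \<delta> by (intro exI[of _ "(\<lambda>i. real i * \<delta>) ` {..N}"] exI[of _ g]) auto
qed

end

section \<open>Deviations of loss and estimated risk\<close>

context gaussian_noise
begin

definition ms_loss :: "real \<Rightarrow> real \<Rightarrow> real \<Rightarrow> real" where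
  "ms_loss a m x = (a * x - m)\<^sup>2"

lemma tame_square: "tame (\<lambda>m x. x\<^sup>2)"
proof (rule tameI[where K="8 * (1 + c) ^ 4"])
  fix m x :: real assume m: "\<bar>m\<bar> \<le> c"
  obtain v where v: "\<bar>x\<bar> \<le> v" "v\<^sup>2 \<le> v ^ 4" "v ^ 4 \<le> 8 * (1 + c) ^ 4 * (1 + (x - m) ^ 4)"
    using poly_weight_bound[OF m] by metis
  have "x\<^sup>2 \<le> v\<^sup>2" using v by (metis abs_ge_zero power2_abs power_mono)
  then show "\<bar>x\<^sup>2\<bar> \<le> 8 * (1 + c) ^ 4 * (1 + (x - m) ^ 4)" using v by simp
qed simp

lemma tame_linear: "tame (\<lambda>m x. m * x)"
proof (rule tameI[where K="8 * (1 + c) ^ 4"])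
  fix m x :: real assume m: "\<bar>m\<bar> \<le> c"
  obtain v where v: "1 \<le> v" "\<bar>x\<bar> \<le> v" "\<bar>m\<bar> \<le> v" "v\<^sup>2 \<le> v ^ 4" "v ^ 4 \<le> 8 * (1 + c) ^ 4 * (1 + (x - m) ^ 4)"
    using poly_weight_bound[OF m] by metis
  have "\<bar>m * x\<bar> \<le> v\<^sup>2" using v by (auto simp: abs_mult power2_eq_square intro!: mult_mono)
  then show "\<bar>m * x\<bar> \<le> 8 * (1 + c) ^ 4 * (1 + (x - m) ^ 4)" using v by simp
qed simp

lemma tame_mean_square: "tame (\<lambda>m x. m\<^sup>2)"
proof (rule tame_dominated[OF tame_const[of "c\<^sup>2"]])
  fix m x :: real assume m: "\<bar>m\<bar> \<le> c"
  then have "m\<^sup>2 \<le> c\<^sup>2" using c_pos by (metis abs_le_square_iff abs_of_pos)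
  then show "\<bar>m\<^sup>2\<bar> \<le> \<bar>c\<^sup>2\<bar>" by simp
qed simp

lemma mean_const: "mean (\<lambda>m x. k m) m = k m"
proof -
  interpret prob_space "gauss s2 m" using s2_pos by (rule prob_space_gauss)
  show ?thesis by (simp add: mean_def prob_space[simplified])
qed

lemma mean_linear: "mean (\<lambda>m x. m * x) m = m\<^sup>2"
proof -
  interpret prob_space "gauss s2 m" using s2_pos by (rule prob_space_gauss)
  have i: "integrable (gauss s2 m) (\<lambda>x. x - m)" using integrable_gauss_power[OF s2_pos, of m 1] by simp
  have "(\<integral>x. (x - m) + m \<partial>gauss s2 m) = (\<integral>x. x - m \<partial>gauss s2 m) + m"
    using i by (subst Bochner_Integration.integral_add) (auto simp: prob_space[simplified])
  also have "(\<integral>x. x - m \<partial>gauss s2 m) = 0" using integral_gauss_odd_power[OF s2_pos, of m 0] by simp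
  finally show ?thesis by (simp add: mean_def power2_eq_square)
qed

lemma mean_square: "mean (\<lambda>m x. x\<^sup>2) m = m\<^sup>2 + s2"
proof -
  interpret prob_space "gauss s2 m" using s2_pos by (rule prob_space_gauss)
  have i: "integrable (gauss s2 m) (\<lambda>x. x - m)" "integrable (gauss s2 m) (\<lambda>x. (x - m)\<^sup>2)"
    using integrable_gauss_power[OF s2_pos, of m 1] integrable_gauss_power[OF s2_pos, of m 2] by auto
  have "mean (\<lambda>m x. x\<^sup>2) m = (\<integral>x. (x - m)\<^sup>2 + (2 * m * (x - m) + m\<^sup>2) \<partial>gauss s2 m)"
    unfolding mean_def by (rule Bochner_Integration.integral_cong) (auto simp: power2_eq_square algebra_simps)
  also have "\<dots> = (\<integral>x. (x - m)\<^sup>2 \<partial>gauss s2 m) + (2 * m * (\<integral>x. x - m \<partial>gauss s2 m) + m\<^sup>2)"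
    using i by (subst Bochner_Integration.integral_add, simp, simp, subst Bochner_Integration.integral_add) (auto simp: prob_space[simplified])
  also have "(\<integral>x. x - m \<partial>gauss s2 m) = 0" using integral_gauss_odd_power[OF s2_pos, of m 0] by simp
  also have "(\<integral>x. (x - m)\<^sup>2 \<partial>gauss s2 m) = s2" using integral_gauss_even_power[OF s2_pos, of m 1] by simp
  finally show ?thesis by simp
qed

text \<open>The weight is separated from the random factors: it occurs as a^2 in front of x^2 and as
  a in front of m x, and both coefficients are increasing in a on [0,1].\<close>

lemma ms_loss_eq: "ms_loss a = (\<lambda>m x. a\<^sup>2 * x\<^sup>2 + ((- 2 * a) * (m * x) + m\<^sup>2))"
  by (simp add: fun_eq_iff ms_loss_def power2_eq_square algebra_simps)

lemma tame_ms_loss: "tame (ms_loss a)"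
  unfolding ms_loss_eq by (intro tame_add tame_cmult tame_square tame_linear tame_mean_square)

lemma mean_ms_loss:
  assumes "\<bar>m\<bar> \<le> c"
  shows "mean (ms_loss a) m = a\<^sup>2 * (m\<^sup>2 + s2) - 2 * a * m\<^sup>2 + m\<^sup>2"
proof -
  have "mean (ms_loss a) m = a\<^sup>2 * mean (\<lambda>m x. x\<^sup>2) m + ((- 2 * a) * mean (\<lambda>m x. m * x) m + mean (\<lambda>m x. m\<^sup>2) m)"
    unfolding ms_loss_eq
    by (simp only: mean_add[OF _ _ assms] mean_cmult tame_add tame_cmult tame_square tame_linear tame_mean_square)
  then show ?thesis by (simp add: mean_square mean_linear mean_const)
qed

end

context gaussian_array
begin

text \<open>In \<open>(D, k, f, t)\<close> the weights are \<open>f\<close> below the split index \<open>k\<close> and soft thresholding at \<open>t\<close> from \<open>k\<close> on,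
  so that \<open>k = p\<close> gives monotone shrinkage and \<open>k = 0\<close> soft thresholding.\<close>

definition candidates :: "nat \<Rightarrow> ('d \<times> nat \<times> (nat \<Rightarrow> real) \<times> real) set" where
  "candidates p = {(D, k, f, t). D \<in> Ds p \<and> k \<le> p \<and> (\<forall>i<k. 0 \<le> f i \<and> f i \<le> 1) \<and>
     (\<forall>i j. i \<le> j \<and> j < k \<longrightarrow> f j \<le> f i) \<and> t \<ge> 0}"

definition array_loss :: "nat \<Rightarrow> 'h \<Rightarrow> 'd \<times> nat \<times> (nat \<Rightarrow> real) \<times> real \<Rightarrow> 'a \<Rightarrow> real" where
  "array_loss p h = (\<lambda>(D, k, f, t) x. ((\<Sum>i<k. ms_loss (f i) (xi p h D i) (Z p D i x)) +
     (\<Sum>i\<in>{k..<p}. st_loss t (xi p h D i) (Z p D i x))) / real p)"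

definition array_risk :: "nat \<Rightarrow> 'h \<Rightarrow> 'd \<times> nat \<times> (nat \<Rightarrow> real) \<times> real \<Rightarrow> real" where
  "array_risk p h i = (\<integral>x. array_loss p h i x \<partial>M p h)"

definition array_rhat :: "real \<Rightarrow> nat \<Rightarrow> 'd \<times> nat \<times> (nat \<Rightarrow> real) \<times> real \<Rightarrow> 'a \<Rightarrow> real" where
  "array_rhat s p = (\<lambda>(D, k, f, t) x. ((\<Sum>i<k. (f i)\<^sup>2 * s + (1 - f i)\<^sup>2 * ((Z p D i x)\<^sup>2 - s)) +
     (\<Sum>i\<in>{k..<p}. s * (1 - 2 * indicator {-t..t} (Z p D i x)) + (min \<bar>Z p D i x\<bar> t)\<^sup>2)) / real p)"

text \<open>The variance enters affinely, with coefficient f^2 - (1 - f)^2 = 2 f - 1 in the monotone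
  part and 1 - 2 times an indicator in the thresholded part. Both lie in [-1, 1], so the effect of
  estimating the variance is bounded for all candidates at once.\<close>

lemma array_rhat_lipschitz:
  assumes "p > 0" "i \<in> candidates p"
  shows "\<bar>array_rhat s p i x - array_rhat s2 p i x\<bar> \<le> \<bar>s - s2\<bar>"
proof -
  obtain D k f t where i: "i = (D, k, f, t)" by (cases i)
  have k: "k \<le> p" and f: "\<And>i. i < k \<Longrightarrow> 0 \<le> f i \<and> f i \<le> 1" using assms by (auto simp: candidates_def i)
  have "(\<Sum>i<k. (f i)\<^sup>2 * s + (1 - f i)\<^sup>2 * ((Z p D i x)\<^sup>2 - s)) -
      (\<Sum>i<k. (f i)\<^sup>2 * s2 + (1 - f i)\<^sup>2 * ((Z p D i x)\<^sup>2 - s2)) = (\<Sum>i<k. (s - s2) * (2 * f i - 1))"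
    unfolding sum_subtractf[symmetric] by (intro sum.cong) (auto simp: power2_eq_square algebra_simps)
  moreover have "\<bar>\<Sum>i<k. (s - s2) * (2 * f i - 1)\<bar> \<le> (\<Sum>i<k. \<bar>s - s2\<bar> * 1)"
    using f by (intro order_trans[OF sum_abs] sum_mono) (auto simp: abs_mult abs_le_iff intro!: mult_left_le)
  moreover have "(\<Sum>i\<in>{k..<p}. s * (1 - 2 * indicator {-t..t} (Z p D i x)) + (min \<bar>Z p D i x\<bar> t)\<^sup>2) -
      (\<Sum>i\<in>{k..<p}. s2 * (1 - 2 * indicator {-t..t} (Z p D i x)) + (min \<bar>Z p D i x\<bar> t)\<^sup>2) =
      (\<Sum>i\<in>{k..<p}. (s - s2) * (1 - 2 * indicator {-t..t} (Z p D i x)))"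
    unfolding sum_subtractf[symmetric] by (intro sum.cong) (auto simp: algebra_simps)
  moreover have "\<bar>\<Sum>i\<in>{k..<p}. (s - s2) * (1 - 2 * indicator {-t..t} (Z p D i x))\<bar> \<le> (\<Sum>i\<in>{k..<p}. \<bar>s - s2\<bar> * 1)"
    by (intro order_trans[OF sum_abs] sum_mono) (auto simp: abs_mult indicator_def)
  moreover have "(\<Sum>i<k. \<bar>s - s2\<bar> * 1) + (\<Sum>i\<in>{k..<p}. \<bar>s - s2\<bar> * 1) = \<bar>s - s2\<bar> * real p"
    using k by (simp add: of_nat_diff algebra_simps)
  ultimately have "\<bar>array_rhat s p i x - array_rhat s2 p i x\<bar> \<le> (\<bar>s - s2\<bar> * real p) / real p"
    unfolding array_rhat_def i prod.case diff_divide_distrib[symmetric] abs_divide abs_of_nat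
    by (intro divide_right_mono) linarith+
  then show ?thesis using assms(1) by simp
qed

lemma array_risk_eq:
  assumes "p > 0" "h \<in> H p" "(D, k, f, t) \<in> candidates p"
  shows "array_risk p h (D, k, f, t) = ((\<Sum>i<k. mean (ms_loss (f i)) (xi p h D i)) + (\<Sum>i\<in>{k..<p}. mean (st_loss t) (xi p h D i))) / real p"
proof -
  have D: "D \<in> Ds p" and k: "k \<le> p" and t: "t \<ge> 0" using assms(3) by (auto simp: candidates_def)
  have 1: "integrable (M p h) (\<lambda>x. ms_loss (f i) (xi p h D i) (Z p D i x))" if "i \<in> {..<k}" for i
    using assms D k that by (intro tame_integrable_Z tame_ms_loss) auto
  have 2: "integrable (M p h) (\<lambda>x. st_loss t (xi p h D i) (Z p D i x))" if "i \<in> {k..<p}" for i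
    using assms D k t that by (intro tame_integrable_Z tame_st_loss) auto
  have "array_risk p h (D, k, f, t) = ((\<Sum>i<k. \<integral>x. ms_loss (f i) (xi p h D i) (Z p D i x) \<partial>M p h) +
     (\<Sum>i\<in>{k..<p}. \<integral>x. st_loss t (xi p h D i) (Z p D i x) \<partial>M p h)) / real p"
    unfolding array_risk_def array_loss_def prod.case using 1 2
    by (subst integral_divide_zero, subst Bochner_Integration.integral_add)
      (auto simp: Bochner_Integration.integral_sum intro!: Bochner_Integration.integrable_sum)
  also have "(\<Sum>i<k. \<integral>x. ms_loss (f i) (xi p h D i) (Z p D i x) \<partial>M p h) = (\<Sum>i<k. mean (ms_loss (f i)) (xi p h D i))"
    using assms D k by (intro sum.cong tame_expectation_Z tame_ms_loss) auto
  also have "(\<Sum>i\<in>{k..<p}. \<integral>x. st_loss t (xi p h D i) (Z p D i x) \<partial>M p h) = (\<Sum>i\<in>{k..<p}. mean (st_loss t) (xi p h D i))"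
    using assms D t by (intro sum.cong tame_expectation_Z tame_st_loss) auto
  finally show ?thesis .
qed

text \<open>An increasing w keeps the sequence w (f i) decreasing, so the weighted sum is dominated
  by a single partial sum, and the partial sums no longer involve f. The instances of w are a
  constant, the identity and the square.\<close>

lemma negl_weighted:
  assumes tame: "tame \<phi>" and w: "\<And>a b. 0 \<le> a \<Longrightarrow> a \<le> b \<Longrightarrow> b \<le> 1 \<Longrightarrow> 0 \<le> w a \<and> w a \<le> w b \<and> w b \<le> (1::real)"
  shows "negl candidates (\<lambda>p h (D, k, f, t) x. (\<Sum>i<k. w (f i) * dev \<phi> p h D i x) / real p)"
proof (rule negl_dominated[OF negl_psum[OF tame]], intro always_eventually allI ballI)
  fix p h x i assume "i \<in> candidates p"
  then obtain D k f t where i: "i = (D, k, f, t)" and D: "D \<in> Ds p" and k: "k \<le> p"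
    and f: "\<And>i. i < k \<Longrightarrow> 0 \<le> f i \<and> f i \<le> 1" "\<And>i j. i \<le> j \<Longrightarrow> j < k \<Longrightarrow> f j \<le> f i"
    by (auto simp: candidates_def)
  obtain j where j: "j \<le> k" "\<bar>\<Sum>i<k. w (f i) * dev \<phi> p h D i x\<bar> \<le> \<bar>\<Sum>i<j. dev \<phi> p h D i x\<bar>"
  proof (rule abel_sum_attained[of k "\<lambda>i. w (f i)"])
    show "0 \<le> w (f i) \<and> w (f i) \<le> 1" if "i < k" for i
      using w[of "f i" "f i"] f(1)[OF that] by auto
    show "w (f j) \<le> w (f i)" if "i \<le> j" "j < k" for i j
      using w[of "f j" "f i"] f(1)[of j] f(1)[of i] f(2)[OF that] that by auto
  qed
  then have "\<bar>(\<Sum>i<k. w (f i) * dev \<phi> p h D i x) / real p\<bar> \<le> \<bar>psum \<phi> p h (D, j) x\<bar>"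
    by (simp add: psum_def divide_right_mono)
  then show "\<exists>j\<in>Ds p \<times> {..p}. \<bar>(case i of (D, k, f, t) \<Rightarrow> \<lambda>x. (\<Sum>i<k. w (f i) * dev \<phi> p h D i x) / real p) x\<bar> \<le> \<bar>psum \<phi> p h j x\<bar>"
    using D j k by (intro bexI[of _ "(D, j)"]) (auto simp: i)
qed

text \<open>The sum over the coordinates from k on is the difference of the partial sums up to p and
  up to k. Since all partial sums are controlled together, the split index costs nothing.\<close>

lemma negl_threshold:
  assumes A: "A = st_loss \<or> A = st_rhat"
  shows "negl candidates (\<lambda>p h (D, k, f, t) x. (\<Sum>i\<in>{k..<p}. dev (A t) p h D i x) / real p)"
proof -
  have base: "negl (\<lambda>p. (Ds p \<times> {..p}) \<times> {0..}) (\<lambda>p h (i, t). psum (A t) p h i)"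
    using A tame_st_loss tame_st_rhat by (intro negl_psum_bracketed soft_threshold_bracket) auto
  have 1: "negl candidates (\<lambda>p h (D, k, f, t). psum (A t) p h (D, p))"
  proof (rule negl_dominated[OF base], intro always_eventually allI ballI)
    fix p h x i assume "i \<in> candidates p"
    then obtain D k f t where i: "i = (D, k, f, t)" "D \<in> Ds p" "k \<le> p" "t \<ge> 0" by (auto simp: candidates_def)
    show "\<exists>j\<in>(Ds p \<times> {..p}) \<times> {0..}. \<bar>(case i of (D, k, f, t) \<Rightarrow> psum (A t) p h (D, p)) x\<bar> \<le>
        \<bar>(case j of (i, t) \<Rightarrow> psum (A t) p h i) x\<bar>"
      using i by (intro bexI[of _ "((D, p), t)"]) auto
  qed
  have 2: "negl candidates (\<lambda>p h (D, k, f, t). psum (A t) p h (D, k))"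
  proof (rule negl_dominated[OF base], intro always_eventually allI ballI)
    fix p h x i assume "i \<in> candidates p"
    then obtain D k f t where i: "i = (D, k, f, t)" "D \<in> Ds p" "k \<le> p" "t \<ge> 0" by (auto simp: candidates_def)
    show "\<exists>j\<in>(Ds p \<times> {..p}) \<times> {0..}. \<bar>(case i of (D, k, f, t) \<Rightarrow> psum (A t) p h (D, k)) x\<bar> \<le>
        \<bar>(case j of (i, t) \<Rightarrow> psum (A t) p h i) x\<bar>"
      using i by (intro bexI[of _ "((D, k), t)"]) auto
  qed
  show ?thesis
  proof (rule negl_dominated[OF negl_add[OF negl_abs[OF 1] negl_abs[OF 2]]], intro always_eventually allI ballI)
    fix p h x i assume i: "i \<in> candidates p"
    obtain D k f t where i': "i = (D, k, f, t)" by (cases i)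
    have k: "k \<le> p" using i by (auto simp: candidates_def i')
    have "(\<Sum>i<p. dev (A t) p h D i x) = (\<Sum>i<k. dev (A t) p h D i x) + (\<Sum>i\<in>{k..<p}. dev (A t) p h D i x)"
      using k by (simp add: sum.atLeastLessThan_concat lessThan_atLeast0)
    then have "(\<Sum>i\<in>{k..<p}. dev (A t) p h D i x) / real p = psum (A t) p h (D, p) x - psum (A t) p h (D, k) x"
      by (simp add: psum_def diff_divide_distrib[symmetric])
    then show "\<exists>j\<in>candidates p. \<bar>(case i of (D, k, f, t) \<Rightarrow> \<lambda>x. (\<Sum>i\<in>{k..<p}. dev (A t) p h D i x) / real p) x\<bar> \<le>
      \<bar>\<bar>(case j of (D, k, f, t) \<Rightarrow> psum (A t) p h (D, p)) x\<bar> + \<bar>(case j of (D, k, f, t) \<Rightarrow> psum (A t) p h (D, k)) x\<bar>\<bar>"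
      using i by (intro bexI[of _ i]) (auto simp: i')
  qed
qed

text \<open>This is the common shape of both deviations: the loss has a = 0 and \<psi> = m x, from
  f^2 x^2 - 2 f m x; the estimated risk has a = 1 and \<psi> = x^2, from (1 - f)^2 x^2. Each of the
  three coefficient sequences is decreasing or constant.\<close>

lemma negl_quadratic_deviation:
  assumes tame: "tame \<psi>" and a: "0 \<le> a" "a \<le> 1" and A: "A = st_loss \<or> A = st_rhat"
    and eq: "\<And>p h D k f t x. p > 0 \<Longrightarrow> h \<in> H p \<Longrightarrow> (D, k, f, t) \<in> candidates p \<Longrightarrow> F p h (D, k, f, t) x =
      ((\<Sum>i<k. a * dev (\<lambda>m x. x\<^sup>2) p h D i x + (f i)\<^sup>2 * dev (\<lambda>m x. x\<^sup>2) p h D i x - 2 * (f i * dev \<psi> p h D i x)) +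
       (\<Sum>i\<in>{k..<p}. dev (A t) p h D i x)) / real p"
  shows "negl candidates F"
proof -
  let ?w = "\<lambda>w \<phi> p h (D, k, f :: nat \<Rightarrow> real, t :: real) x. (\<Sum>i<k. w (f i) * dev \<phi> p h D i x) / real p"
  let ?o = "?w (\<lambda>_. a) (\<lambda>m x. x\<^sup>2)" and ?q = "?w (\<lambda>b. b\<^sup>2) (\<lambda>m x. x\<^sup>2)" and ?l = "?w (\<lambda>b. b) \<psi>"
  let ?s = "\<lambda>p h (D, k, f :: nat \<Rightarrow> real, t) x. (\<Sum>i\<in>{k..<p}. dev (A t) p h D i x) / real p"
  have o: "negl candidates ?o" using a by (intro negl_weighted[OF tame_square]) auto
  have q: "negl candidates ?q" by (rule negl_weighted[OF tame_square]) (auto simp: power_mono power_le_one)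
  have l: "negl candidates ?l" by (rule negl_weighted[OF tame]) auto
  have s: "negl candidates ?s" using A by (rule negl_threshold)
  show ?thesis
  proof (rule negl_dominated[OF negl_add[OF negl_add[OF negl_abs[OF o] negl_abs[OF q]] negl_add[OF negl_add[OF negl_abs[OF l] negl_abs[OF l]] negl_abs[OF s]]]])
    show "\<forall>\<^sub>F p in sequentially. \<forall>h\<in>H p. \<forall>x\<in>space (M p h). \<forall>i\<in>candidates p. \<exists>j\<in>candidates p.
       \<bar>F p h i x\<bar> \<le> \<bar>\<bar>?o p h j x\<bar> + \<bar>?q p h j x\<bar> + (\<bar>?l p h j x\<bar> + \<bar>?l p h j x\<bar> + \<bar>?s p h j x\<bar>)\<bar>"
      using eventually_gt_at_top[of 0]
    proof (eventually_elim, intro ballI)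
      fix p h x i assume p: "0 < p" and h: "h \<in> H p" and i: "i \<in> candidates p"
      obtain D k f t where i': "i = (D, k, f, t)" by (cases i)
      have "F p h i x = ?o p h i x + ?q p h i x - 2 * ?l p h i x + ?s p h i x"
        using eq[OF p h i[unfolded i'], of x]
        by (simp add: i' add_divide_distrib diff_divide_distrib sum.distrib sum_subtractf sum_distrib_left)
      then show "\<exists>j\<in>candidates p. \<bar>F p h i x\<bar> \<le>
          \<bar>\<bar>?o p h j x\<bar> + \<bar>?q p h j x\<bar> + (\<bar>?l p h j x\<bar> + \<bar>?l p h j x\<bar> + \<bar>?s p h j x\<bar>)\<bar>"
        using i by (intro bexI[of _ i]) linarith+
    qed
  qed
qed

lemma array_loss_deviation:
  "negl candidates (\<lambda>p h i x. array_loss p h i x - array_risk p h i)"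
proof (rule negl_quadratic_deviation[OF tame_linear, of 0 st_loss])
  fix p h D k t x and f :: "nat \<Rightarrow> real"
  assume p: "p > 0" and h: "h \<in> H p" and i: "(D, k, f, t) \<in> candidates p"
  let ?R = "\<lambda>i. 0 * dev (\<lambda>m x. x\<^sup>2) p h D i x + (f i)\<^sup>2 * dev (\<lambda>m x. x\<^sup>2) p h D i x - 2 * (f i * dev (\<lambda>m x. m * x) p h D i x)"
  have 1: "(\<Sum>i<k. ms_loss (f i) (xi p h D i) (Z p D i x)) = (\<Sum>i<k. mean (ms_loss (f i)) (xi p h D i)) + (\<Sum>i<k. ?R i)"
    unfolding sum.distrib[symmetric]
  proof (intro sum.cong refl)
    fix i assume "i \<in> {..<k}"
    then have "\<bar>xi p h D i\<bar> \<le> c" using p h i by (intro xi_bound) (auto simp: candidates_def)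
    then show "ms_loss (f i) (xi p h D i) (Z p D i x) = mean (ms_loss (f i)) (xi p h D i) + ?R i"
      unfolding mean_ms_loss[OF \<open>\<bar>xi p h D i\<bar> \<le> c\<close>] dev_def mean_square mean_linear ms_loss_def by (simp add: power2_eq_square algebra_simps)
  qed
  have 2: "(\<Sum>i\<in>{k..<p}. st_loss t (xi p h D i) (Z p D i x)) =
      (\<Sum>i\<in>{k..<p}. mean (st_loss t) (xi p h D i)) + (\<Sum>i\<in>{k..<p}. dev (st_loss t) p h D i x)"
    by (simp add: dev_def sum_subtractf)
  show "array_loss p h (D, k, f, t) x - array_risk p h (D, k, f, t) = ((\<Sum>i<k. ?R i) + (\<Sum>i\<in>{k..<p}. dev (st_loss t) p h D i x)) / real p"
    unfolding array_risk_eq[OF p h i] array_loss_def prod.case 1 2 diff_divide_distrib[symmetric] by (rule arg_cong[where f="\<lambda>x. x / real p"]) linarith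
qed auto

text \<open>The risk is the right centring here as well: in the monotone part f^2 s2 + (1 - f)^2 m^2
  equals the mean loss, and in the thresholded part \<open>sure\<close> identifies the
  means.\<close>

lemma array_rhat_deviation:
  "negl candidates (\<lambda>p h i x. array_rhat s2 p i x - array_risk p h i)"
proof (rule negl_quadratic_deviation[OF tame_square, of 1 st_rhat])
  fix p h D k t x and f :: "nat \<Rightarrow> real"
  assume p: "p > 0" and h: "h \<in> H p" and i: "(D, k, f, t) \<in> candidates p"
  have xi: "\<bar>xi p h D i\<bar> \<le> c" if "i < p" for i
    using p h i that by (intro xi_bound) (auto simp: candidates_def)
  let ?R = "\<lambda>i. 1 * dev (\<lambda>m x. x\<^sup>2) p h D i x + (f i)\<^sup>2 * dev (\<lambda>m x. x\<^sup>2) p h D i x - 2 * (f i * dev (\<lambda>m x. x\<^sup>2) p h D i x)"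
  have 1: "(\<Sum>i<k. (f i)\<^sup>2 * s2 + (1 - f i)\<^sup>2 * ((Z p D i x)\<^sup>2 - s2)) = (\<Sum>i<k. mean (ms_loss (f i)) (xi p h D i)) + (\<Sum>i<k. ?R i)"
    unfolding sum.distrib[symmetric]
  proof (intro sum.cong refl)
    fix j assume "j \<in> {..<k}"
    then have "j < p" using i by (auto simp: candidates_def)
    then show "(f j)\<^sup>2 * s2 + (1 - f j)\<^sup>2 * ((Z p D j x)\<^sup>2 - s2) = mean (ms_loss (f j)) (xi p h D j) + ?R j"
      unfolding mean_ms_loss[OF xi[OF \<open>j < p\<close>]] dev_def mean_square by (simp add: power2_eq_square algebra_simps)
  qed
  have 2: "(\<Sum>i\<in>{k..<p}. s2 * (1 - 2 * indicator {-t..t} (Z p D i x)) + (min \<bar>Z p D i x\<bar> t)\<^sup>2) =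
      (\<Sum>i\<in>{k..<p}. mean (st_loss t) (xi p h D i)) + (\<Sum>i\<in>{k..<p}. dev (st_rhat t) p h D i x)"
    unfolding sum.distrib[symmetric] dev_def
    using sure[OF _ xi, of t] i by (intro sum.cong refl) (auto simp: st_rhat_def candidates_def)
  show "array_rhat s2 p (D, k, f, t) x - array_risk p h (D, k, f, t) = ((\<Sum>i<k. ?R i) + (\<Sum>i\<in>{k..<p}. dev (st_rhat t) p h D i x)) / real p"
    unfolding array_risk_eq[OF p h i] array_rhat_def prod.case 1 2 diff_divide_distrib[symmetric] by (rule arg_cong[where f="\<lambda>x. x / real p"]) linarith
qed auto

end

section \<open>Independence through characteristic functions\<close>

context prob_space
begin

lemma integrable_bounded_real:
  fixes g :: "'a \<Rightarrow> real"
  assumes "g \<in> borel_measurable M" "\<And>x. \<bar>g x\<bar> \<le> K"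
  shows "integrable M g"
  using assms by (intro integrable_const_bound[where B=K]) auto

lemma integrable_bounded_iexp:
  fixes g X :: "'a \<Rightarrow> real"
  assumes [measurable]: "g \<in> borel_measurable M" "X \<in> borel_measurable M" and "\<And>x. \<bar>g x\<bar> \<le> K"
  shows "integrable M (\<lambda>x. g x *\<^sub>R iexp (X x))"
  using assms(3) by (intro integrable_const_bound[where B=K]) auto

text \<open>Tilting the law by \<open>g\<close> does not change the characteristic function of \<open>X\<close>, hence not its law.\<close>

lemma tilted_expectation:
  fixes g X :: "'a \<Rightarrow> real"
  assumes g [measurable]: "g \<in> borel_measurable M" and X [measurable]: "X \<in> borel_measurable M"
    and g0: "\<And>x. 0 \<le> g x" and gK: "\<And>x. g x \<le> K"
    and char_eq: "\<And>t. (\<integral>x. g x *\<^sub>R iexp (t * X x) \<partial>M) = expectation g *\<^sub>R (\<integral>x. iexp (t * X x) \<partial>M)"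
    and A [measurable]: "A \<in> sets borel"
  shows "expectation (\<lambda>x. g x * indicator A (X x)) = expectation g * expectation (\<lambda>x. indicator A (X x))"
\<comment> \<open>Without positive expectation g cannot be normalised to a density, but then both
  sides vanish.\<close>
proof (cases "expectation g = 0")
  case True
  have gi: "integrable M g" using g0 gK by (intro integrable_bounded_real[of _ K]) auto
  have "expectation (\<lambda>x. g x * indicator A (X x)) \<le> expectation g"
    using g0 gK by (intro integral_mono gi integrable_bounded_real[of _ K]) (auto simp: indicator_def intro: order_trans)
  moreover have "0 \<le> expectation (\<lambda>x. g x * indicator A (X x))"
    using g0 by (intro integral_nonneg_AE) auto
  ultimately show ?thesis using True by simp
next
  case False
  have gi: "integrable M g" using g0 gK by (intro integrable_bounded_real[of _ K]) auto
  have "0 \<le> expectation g" using g0 by (intro integral_nonneg_AE) auto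
  with False have pos: "0 < expectation g" by simp
  define w where "w = (\<lambda>x. g x / expectation g)"
  have w [measurable]: "w \<in> borel_measurable M" unfolding w_def by measurable
  have w0: "0 \<le> w x" for x using g0 pos by (simp add: w_def)
  define Q where "Q = density M (\<lambda>x. ennreal (w x))"
  have "(\<integral>\<^sup>+x. ennreal (w x) \<partial>M) = ennreal (\<integral>x. w x \<partial>M)"
    using w0 gi by (intro nn_integral_eq_integral) (auto simp: w_def)
  also have "(\<integral>x. w x \<partial>M) = 1" using pos by (simp add: w_def)
  finally have "emeasure Q (space Q) = 1" by (simp add: Q_def emeasure_density cong: nn_integral_cong)
  then interpret Q: prob_space Q by (rule prob_spaceI)
  have XQ: "X \<in> borel_measurable Q" by (simp add: Q_def)
  have eq: "distr Q borel X = distr M borel X"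
  proof (rule Levy_uniqueness)
    show "real_distribution (distr Q borel X)" using XQ by simp
    show "real_distribution (distr M borel X)" by simp
    show "char (distr Q borel X) = char (distr M borel X)"
    proof
      fix t
      have "char (distr Q borel X) t = (\<integral>x. iexp (t * X x) \<partial>Q)"
        unfolding char_def using XQ by (subst integral_distr) auto
      also have "\<dots> = (\<integral>x. w x *\<^sub>R iexp (t * X x) \<partial>M)"
        unfolding Q_def using w0 by (subst integral_density) auto
      also have "\<dots> = (\<integral>x. (1 / expectation g) *\<^sub>R (g x *\<^sub>R iexp (t * X x)) \<partial>M)"
        by (simp add: w_def)
      also have "\<dots> = (1 / expectation g) *\<^sub>R (expectation g *\<^sub>R (\<integral>x. iexp (t * X x) \<partial>M))"
        unfolding char_eq[symmetric] by (rule integral_scaleR_right)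
      also have "\<dots> = (\<integral>x. iexp (t * X x) \<partial>M)" using pos by simp
      also have "\<dots> = char (distr M borel X) t"
        unfolding char_def by (subst integral_distr) auto
      finally show "char (distr Q borel X) t = char (distr M borel X) t" .
    qed
  qed
  have "expectation (\<lambda>x. w x *\<^sub>R indicat_real A (X x)) = (\<integral>x. indicat_real A (X x) \<partial>Q)"
    unfolding Q_def using w0 by (subst integral_density) auto
  also have "\<dots> = (\<integral>x. indicat_real A x \<partial>distr Q borel X)" using XQ by (subst integral_distr) auto
  also have "\<dots> = (\<integral>x. indicat_real A (X x) \<partial>M)" unfolding eq by (subst integral_distr) auto
  finally have "expectation (\<lambda>x. (g x * indicat_real A (X x)) / expectation g) = (\<integral>x. indicat_real A (X x) \<partial>M)"
    by (simp add: w_def)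
  then show ?thesis using pos by (simp add: field_simps)
qed

text \<open>Two tilts reduce the claim to uniqueness for laws on the line. Tilting by a cosine of X
  leaves the law of Y unchanged, so every cosine of X factors against indicators of Y; therefore
  tilting by an indicator of Y leaves the law of X unchanged. That is the product formula on
  rectangles.\<close>

lemma indep_var_char:
  fixes X Y :: "'a \<Rightarrow> real"
  assumes X [measurable]: "X \<in> borel_measurable M" and Y [measurable]: "Y \<in> borel_measurable M"
    and char_eq: "\<And>s t. (\<integral>x. iexp (s * X x + t * Y x) \<partial>M) = (\<integral>x. iexp (s * X x) \<partial>M) * (\<integral>x. iexp (t * Y x) \<partial>M)"
  shows "indep_var borel X borel Y"
proof -
  have iexp_int: "integrable M (\<lambda>x. iexp (Z x))" if [measurable]: "Z \<in> borel_measurable M" for Z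
    using integrable_bounded_iexp[of "\<lambda>_. 1" Z 1] by simp
  have lin2: "(\<integral>x. a * iexp (U x) + b * iexp (V x) \<partial>M) = a * (\<integral>x. iexp (U x) \<partial>M) + b * (\<integral>x. iexp (V x) \<partial>M)"
    if "U \<in> borel_measurable M" "V \<in> borel_measurable M" for a b U V
    using iexp_int[OF that(1)] iexp_int[OF that(2)] by simp
  have cos_expand: "complex_of_real (cos (u + \<theta>)) = (iexp \<theta> * iexp u + iexp (- \<theta>) * iexp (- u)) / 2" for u \<theta>
    unfolding cos_of_real[symmetric] cos_exp_eq by (simp add: distrib_left exp_add exp_diff exp_minus field_simps)
  \<comment> \<open>A cosine is half the sum of two exponentials, so the assumed factorisation is
    used at s and at -s. The phase \<theta> makes the sine available too.\<close>
  have *: "(\<integral>x. cos (s * X x + \<theta>) *\<^sub>R iexp (t * Y x) \<partial>M) =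
      expectation (\<lambda>x. cos (s * X x + \<theta>)) *\<^sub>R (\<integral>x. iexp (t * Y x) \<partial>M)" for s \<theta> t
  proof -
    have "(\<integral>x. cos (s * X x + \<theta>) *\<^sub>R iexp (t * Y x) \<partial>M) =
        (\<integral>x. (iexp \<theta> / 2) * iexp (s * X x + t * Y x) + (iexp (- \<theta>) / 2) * iexp ((- s) * X x + t * Y x) \<partial>M)"
      by (intro Bochner_Integration.integral_cong refl)
        (simp add: scaleR_conv_of_real cos_expand distrib_left exp_add exp_diff exp_minus field_simps)
    also have "\<dots> = (iexp \<theta> / 2) * (\<integral>x. iexp (s * X x + t * Y x) \<partial>M) + (iexp (- \<theta>) / 2) * (\<integral>x. iexp ((- s) * X x + t * Y x) \<partial>M)"
      by (rule lin2) measurable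
    also have "\<dots> = ((iexp \<theta> / 2) * (\<integral>x. iexp (s * X x) \<partial>M) + (iexp (- \<theta>) / 2) * (\<integral>x. iexp ((- s) * X x) \<partial>M)) * (\<integral>x. iexp (t * Y x) \<partial>M)"
      unfolding char_eq by (simp add: algebra_simps)
    also have "(iexp \<theta> / 2) * (\<integral>x. iexp (s * X x) \<partial>M) + (iexp (- \<theta>) / 2) * (\<integral>x. iexp ((- s) * X x) \<partial>M) =
        (\<integral>x. (iexp \<theta> / 2) * iexp (s * X x) + (iexp (- \<theta>) / 2) * iexp ((- s) * X x) \<partial>M)"
      by (rule lin2[symmetric]) measurable
    also have "\<dots> = (\<integral>x. complex_of_real (cos (s * X x + \<theta>)) \<partial>M)"
      by (intro Bochner_Integration.integral_cong refl) (simp add: cos_expand add_divide_distrib)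
    also have "\<dots> = complex_of_real (expectation (\<lambda>x. cos (s * X x + \<theta>)))"
      by (rule integral_complex_of_real)
    finally show ?thesis by (simp add: scaleR_conv_of_real)
  qed
  have cos_int: "integrable M (\<lambda>x. cos (s * X x + \<theta>))" for s \<theta>
    by (intro integrable_bounded_real[of _ 1]) auto
  have cos_ind: "expectation (\<lambda>x. cos (s * X x + \<theta>) * indicator B (Y x)) =
      expectation (\<lambda>x. cos (s * X x + \<theta>)) * expectation (\<lambda>x. indicator B (Y x))"
    if B [measurable]: "B \<in> sets borel" for s \<theta> B
  proof -
    \<comment> \<open>The summand 2 makes the weight nonnegative, as tilting requires; its
      contribution is subtracted afterwards.\<close>
    define g where "g = (\<lambda>x. 2 + cos (s * X x + \<theta>))"
    have [measurable]: "g \<in> borel_measurable M" unfolding g_def by measurable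
    have bd: "0 \<le> g x \<and> g x \<le> 3" for x
      using cos_ge_minus_one[of "s * X x + \<theta>"] cos_le_one[of "s * X x + \<theta>"] unfolding g_def by linarith
    have ib: "integrable M (\<lambda>x. indicator B (Y x) :: real)"
      by (intro integrable_bounded_real[of _ 1]) auto
    have icb: "integrable M (\<lambda>x. cos (s * X x + \<theta>) * indicator B (Y x))"
      by (intro integrable_bounded_real[of _ 1]) (auto simp: indicator_def)
    have eg: "expectation g = 2 + expectation (\<lambda>x. cos (s * X x + \<theta>))"
      unfolding g_def using cos_int by (subst Bochner_Integration.integral_add) (auto simp: prob_space)
    have "expectation (\<lambda>x. g x * indicator B (Y x)) = expectation g * expectation (\<lambda>x. indicator B (Y x))"
    proof (rule tilted_expectation[where K=3])
      fix t
      have "(\<integral>x. g x *\<^sub>R iexp (t * Y x) \<partial>M) = (\<integral>x. 2 *\<^sub>R iexp (t * Y x) + cos (s * X x + \<theta>) *\<^sub>R iexp (t * Y x) \<partial>M)"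
        by (simp only: g_def scaleR_add_left)
      also have "\<dots> = (\<integral>x. 2 *\<^sub>R iexp (t * Y x) \<partial>M) + (\<integral>x. cos (s * X x + \<theta>) *\<^sub>R iexp (t * Y x) \<partial>M)"
        by (intro Bochner_Integration.integral_add integrable_scaleR_right iexp_int integrable_bounded_iexp[of _ _ 1]) auto
      also have "\<dots> = expectation g *\<^sub>R (\<integral>x. iexp (t * Y x) \<partial>M)"
        unfolding * eg by (simp only: scaleR_add_left integral_scaleR_right)
      finally show "(\<integral>x. g x *\<^sub>R iexp (t * Y x) \<partial>M) = expectation g *\<^sub>R (\<integral>x. iexp (t * Y x) \<partial>M)" .
    qed (use bd in auto)
    moreover have "expectation (\<lambda>x. g x * indicator B (Y x)) =
        2 * expectation (\<lambda>x. indicator B (Y x)) + expectation (\<lambda>x. cos (s * X x + \<theta>) * indicator B (Y x))"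
      unfolding g_def distrib_right using ib icb by simp
    ultimately show ?thesis unfolding eg by (simp add: distrib_right)
  qed
  have prod: "expectation (\<lambda>x. indicat_real B (Y x) * indicat_real A (X x)) =
      expectation (\<lambda>x. indicat_real B (Y x)) * expectation (\<lambda>x. indicat_real A (X x))"
    if A [measurable]: "A \<in> sets borel" and B [measurable]: "B \<in> sets borel" for A B
  proof (rule tilted_expectation[where K=1])
    fix t
    \<comment> \<open>The phases 0 and - pi / 2 give the real and the imaginary part of the
      characteristic function.\<close>
    have sin_shift: "cos (u + - pi / 2) = sin u" for u :: real by (simp add: cos_diff)
    have "(\<integral>x. cos (t * X x) * indicat_real B (Y x) \<partial>M) = expectation (\<lambda>x. indicat_real B (Y x)) * expectation (\<lambda>x. cos (t * X x))"
      "(\<integral>x. sin (t * X x) * indicat_real B (Y x) \<partial>M) = expectation (\<lambda>x. indicat_real B (Y x)) * expectation (\<lambda>x. sin (t * X x))"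
      using cos_ind[OF B, of t 0] cos_ind[OF B, of t "- pi / 2"] unfolding sin_shift by (simp_all add: mult.commute)
    moreover have "integrable M (\<lambda>x. indicat_real B (Y x) *\<^sub>R iexp (t * X x))"
      by (intro integrable_bounded_iexp[of _ _ 1]) (auto simp: indicator_def)
    moreover have "integrable M (\<lambda>x. iexp (t * X x))" by (intro iexp_int) simp
    ultimately show "(\<integral>x. indicat_real B (Y x) *\<^sub>R iexp (t * X x) \<partial>M) =
        expectation (\<lambda>x. indicat_real B (Y x)) *\<^sub>R (\<integral>x. iexp (t * X x) \<partial>M)"
      by (intro complex_eqI) (simp_all add: integral_Re[symmetric] integral_Im[symmetric] Re_exp Im_exp mult.commute)
  qed (auto simp: indicator_def)
  interpret DX: prob_space "distr M borel X" by (rule prob_space_distr) simp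
  interpret DY: prob_space "distr M borel Y" by (rule prob_space_distr) simp
  have "distr M borel X \<Otimes>\<^sub>M distr M borel Y = distr M (borel \<Otimes>\<^sub>M borel) (\<lambda>x. (X x, Y x))"
  proof (rule pair_measure_eqI)
    show "sigma_finite_measure (distr M borel X)" by unfold_locales
    show "sigma_finite_measure (distr M borel Y)" by unfold_locales
    show "sets (distr M borel X \<Otimes>\<^sub>M distr M borel Y) = sets (distr M (borel \<Otimes>\<^sub>M borel) (\<lambda>x. (X x, Y x)))"
      by (simp cong: sets_pair_measure_cong)
    fix A B assume AB: "A \<in> sets (distr M borel X)" "B \<in> sets (distr M borel Y)"
    then have [measurable]: "A \<in> sets borel" "B \<in> sets borel" by auto
    have e: "expectation (\<lambda>x. indicat_real S (W x)) = prob (W -` S \<inter> space M)" for S :: "'z set" and W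
    proof -
      have "expectation (\<lambda>x. indicat_real S (W x)) = expectation (indicat_real (W -` S \<inter> space M))"
        by (intro Bochner_Integration.integral_cong) (auto simp: indicator_def)
      then show ?thesis by simp
    qed
    have "prob ((\<lambda>x. (X x, Y x)) -` (A \<times> B) \<inter> space M) = expectation (\<lambda>x. indicat_real (A \<times> B) (X x, Y x))"
      by (simp only: e)
    also have "\<dots> = expectation (\<lambda>x. indicat_real B (Y x) * indicat_real A (X x))"
      by (simp only: indicator_times fst_conv snd_conv mult.commute)
    also have "\<dots> = prob (Y -` B \<inter> space M) * prob (X -` A \<inter> space M)"
      using prod[of A B] by (simp only: e) simp
    finally show "emeasure (distr M borel X) A * emeasure (distr M borel Y) B =
        emeasure (distr M (borel \<Otimes>\<^sub>M borel) (\<lambda>x. (X x, Y x))) (A \<times> B)"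
      by (simp add: emeasure_distr emeasure_eq_measure ennreal_mult'[symmetric] mult.commute)
  qed
  then show ?thesis unfolding indep_var_distribution_eq using X Y by simp
qed

end

section \<open>Linear forms of the Gaussian vector\<close>

lemma char_gauss:
  assumes "s2 > 0"
  shows "char (gauss s2 m) t = iexp (t * m) * complex_of_real (exp (- (s2 * t\<^sup>2) / 2))"
proof -
  interpret prob_space "gauss s2 m" using assms by (rule prob_space_gauss)
  define \<sigma> where "\<sigma> = sqrt s2"
  have \<sigma>: "\<sigma> > 0" "\<sigma>\<^sup>2 = s2" using assms by (auto simp: \<sigma>_def)
  have "distributed (gauss s2 m) lborel (\<lambda>x. x) (normal_density m \<sigma>)"
    by (auto simp: distributed_def gauss_def \<sigma>_def distr_id2)
  then have "distributed (gauss s2 m) lborel (\<lambda>x. (x - m) / \<sigma>) std_normal_density"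
    by (subst (asm) normal_standard_normal_convert[OF \<sigma>(1)])
  then have d: "distr (gauss s2 m) lborel (\<lambda>x. (x - m) / \<sigma>) = std_normal_distribution"
    by (simp add: distributed_def)
  have e: "iexp (t * x) = iexp (t * m) * iexp ((t * \<sigma>) * ((x - m) / \<sigma>))" for x
  proof -
    have "t * x = t * m + (t * \<sigma>) * ((x - m) / \<sigma>)" using \<sigma>(1) by (simp add: field_simps)
    then show ?thesis by (simp only: of_real_add distrib_left exp_add)
  qed
  have "char (gauss s2 m) t = (\<integral>x. iexp (t * m) * iexp ((t * \<sigma>) * ((x - m) / \<sigma>)) \<partial>gauss s2 m)"
    unfolding char_def by (intro Bochner_Integration.integral_cong refl e)
  also have "\<dots> = iexp (t * m) * (\<integral>x. iexp ((t * \<sigma>) * ((x - m) / \<sigma>)) \<partial>gauss s2 m)"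
    by (rule integral_mult_right_zero)
  also have "(\<integral>x. iexp ((t * \<sigma>) * ((x - m) / \<sigma>)) \<partial>gauss s2 m) = char std_normal_distribution (t * \<sigma>)"
    unfolding char_def d[symmetric] by (subst integral_distr) auto
  finally show ?thesis using \<sigma> by (simp add: char_std_normal_distribution power_mult_distrib mult.commute)
qed

lemma gauss_law_eq: "gauss_law \<eta> s2 = (\<Pi>\<^sub>M j\<in>{..<dim_vec \<eta>}. gauss s2 (\<eta> $ j))"
  by (simp add: gauss_law_def gauss_def)

lemma prob_space_gauss_law: "s2 > 0 \<Longrightarrow> prob_space (gauss_law \<eta> s2)"
  unfolding gauss_law_eq by (intro prob_space_PiM prob_space_gauss)

lemma measurable_gauss_law_component:
  "j < dim_vec \<eta> \<Longrightarrow> (\<lambda>x. x j) \<in> borel_measurable (gauss_law \<eta> s2)"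
  unfolding gauss_law_eq using measurable_component_singleton[of j "{..<dim_vec \<eta>}" "\<lambda>j. gauss s2 (\<eta> $ j)"] by simp

text \<open>The exponential of the sum factors over the independent coordinates. The result depends
  on the coefficients only through the mean of the form and its squared length.\<close>

lemma char_gauss_law:
  assumes "s2 > 0"
  shows "(\<integral>x. iexp (\<Sum>j<dim_vec \<eta>. a j * x j) \<partial>gauss_law \<eta> s2) =
    iexp (\<Sum>j<dim_vec \<eta>. a j * \<eta> $ j) * complex_of_real (exp (- (s2 * (\<Sum>j<dim_vec \<eta>. (a j)\<^sup>2)) / 2))"
proof -
  interpret G: prob_space "gauss s2 (\<eta> $ j)" for j using assms by (rule prob_space_gauss)
  interpret product_sigma_finite "\<lambda>j. gauss s2 (\<eta> $ j)" by unfold_locales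
  have "(\<integral>x. iexp (\<Sum>j<dim_vec \<eta>. a j * x j) \<partial>gauss_law \<eta> s2) =
      (\<integral>x. (\<Prod>j<dim_vec \<eta>. iexp (a j * x j)) \<partial>gauss_law \<eta> s2)"
    by (simp add: exp_sum sum_distrib_left)
  also have "\<dots> = (\<Prod>j<dim_vec \<eta>. \<integral>x. iexp (a j * x) \<partial>gauss s2 (\<eta> $ j))"
    unfolding gauss_law_eq
  proof (rule product_integral_prod)
    show "integrable (gauss s2 (\<eta> $ j)) (\<lambda>x. iexp (a j * x))" for j
      using G.integrable_bounded_iexp[of "\<lambda>_. 1" _ "\<lambda>x. a j * x" 1] by simp
  qed simp
  also have "\<dots> = (\<Prod>j<dim_vec \<eta>. iexp (a j * \<eta> $ j) * complex_of_real (exp (- (s2 * (a j)\<^sup>2) / 2)))"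
    using char_gauss[OF assms] by (simp add: char_def)
  also have "\<dots> = iexp (\<Sum>j<dim_vec \<eta>. a j * \<eta> $ j) * complex_of_real (exp (\<Sum>j<dim_vec \<eta>. - (s2 * (a j)\<^sup>2) / 2))"
    by (simp add: prod.distrib exp_sum sum_distrib_left)
  also have "(\<Sum>j<dim_vec \<eta>. - (s2 * (a j)\<^sup>2) / 2) = - (s2 * (\<Sum>j<dim_vec \<eta>. (a j)\<^sup>2)) / 2"
    by (simp add: sum_divide_distrib sum_negf sum_distrib_left)
  finally show ?thesis .
qed

definition lin :: "real vec \<Rightarrow> (nat \<Rightarrow> real) \<Rightarrow> (nat \<Rightarrow> real) \<Rightarrow> real" where
  "lin \<eta> a x = (\<Sum>j<dim_vec \<eta>. a j * x j)"

lemma lin_measurable: "lin \<eta> a \<in> borel_measurable (gauss_law \<eta> s2)"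
  unfolding lin_def[abs_def] using measurable_gauss_law_component
  by (intro borel_measurable_sum borel_measurable_times) auto

lemma distr_lin:
  assumes s2: "s2 > 0" and a: "(\<Sum>j<dim_vec \<eta>. (a j)\<^sup>2) = 1"
  shows "distr (gauss_law \<eta> s2) borel (lin \<eta> a) = gauss s2 (lin \<eta> a (\<lambda>j. \<eta> $ j))"
proof (rule Levy_uniqueness)
  interpret prob_space "gauss_law \<eta> s2" using s2 by (rule prob_space_gauss_law)
  interpret G: prob_space "gauss s2 (lin \<eta> a (\<lambda>j. \<eta> $ j))" using s2 by (rule prob_space_gauss)
  show "real_distribution (distr (gauss_law \<eta> s2) borel (lin \<eta> a))"
    using lin_measurable by simp
  show "real_distribution (gauss s2 (lin \<eta> a (\<lambda>j. \<eta> $ j)))"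
    by unfold_locales auto
  show "char (distr (gauss_law \<eta> s2) borel (lin \<eta> a)) = char (gauss s2 (lin \<eta> a (\<lambda>j. \<eta> $ j)))"
  proof
    fix t
    have "char (distr (gauss_law \<eta> s2) borel (lin \<eta> a)) t =
        (\<integral>x. iexp (\<Sum>j<dim_vec \<eta>. (t * a j) * x j) \<partial>gauss_law \<eta> s2)"
      unfolding char_def using lin_measurable by (subst integral_distr) (auto simp: lin_def sum_distrib_left mult.assoc)
    also have "\<dots> = char (gauss s2 (lin \<eta> a (\<lambda>j. \<eta> $ j))) t"
      unfolding char_gauss_law[OF s2] char_gauss[OF s2]
      using a by (simp add: lin_def power_mult_distrib sum_distrib_left[symmetric] mult.assoc)
    finally show "char (distr (gauss_law \<eta> s2) borel (lin \<eta> a)) t = char (gauss s2 (lin \<eta> a (\<lambda>j. \<eta> $ j))) t" .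
  qed
qed

text \<open>In the squared length of s a + t b the cross term is 2 s t times the inner product of a
  and b. Orthogonality removes it, so the joint characteristic function factors.\<close>

lemma indep_lin:
  assumes s2: "s2 > 0" and ab: "(\<Sum>j<dim_vec \<eta>. a j * b j) = 0"
  shows "prob_space.indep_var (gauss_law \<eta> s2) borel (lin \<eta> a) borel (lin \<eta> b)"
proof -
  interpret prob_space "gauss_law \<eta> s2" using s2 by (rule prob_space_gauss_law)
  have ch: "(\<integral>x. iexp (s * lin \<eta> a x + t * lin \<eta> b x) \<partial>gauss_law \<eta> s2) =
      iexp (s * lin \<eta> a (\<lambda>j. \<eta> $ j) + t * lin \<eta> b (\<lambda>j. \<eta> $ j)) *
      complex_of_real (exp (- (s2 * (s\<^sup>2 * (\<Sum>j<dim_vec \<eta>. (a j)\<^sup>2) + t\<^sup>2 * (\<Sum>j<dim_vec \<eta>. (b j)\<^sup>2))) / 2))" for s t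
  proof -
    have lin: "s * lin \<eta> a x + t * lin \<eta> b x = (\<Sum>j<dim_vec \<eta>. (s * a j + t * b j) * x j)" for x
      by (simp add: lin_def sum_distrib_left distrib_right sum.distrib mult.assoc)
    have "(\<Sum>j<dim_vec \<eta>. (s * a j + t * b j)\<^sup>2) =
        s\<^sup>2 * (\<Sum>j<dim_vec \<eta>. (a j)\<^sup>2) + t\<^sup>2 * (\<Sum>j<dim_vec \<eta>. (b j)\<^sup>2) + 2 * s * t * (\<Sum>j<dim_vec \<eta>. a j * b j)"
      unfolding sum_distrib_left sum.distrib[symmetric]
      by (intro sum.cong) (auto simp: power2_eq_square algebra_simps)
    then show ?thesis unfolding lin char_gauss_law[OF s2] using ab by simp
  qed
  show ?thesis
  proof (rule indep_var_char[OF lin_measurable lin_measurable])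
    fix s t
    have 1: "(\<integral>x. iexp (s * lin \<eta> a x) \<partial>gauss_law \<eta> s2) =
       iexp (s * lin \<eta> a (\<lambda>j. \<eta> $ j)) * complex_of_real (exp (- (s2 * (s\<^sup>2 * (\<Sum>j<dim_vec \<eta>. (a j)\<^sup>2))) / 2))"
      using ch[of s 0] by simp
    have 2: "(\<integral>x. iexp (t * lin \<eta> b x) \<partial>gauss_law \<eta> s2) =
       iexp (t * lin \<eta> b (\<lambda>j. \<eta> $ j)) * complex_of_real (exp (- (s2 * (t\<^sup>2 * (\<Sum>j<dim_vec \<eta>. (b j)\<^sup>2))) / 2))"
      using ch[of 0 t] by simp
    have 3: "exp (- (s2 * (x + y)) / 2) = exp (- (s2 * x) / 2) * exp (- (s2 * y) / 2)" for x y :: real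
      by (simp add: distrib_left add_divide_distrib diff_divide_distrib flip: exp_add)
    show "(\<integral>x. iexp (s * lin \<eta> a x + t * lin \<eta> b x) \<partial>gauss_law \<eta> s2) =
        (\<integral>x. iexp (s * lin \<eta> a x) \<partial>gauss_law \<eta> s2) * (\<integral>x. iexp (t * lin \<eta> b x) \<partial>gauss_law \<eta> s2)"
      unfolding ch 1 2 3 by (simp add: distrib_left exp_add mult_ac)
  qed
qed

section \<open>Penalty bases\<close>

text \<open>Each observation has exactly one level, so distinct columns of X have disjoint supports.
  The diagonal holds the level counts, which are positive because every level is observed.\<close>

lemma incidence_gram:
  assumes "incidence_matrix p X"
  obtains m where "\<And>i. i < p \<Longrightarrow> m i > 0" "transpose_mat X * X = mat_diag p m"
proof -
  obtain lev where lev: "lev ` {..<dim_row X} = {..<p}"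
    and X: "X = Matrix.mat (dim_row X) p (\<lambda>(j, i). if lev j = i then 1 else 0)"
    using assms by (auto simp: incidence_matrix_def)
  define m where "m = (\<lambda>i. real (card {j. j < dim_row X \<and> lev j = i}))"
  have Xij: "X $$ (j, i) = (if lev j = i then 1 else 0)" if "j < dim_row X" "i < p" for i j
    using that by (subst X) simp
  have dc: "dim_col X = p" by (subst X) simp
  have "m i > 0" if i: "i < p" for i
  proof -
    have "i \<in> lev ` {..<dim_row X}" using lev i by simp
    then obtain j where j: "j < dim_row X" "lev j = i" by auto
    then have "card {j. j < dim_row X \<and> lev j = i} > 0" by (subst card_gt_0_iff) auto
    then show ?thesis by (simp add: m_def)
  qed
  moreover have "transpose_mat X * X = mat_diag p m"
  proof (rule eq_matI)
    fix i k assume "i < dim_row (mat_diag p m)" "k < dim_col (mat_diag p m)"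
    then have ik: "i < p" "k < p" by (auto simp: mat_diag_def)
    have "(transpose_mat X * X) $$ (i, k) = (\<Sum>j\<in>{0..<dim_row X}. X $$ (j, i) * X $$ (j, k))"
      using ik dc by (simp add: scalar_prod_def)
    also have "\<dots> = (\<Sum>j\<in>{0..<dim_row X}. if lev j = i \<and> i = k then 1 else 0)"
      using ik by (intro sum.cong) (auto simp: Xij)
    also have "\<dots> = (if i = k then m k else 0)"
    proof (cases "i = k")
      case True
      have "{j \<in> {0..<dim_row X}. lev j = k} = {j. j < dim_row X \<and> lev j = k}" by auto
      then show ?thesis using True by (simp add: m_def sum.If_cases Int_def)
    qed simp
    finally show "(transpose_mat X * X) $$ (i, k) = mat_diag p m $$ (i, k)"
      using ik by (simp add: mat_diag_def)
  qed (auto simp: dc mat_diag_def)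
  ultimately show thesis using that by blast
qed

text \<open>Write N = X'X, so that S is the inverse square root of N. Then U'U = G' (S N S) G = G'G
  is the identity, and U U' X = X S (G G') S N = X S S N = X. The second identity says that U U'
  fixes the column space of X, hence every admissible mean.\<close>

lemma penalty_basis_properties:
  assumes inc: "incidence_matrix p X" and pb: "penalty_basis X D U" and D: "dim_col D = p"
  shows "X \<in> carrier_mat (dim_row X) p" "U \<in> carrier_mat (dim_row X) p"
    "transpose_mat U * U = 1\<^sub>m p" "U * (transpose_mat U * X) = X"
proof -
  define n where "n = dim_row X"
  obtain m where m: "\<And>i. i < p \<Longrightarrow> m i > 0" and gram: "transpose_mat X * X = mat_diag p m"
    using incidence_gram[OF inc] by blast
  have X: "X \<in> carrier_mat n p"
    using inc unfolding incidence_matrix_def n_def by (metis carrier_matI dim_col_mat(1))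
  define S where "S = mat_diag p (\<lambda>i. 1 / sqrt (m i))"
  have S: "S \<in> carrier_mat p p" and St: "transpose_mat S = S"
    by (auto simp: S_def mat_diag_def)
  have Seq: "inv_sqrt_diag (transpose_mat X * X) = S"
    unfolding gram inv_sqrt_diag_def S_def by (auto simp: mat_diag_def)
  obtain G lam where sp: "spectral_representation (S * (transpose_mat D * D) * S) G lam" and U: "U = X * S * G"
    using pb unfolding penalty_basis_def Seq Let_def by blast
  have dr: "dim_row (S * (transpose_mat D * D) * S) = p" using S by simp
  have G: "G \<in> carrier_mat p p" and GG: "transpose_mat G * G = 1\<^sub>m p"
    using sp unfolding spectral_representation_def Let_def dr by auto
  have Gt: "transpose_mat G \<in> carrier_mat p p" and Xt: "transpose_mat X \<in> carrier_mat p n" using G X by auto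
  have GG': "G * transpose_mat G = 1\<^sub>m p" by (rule mat_mult_left_right_inverse[OF Gt G GG])
  have sq: "1 / sqrt (m i) * (m i * (1 / sqrt (m i))) = 1" "1 / sqrt (m i) * (1 / sqrt (m i) * m i) = 1" if "i < p" for i
    using m[OF that] by (simp_all add: field_simps)
  have SNS: "S * (mat_diag p m * S) = 1\<^sub>m p"
    unfolding S_def mat_diag_diag using sq by (auto simp: mat_diag_def intro!: eq_matI)
  have SSN: "S * (S * mat_diag p m) = 1\<^sub>m p"
    unfolding S_def mat_diag_diag using sq by (auto simp: mat_diag_def intro!: eq_matI)
  show "X \<in> carrier_mat (dim_row X) p" using X unfolding n_def .
  have XS: "X * S \<in> carrier_mat n p" using X S by simp
  have U': "U \<in> carrier_mat n p" unfolding U using X S G by simp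
  then show "U \<in> carrier_mat (dim_row X) p" unfolding n_def .
  have Ut: "transpose_mat U = transpose_mat G * (S * transpose_mat X)"
    unfolding U using transpose_mult[OF XS G] transpose_mult[OF X S] St by simp
  have N: "mat_diag p m \<in> carrier_mat p p" by simp
  have UtX: "transpose_mat U * X = transpose_mat G * (S * mat_diag p m)"
    unfolding Ut gram[symmetric]
    using assoc_mult_mat[OF Gt mult_carrier_mat[OF S Xt] X] assoc_mult_mat[OF S Xt X] by simp
  have SN: "S * mat_diag p m \<in> carrier_mat p p" using S N by simp
  have "transpose_mat U * U = transpose_mat U * (X * (S * G))"
    unfolding U using assoc_mult_mat[OF X S G] by simp
  also have "\<dots> = (transpose_mat U * X) * (S * G)"
    using assoc_mult_mat[of "transpose_mat U" p n X p "S * G" p] U' X S G by simp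
  also have "\<dots> = transpose_mat G * ((S * mat_diag p m) * (S * G))"
    unfolding UtX by (rule assoc_mult_mat[OF Gt SN mult_carrier_mat[OF S G]])
  also have "(S * mat_diag p m) * (S * G) = (S * mat_diag p m * S) * G"
    by (rule assoc_mult_mat[OF SN S G, symmetric])
  also have "S * mat_diag p m * S = 1\<^sub>m p" using SNS assoc_mult_mat[OF S N S] by simp
  also have "1\<^sub>m p * G = G" using G by simp
  finally show "transpose_mat U * U = 1\<^sub>m p" using GG by simp
  have "U * (transpose_mat U * X) = (X * S) * (G * (transpose_mat G * (S * mat_diag p m)))"
    unfolding UtX unfolding U by (rule assoc_mult_mat[OF XS G mult_carrier_mat[OF Gt SN]])
  also have "G * (transpose_mat G * (S * mat_diag p m)) = S * mat_diag p m"
    using assoc_mult_mat[OF G Gt SN] unfolding GG' left_mult_one_mat[OF SN] by (rule sym)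
  also have "(X * S) * (S * mat_diag p m) = X * (S * (S * mat_diag p m))"
    by (rule assoc_mult_mat[OF X S SN])
  also have "\<dots> = X" unfolding SSN using X by simp
  finally show "U * (transpose_mat U * X) = X" .
qed

lemma isometry_norm:
  fixes U :: "real mat"
  assumes U: "U \<in> carrier_mat n p" and orth: "transpose_mat U * U = 1\<^sub>m p" and v: "v \<in> carrier_vec p"
  shows "(\<Sum>j<n. ((U *\<^sub>v v) $ j)\<^sup>2) = (\<Sum>i<p. (v $ i)\<^sup>2)"
proof -
  have sq: "(\<Sum>i<d. (w $ i)\<^sup>2) = w \<bullet> w" if "w \<in> carrier_vec d" for w :: "real vec" and d
    using that by (auto simp: scalar_prod_def power2_eq_square lessThan_atLeast0)
  have Uv: "U *\<^sub>v v \<in> carrier_vec n" using U v by simp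
  have "(U *\<^sub>v v) \<bullet> (U *\<^sub>v v) = (transpose_mat U *\<^sub>v (U *\<^sub>v v)) \<bullet> v"
    using transpose_vec_mult_scalar[OF U v Uv] by simp
  also have "transpose_mat U *\<^sub>v (U *\<^sub>v v) = (transpose_mat U * U) *\<^sub>v v"
    using U v by (intro assoc_mult_mat_vec[symmetric]) auto
  also have "\<dots> = v" using orth v by simp
  finally show ?thesis using sq[OF Uv] sq[OF v] by simp
qed

text \<open>Because \<eta> = U \<xi>, estimator and mean are both images under U, and U preserves
  length. This turns the loss over n observations into a sum over p coordinates.\<close>

lemma shrink_loss:
  assumes U: "U \<in> carrier_mat n p" and orth: "transpose_mat U * U = 1\<^sub>m p"
    and \<eta>: "\<eta> \<in> carrier_vec n" "U *\<^sub>v (transpose_mat U *\<^sub>v \<eta>) = \<eta>" and y: "y \<in> carrier_vec n"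
  shows "loss p (shrink U f y) \<eta> =
    (\<Sum>i<p. (f $ i * (transpose_mat U *\<^sub>v y) $ i - (transpose_mat U *\<^sub>v \<eta>) $ i)\<^sup>2) / real p"
proof -
  define z where "z = transpose_mat U *\<^sub>v y"
  define \<xi> where "\<xi> = transpose_mat U *\<^sub>v \<eta>"
  have z: "z \<in> carrier_vec p" and \<xi>: "\<xi> \<in> carrier_vec p" using U y \<eta> by (auto simp: z_def \<xi>_def)
  define w where "w = mat_diag p (\<lambda>i. f $ i) *\<^sub>v z"
  have w: "w \<in> carrier_vec p" unfolding w_def using z by (intro mult_mat_vec_carrier[of _ p p]) auto
  have wi: "w $ i = f $ i * z $ i" if "i < p" for i
  proof -
    have "w $ i = (\<Sum>k\<in>{0..<p}. (if i = k then f $ k else 0) * z $ k)"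
      using that z by (simp add: w_def mat_diag_def scalar_prod_def)
    also have "\<dots> = (\<Sum>k\<in>{0..<p}. if i = k then f $ k * z $ k else 0)" by (intro sum.cong) auto
    also have "\<dots> = f $ i * z $ i" using that by simp
    finally show ?thesis .
  qed
  have est: "shrink U f y = U *\<^sub>v w" using U by (simp add: shrink_def w_def z_def)
  have diff: "U *\<^sub>v (w - \<xi>) = U *\<^sub>v w - \<eta>"
    using mult_minus_distrib_mat_vec[OF U w \<xi>] \<eta>(2) by (simp add: \<xi>_def)
  have "loss p (shrink U f y) \<eta> = (\<Sum>j<n. ((U *\<^sub>v (w - \<xi>)) $ j)\<^sup>2) / real p"
    using U \<eta>(1) w by (simp add: loss_def est diff)
  also have "(\<Sum>j<n. ((U *\<^sub>v (w - \<xi>)) $ j)\<^sup>2) = (\<Sum>i<p. ((w - \<xi>) $ i)\<^sup>2)"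
    using w \<xi> by (intro isometry_norm[OF U orth]) auto
  also have "\<dots> = (\<Sum>i<p. (f $ i * z $ i - \<xi> $ i)\<^sup>2)"
    using w \<xi> by (intro sum.cong) (auto simp: wi)
  finally show ?thesis by (simp add: z_def \<xi>_def)
qed

section \<open>From uniform closeness to the adaptive estimators\<close>

lemma ennreal_tendsto_0I:
  fixes f :: "nat \<Rightarrow> ennreal"
  assumes "\<And>e::real. e > 0 \<Longrightarrow> \<forall>\<^sub>F p in sequentially. f p \<le> ennreal e"
  shows "f \<longlonglongrightarrow> 0"
proof (rule order_tendstoI)
  fix a :: ennreal assume a: "0 < a"
  obtain e :: real where e: "e > 0" "ennreal e < a"
  proof (cases a)
    case (real r)
    then have "r > 0" using a by auto
    then show thesis using real that[of "r / 2"] by (auto simp: ennreal_less_iff)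
  next
    case top
    then show thesis using that[of 1] by simp
  qed
  show "\<forall>\<^sub>F p in sequentially. f p < a"
    using assms[OF e(1)] by eventually_elim (use e(2) in auto)
qed simp

text \<open>One envelope serves both quantities, since the argument for the minimizer compares loss
  and estimated risk with the risk at the same data point.\<close>

definition risk_close ::
  "nat \<Rightarrow> 'i set \<Rightarrow> ('i \<Rightarrow> real vec \<Rightarrow> real vec) \<Rightarrow> ('i \<Rightarrow> real vec \<Rightarrow> real) \<Rightarrow> nat \<Rightarrow> real vec \<Rightarrow> real \<Rightarrow>
   ((nat \<Rightarrow> real) \<Rightarrow> real) \<Rightarrow> bool" where
  "risk_close n I est rhat p \<eta> s2 B \<longleftrightarrow> (\<forall>x\<in>space (gauss_law \<eta> s2). \<forall>i\<in>I.
     \<bar>loss p (est i (Matrix.vec n x)) \<eta> - risk p \<eta> s2 (est i)\<bar> \<le> B x \<and>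
     \<bar>rhat i (Matrix.vec n x) - risk p \<eta> s2 (est i)\<bar> \<le> B x)"

text \<open>Write m for the infimum of the candidate risks. The selected estimated risk is at least
  m - B by closeness at the selected index and at most m + B by minimality, even when the infimum is
  not attained. The loss of the selection differs from it by at most 2 B and is thus between m - B
  and m + 3 B. Only after this pointwise argument is the expectation taken: the adaptive risk is the
  mean of that loss, not the risk of a fixed candidate read off at a random index.\<close>

lemma adaptive_bounds:
  fixes \<eta> :: "real vec" and s2 :: real and est :: "nat \<Rightarrow> 'i \<Rightarrow> real vec \<Rightarrow> real vec"
  defines "P \<equiv> gauss_law \<eta> s2"
  assumes sel: "minimizes_estimated_risk n I est rhat sel"
    and p: "p > 0" and s2: "s2 > 0" and e: "e > 0" and dim: "dim_vec \<eta> = n p"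
    and small: "small_envelope P e B"
    and close: "risk_close (n p) (I p) (est p) (rhat p) p \<eta> s2 B"
  defines "y \<equiv> \<lambda>x. Matrix.vec (n p) x"
  defines "m \<equiv> INF i\<in>I p. risk p \<eta> s2 (est p i)"
  shows "\<bar>risk p \<eta> s2 (\<lambda>y. est p (sel p y) y) - m\<bar> \<le> 3 * e"
    "\<And>x. x \<in> space P \<Longrightarrow> \<bar>rhat p (sel p (y x)) (y x) - m\<bar> \<le> B x"
    "\<And>x. x \<in> space P \<Longrightarrow>
       \<bar>rhat p (sel p (y x)) (y x) - loss p (est p (sel p (y x)) (y x)) \<eta>\<bar> \<le> 2 * B x"
proof -
  have B: "B \<in> borel_measurable P" "\<And>x. x \<in> space P \<Longrightarrow> 0 \<le> B x"
    "(\<integral>\<^sup>+x. ennreal (B x) \<partial>P) \<le> ennreal e"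
    using small by (auto simp: small_envelope_def)
  interpret prob_space P unfolding P_def using s2 by (rule prob_space_gauss_law)
  define s where "s = (\<lambda>x. sel p (y x))"
  define R where "R = (\<lambda>i. risk p \<eta> s2 (est p i))"
  have m: "m = (INF i\<in>I p. R i)" by (simp add: m_def R_def)
  define L where "L = (\<lambda>x. loss p (est p (s x) (y x)) \<eta>)"
  have y_carrier: "y x \<in> carrier_vec (n p)" for x by (simp add: y_def)
  have amin: "is_arg_min (\<lambda>i. rhat p i (y x)) (\<lambda>i. i \<in> I p) (s x)" for x
    using sel p y_carrier unfolding minimizes_estimated_risk_def s_def by blast
  have sI: "s x \<in> I p" for x using amin[of x] by (simp add: is_arg_min_def)
  have s_min: "rhat p (s x) (y x) \<le> rhat p i (y x)" if "i \<in> I p" for i x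
    using amin[of x] that by (auto simp: is_arg_min_linorder)
  have loss_nonneg: "0 \<le> loss p v \<eta>" for v by (auto simp: loss_def intro!: divide_nonneg_nonneg sum_nonneg)
  have R0: "0 \<le> R i" for i unfolding R_def risk_def by (intro integral_nonneg_AE AE_I2 loss_nonneg)
  have bdd: "bdd_below (R ` I p)" using R0 by (intro bdd_belowI[of _ 0]) auto
  have ne: "I p \<noteq> {}" using sI by blast
  have m_le: "m \<le> R i" if "i \<in> I p" for i unfolding m using bdd that by (rule cINF_lower)
  have le_m: "a \<le> m" if "\<And>i. i \<in> I p \<Longrightarrow> a \<le> R i" for a unfolding m using ne that by (rule cINF_greatest)
  have rl: "rhat p (s x) (y x) \<ge> m - B x" "rhat p (s x) (y x) \<le> m + B x"
    "L x \<ge> m - B x" "L x \<le> m + 3 * B x" "\<bar>rhat p (s x) (y x) - L x\<bar> \<le> 2 * B x"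
    if x: "x \<in> space P" for x
  proof -
    have 1: "\<bar>rhat p i (y x) - R i\<bar> \<le> B x" "\<bar>loss p (est p i (y x)) \<eta> - R i\<bar> \<le> B x" if "i \<in> I p" for i
      using close x that by (auto simp: R_def y_def risk_close_def P_def)
    note 2 = 1[OF sI[of x]] m_le[OF sI[of x]]
    show "rhat p (s x) (y x) \<ge> m - B x" using 2 by linarith
    show "L x \<ge> m - B x" using 2 unfolding L_def by linarith
    show *: "\<bar>rhat p (s x) (y x) - L x\<bar> \<le> 2 * B x" using 2 unfolding L_def by linarith
    have "rhat p (s x) (y x) - B x \<le> m"
    proof (rule le_m)
      fix i assume i: "i \<in> I p"
      show "rhat p (s x) (y x) - B x \<le> R i" using 1(1)[OF i] s_min[OF i, of x] by linarith
    qed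
    then show "rhat p (s x) (y x) \<le> m + B x" by linarith
    then show "L x \<le> m + 3 * B x" using * by linarith
  qed
  have B_int: "integrable P B"
    using B by (intro integrableI_nonneg) (auto intro: order.strict_trans1)
  have "ennreal (\<integral>x. B x \<partial>P) \<le> ennreal e"
    using B B_int by (subst nn_integral_eq_integral[symmetric]) auto
  then have EB: "(\<integral>x. B x \<partial>P) \<le> e" using e by (simp add: ennreal_le_iff)
  have meas: "L \<in> borel_measurable P"
  proof -
    have sets: "sets P = sets (\<Pi>\<^sub>M j\<in>{..<n p}. borel)"
      unfolding P_def gauss_law_def dim by (intro sets_PiM_cong) auto
    have "(\<lambda>x. est p (s x) (y x) $ j) \<in> borel_measurable P" if "j < n p" for j
      using sel p that unfolding minimizes_estimated_risk_def statistic_def s_def y_def measurable_cong_sets[OF sets refl]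
      by blast
    then show ?thesis unfolding L_def loss_def dim by (intro borel_measurable_divide borel_measurable_sum borel_measurable_power borel_measurable_diff) auto
  qed
  \<comment> \<open>Measurability of the adaptive loss comes from the admissibility of the
    selection; integrability comes from the bound m + 3 B.\<close>
  have L_int: "integrable P L"
  proof (rule Bochner_Integration.integrable_bound[OF _ meas])
    show "integrable P (\<lambda>x. m + 3 * B x)" using B_int by auto
    show "AE x in P. norm (L x) \<le> norm (m + 3 * B x)"
      using rl(4) loss_nonneg by (intro AE_I2) (fastforce simp: L_def)
  qed
  have "(\<integral>x. L x \<partial>P) \<le> (\<integral>x. m + 3 * B x \<partial>P)"
    using L_int B_int rl(4) by (intro integral_mono) auto
  also have "\<dots> = m + 3 * (\<integral>x. B x \<partial>P)"
    using B_int by (simp add: prob_space)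
  finally have up: "(\<integral>x. L x \<partial>P) \<le> m + 3 * e" using EB by linarith
  have "m - (\<integral>x. B x \<partial>P) = (\<integral>x. m - B x \<partial>P)"
    using B_int by (simp add: prob_space)
  also have "\<dots> \<le> (\<integral>x. L x \<partial>P)"
    using L_int B_int rl(3) by (intro integral_mono) auto
  finally have low: "m - e \<le> (\<integral>x. L x \<partial>P)" using EB by linarith
  have RL: "risk p \<eta> s2 (\<lambda>y. est p (sel p y) y) = (\<integral>x. L x \<partial>P)"
    by (simp add: risk_def P_def L_def s_def y_def dim)
  show "\<bar>risk p \<eta> s2 (\<lambda>y. est p (sel p y) y) - m\<bar> \<le> 3 * e"
    unfolding RL using up low e by linarith
  fix x assume x: "x \<in> space P"
  show "\<bar>rhat p (sel p (y x)) (y x) - m\<bar> \<le> B x"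
    using rl(1,2)[OF x] unfolding s_def by linarith
  show "\<bar>rhat p (sel p (y x)) (y x) - loss p (est p (sel p (y x)) (y x)) \<eta>\<bar> \<le> 2 * B x"
    using rl(5)[OF x] unfolding s_def L_def .
qed

lemma convergences_from_envelope:
  fixes I :: "nat \<Rightarrow> 'i set"
  assumes env: "\<And>c s2 e. c > 0 \<Longrightarrow> s2 > 0 \<Longrightarrow> e > 0 \<Longrightarrow>
    \<forall>\<^sub>F p in sequentially. p > 0 \<and> (\<forall>\<eta>\<in>H p c. dim_vec \<eta> = n p \<and> (\<exists>B. small_envelope (gauss_law \<eta> s2) e B \<and>
      risk_close (n p) (I p) (est p) (rhat p) p \<eta> s2 B))"
  shows "convergences_ABC n H I est rhat"
  unfolding convergences_ABC_def
proof (intro conjI allI impI)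
  have sup_le: "expect \<eta> s2 g \<le> ennreal e"
    if "dim_vec \<eta> = n p" "small_envelope (gauss_law \<eta> s2) e B"
      "\<And>x. x \<in> space (gauss_law \<eta> s2) \<Longrightarrow> g (Matrix.vec (n p) x) \<le> ennreal (B x)" for p \<eta> s2 e B g
    using that nn_integral_mono[of "gauss_law \<eta> s2" "\<lambda>x. g (Matrix.vec (n p) x)" "\<lambda>x. ennreal (B x)"]
    by (auto simp: expect_def small_envelope_def)
  show "convergence_A H I est rhat"
    unfolding convergence_A_def
  proof (intro ballI allI impI ennreal_tendsto_0I)
    fix V and c s2 e :: real
    assume V: "V \<in> {\<lambda>p i \<eta> y. loss p (est p i y) \<eta>, \<lambda>p i \<eta> y. rhat p i y}" and "c > 0" "s2 > 0" "e > 0"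
    from env[OF this(2-4)]
    show "\<forall>\<^sub>F p in sequentially. (SUP \<eta>\<in>H p c. expect \<eta> s2 (\<lambda>y. SUP i\<in>I p. ennreal \<bar>V p i \<eta> y - risk p \<eta> s2 (est p i)\<bar>)) \<le> ennreal e"
    proof (eventually_elim, intro SUP_least, elim conjE)
      fix p \<eta> assume all: "\<forall>\<eta>\<in>H p c. dim_vec \<eta> = n p \<and> (\<exists>B. small_envelope (gauss_law \<eta> s2) e B \<and>
        risk_close (n p) (I p) (est p) (rhat p) p \<eta> s2 B)" and \<eta>: "\<eta> \<in> H p c"
      obtain B where dim: "dim_vec \<eta> = n p" and B: "small_envelope (gauss_law \<eta> s2) e B"
        "\<And>x i. x \<in> space (gauss_law \<eta> s2) \<Longrightarrow> i \<in> I p \<Longrightarrow> \<bar>V p i \<eta> (Matrix.vec (n p) x) - risk p \<eta> s2 (est p i)\<bar> \<le> B x"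
        using bspec[OF all \<eta>] V by (auto simp: risk_close_def)
      show "expect \<eta> s2 (\<lambda>y. SUP i\<in>I p. ennreal \<bar>V p i \<eta> y - risk p \<eta> s2 (est p i)\<bar>) \<le> ennreal e"
        using B(2) by (intro sup_le[OF dim B(1)] SUP_least ennreal_leI) auto
    qed
  qed
  fix sel assume sel: "minimizes_estimated_risk n I est rhat sel"
  show "convergence_B H I est sel"
    unfolding convergence_B_def
  proof (intro allI impI ennreal_tendsto_0I)
    fix c s2 e :: real assume c: "c > 0" and s2: "s2 > 0" and e: "e > 0"
    \<comment> \<open>The adaptive risk is within three times the envelope mean of the
      infimum.\<close>
    then have e3: "e / 3 > 0" by simp
    from env[OF c s2 this]
    show "\<forall>\<^sub>F p in sequentially. (SUP \<eta>\<in>H p c.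
        ennreal \<bar>risk p \<eta> s2 (\<lambda>y. est p (sel p y) y) - (INF i\<in>I p. risk p \<eta> s2 (est p i))\<bar>) \<le> ennreal e"
    proof eventually_elim
      case (elim p)
      show ?case
        using elim adaptive_bounds(1)[OF sel _ s2 e3, of p] by (intro SUP_least ennreal_leI) fastforce
    qed
  qed
  show "convergence_C H est rhat sel"
    unfolding convergence_C_def
  proof (intro ballI allI impI ennreal_tendsto_0I)
    fix W and c s2 e :: real
    assume W: "W \<in> {\<lambda>p \<eta> s2 y. loss p (est p (sel p y) y) \<eta>, \<lambda>p \<eta> s2 y. risk p \<eta> s2 (\<lambda>y'. est p (sel p y') y')}"
      and c: "c > 0" and s2: "s2 > 0" and e: "e > 0"
    \<comment> \<open>The error is at most 2 B against the loss and B plus three envelope means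
      against the risk; \<open>B x + B x + 3 * (e / 5)\<close> covers both and costs five
      shares.\<close>
    then have e5: "e / 5 > 0" by simp
    from env[OF c s2 this]
    show "\<forall>\<^sub>F p in sequentially. (SUP \<eta>\<in>H p c. expect \<eta> s2 (\<lambda>y. ennreal \<bar>rhat p (sel p y) y - W p \<eta> s2 y\<bar>)) \<le> ennreal e"
    proof eventually_elim
      case (elim p)
      show ?case
      proof (rule SUP_least)
        fix \<eta> assume \<eta>: "\<eta> \<in> H p c"
        interpret prob_space "gauss_law \<eta> s2" using s2 by (rule prob_space_gauss_law)
        obtain B where dim: "dim_vec \<eta> = n p" and small: "small_envelope (gauss_law \<eta> s2) (e / 5) B"
          and close: "risk_close (n p) (I p) (est p) (rhat p) p \<eta> s2 B"
          using bspec[OF conjunct2[OF elim] \<eta>] by blast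
        note bounds = adaptive_bounds[OF sel conjunct1[OF elim] s2 e5 dim small close]
        have "small_envelope (gauss_law \<eta> s2) (e / 5 + e / 5 + 3 * (e / 5)) (\<lambda>x. B x + B x + 3 * (e / 5))"
          using e by (intro small_envelope_add small_envelope_const small) auto
        then have "small_envelope (gauss_law \<eta> s2) e (\<lambda>x. B x + B x + 3 * (e / 5))" by simp
        then show "expect \<eta> s2 (\<lambda>y. ennreal \<bar>rhat p (sel p y) y - W p \<eta> s2 y\<bar>) \<le> ennreal e"
        proof (rule sup_le[OF dim], intro ennreal_leI)
          fix x assume x: "x \<in> space (gauss_law \<eta> s2)"
          have "0 \<le> B x" using small x by (simp add: small_envelope_def)
          show "\<bar>rhat p (sel p (Matrix.vec (n p) x)) (Matrix.vec (n p) x) - W p \<eta> s2 (Matrix.vec (n p) x)\<bar> \<le> B x + B x + 3 * (e / 5)"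
            using W
          proof (elim insertE emptyE)
            assume "W = (\<lambda>p \<eta> s2 y. loss p (est p (sel p y) y) \<eta>)"
            then show ?thesis using bounds(3)[OF x] e by simp
          next
            assume "W = (\<lambda>p \<eta> s2 y. risk p \<eta> s2 (\<lambda>y'. est p (sel p y') y'))"
            then have "W p \<eta> s2 (Matrix.vec (n p) x) = risk p \<eta> s2 (\<lambda>y. est p (sel p y) y)" by simp
            then show ?thesis using bounds(1) bounds(2)[OF x] \<open>0 \<le> B x\<close> by linarith
          qed
        qed
      qed
    qed
  qed
qed

text \<open>The envelope adds three errors, each of mean e / 3: the deviation of the loss, the
  deviation of the estimated risk with known variance, and the error of the variance estimator
  itself.\<close>

lemma (in gaussian_array) risk_envelope:
  assumes S_meas: "\<And>p h. p > 0 \<Longrightarrow> h \<in> H p \<Longrightarrow> S p \<in> borel_measurable (M p h)"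
    and S_cons: "\<And>e::real. e > 0 \<Longrightarrow> \<forall>\<^sub>F p in sequentially. \<forall>h\<in>H p. (\<integral>\<^sup>+x. ennreal \<bar>S p x - s2\<bar> \<partial>M p h) \<le> ennreal e"
    and e: "e > 0"
  shows "\<forall>\<^sub>F p in sequentially. \<forall>h\<in>H p. \<exists>B. small_envelope (M p h) e B \<and>
    (\<forall>x\<in>space (M p h). \<forall>i\<in>candidates p.
       \<bar>array_loss p h i x - array_risk p h i\<bar> \<le> B x \<and> \<bar>array_rhat (S p x) p i x - array_risk p h i\<bar> \<le> B x)"
proof -
  from e have e3: "e / 3 > 0" by simp
  show ?thesis
    using neglE[OF array_loss_deviation e3] neglE[OF array_rhat_deviation e3] S_cons[OF e3] eventually_gt_at_top[of 0]
  proof eventually_elim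
    case (elim p)
    show ?case
    proof
      fix h assume h: "h \<in> H p"
      obtain A where A: "small_envelope (M p h) (e / 3) A"
        "\<And>x i. x \<in> space (M p h) \<Longrightarrow> i \<in> candidates p \<Longrightarrow> \<bar>array_loss p h i x - array_risk p h i\<bar> \<le> A x"
        using bspec[OF elim(1) h] by blast
      obtain B where B: "small_envelope (M p h) (e / 3) B"
        "\<And>x i. x \<in> space (M p h) \<Longrightarrow> i \<in> candidates p \<Longrightarrow> \<bar>array_rhat s2 p i x - array_risk p h i\<bar> \<le> B x"
        using bspec[OF elim(2) h] by blast
      have S: "small_envelope (M p h) (e / 3) (\<lambda>x. \<bar>S p x - s2\<bar>)"
        using S_meas[OF elim(4) h] elim(3) h by (auto simp: small_envelope_def)
      define E where "E = (\<lambda>x. A x + B x + \<bar>S p x - s2\<bar>)"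
      have "small_envelope (M p h) (e / 3 + e / 3 + e / 3) E"
        unfolding E_def using e by (intro small_envelope_add A(1) B(1) S) auto
      then have "small_envelope (M p h) e E" by simp
      moreover have "\<forall>x\<in>space (M p h). \<forall>i\<in>candidates p.
          \<bar>array_loss p h i x - array_risk p h i\<bar> \<le> E x \<and> \<bar>array_rhat (S p x) p i x - array_risk p h i\<bar> \<le> E x"
      proof (intro ballI conjI)
        fix x i assume x: "x \<in> space (M p h)" and i: "i \<in> candidates p"
        have "0 \<le> A x" "0 \<le> B x" using A(1) B(1) x by (auto simp: small_envelope_def)
        then show "\<bar>array_loss p h i x - array_risk p h i\<bar> \<le> E x" "\<bar>array_rhat (S p x) p i x - array_risk p h i\<bar> \<le> E x"
          using A(2)[OF x i] B(2)[OF x i] array_rhat_lipschitz[OF elim(4) i, of "S p x" x]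
          unfolding E_def by linarith+
      qed
      ultimately show "\<exists>B. small_envelope (M p h) e B \<and> (\<forall>x\<in>space (M p h). \<forall>i\<in>candidates p.
          \<bar>array_loss p h i x - array_risk p h i\<bar> \<le> B x \<and> \<bar>array_rhat (S p x) p i x - array_risk p h i\<bar> \<le> B x)"
        by blast
    qed
  qed
qed

section \<open>Transfer from the array to the matrix model\<close>

definition hybrid_weights :: "nat \<Rightarrow> nat \<Rightarrow> (nat \<Rightarrow> real) \<Rightarrow> real \<Rightarrow> real vec \<Rightarrow> real vec" where
  "hybrid_weights p k f t z = Matrix.vec p (\<lambda>j. if j < k then f j else soft_weight t (z $ j))"

definition hybrid_rhat :: "nat \<Rightarrow> real \<Rightarrow> nat \<Rightarrow> (nat \<Rightarrow> real) \<Rightarrow> real \<Rightarrow> real vec \<Rightarrow> real" where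
  "hybrid_rhat p s k f t z = ((\<Sum>i<k. (f i)\<^sup>2 * s + (1 - f i)\<^sup>2 * ((z $ i)\<^sup>2 - s)) +
     (\<Sum>i\<in>{k..<p}. s * (1 - 2 * indicator {-t..t} (z $ i)) + (min \<bar>z $ i\<bar> t)\<^sup>2)) / real p"

text \<open>The interface for all three classes: the original index is forgotten and only the data
  (D, k, f, t) that represent it are asked for. They must not depend on y, whereas the variance
  estimate s and the thresholded weights do.\<close>

definition hybrid_candidate ::
  "nat \<Rightarrow> nat \<Rightarrow> (real mat \<Rightarrow> real mat) \<Rightarrow> real mat set \<Rightarrow> (real vec \<Rightarrow> real) \<Rightarrow> (real vec \<Rightarrow> real vec) \<Rightarrow>
   (real vec \<Rightarrow> real) \<Rightarrow> bool" where
  "hybrid_candidate n p V Ds s est rhat \<longleftrightarrow>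
     (\<exists>D\<in>Ds. \<exists>k f t. k \<le> p \<and> (\<forall>i<k. 0 \<le> f i \<and> f i \<le> 1) \<and>
      (\<forall>i j. i \<le> j \<and> j < k \<longrightarrow> f j \<le> f i) \<and> 0 \<le> t \<and>
      (\<forall>y\<in>carrier_vec n.
        est y = shrink (V D) (hybrid_weights p k f t (transpose_mat (V D) *\<^sub>v y)) y \<and>
        rhat y = hybrid_rhat p (s y) k f t (transpose_mat (V D) *\<^sub>v y)))"

lemma weighted_consistent_eventually:
  assumes cons: "weighted_consistent w H sig2" and w: "\<And>p. w p \<ge> 1" and c: "c > 0" and s2: "s2 > 0" and e: "e > 0"
  shows "\<forall>\<^sub>F p in sequentially. \<forall>\<eta>\<in>H p c. expect \<eta> s2 (\<lambda>y. ennreal \<bar>sig2 p y - s2\<bar>) \<le> ennreal e"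
proof -
  have "(\<lambda>p. of_nat (w p) * (SUP \<eta>\<in>H p c. expect \<eta> s2 (\<lambda>y. ennreal \<bar>sig2 p y - s2\<bar>))) \<longlonglongrightarrow> 0"
    using cons c s2 unfolding weighted_consistent_def by blast
  then have "\<forall>\<^sub>F p in sequentially. of_nat (w p) * (SUP \<eta>\<in>H p c. expect \<eta> s2 (\<lambda>y. ennreal \<bar>sig2 p y - s2\<bar>)) < ennreal e"
    using e by (intro order_tendstoD) auto
  then show ?thesis
  proof eventually_elim
    case (elim p)
    show ?case
    proof
      fix \<eta> assume \<eta>: "\<eta> \<in> H p c"
      let ?S = "SUP \<eta>\<in>H p c. expect \<eta> s2 (\<lambda>y. ennreal \<bar>sig2 p y - s2\<bar>)"
      have "expect \<eta> s2 (\<lambda>y. ennreal \<bar>sig2 p y - s2\<bar>) \<le> ?S" using \<eta> by (rule SUP_upper)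
      also have "?S = of_nat 1 * ?S" by simp
      also have "\<dots> \<le> of_nat (w p) * ?S" using w[of p] by (intro mult_right_mono) (auto simp del: of_nat_1)
      also have "\<dots> \<le> ennreal e" using elim by simp
      finally show "expect \<eta> s2 (\<lambda>y. ennreal \<bar>sig2 p y - s2\<bar>) \<le> ennreal e" .
    qed
  qed
qed

lemma hybrid_convergences:
  fixes X :: "nat \<Rightarrow> real mat" and U :: "nat \<Rightarrow> real mat \<Rightarrow> real mat" and I :: "nat \<Rightarrow> 'i set"
  assumes layout: "\<And>p. p > 0 \<Longrightarrow> incidence_matrix p (X p)"
    and basis: "\<And>p D. p > 0 \<Longrightarrow> dim_col D = p \<Longrightarrow> penalty_basis (X p) D (U p D)"
    and estimator: "\<And>p. p > 0 \<Longrightarrow> statistic (dim_row (X p)) (sig2 p)"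
    and fin: "\<And>p. finite (\<D> p)" and dim: "\<And>p D. D \<in> \<D> p \<Longrightarrow> dim_col D = p"
    and card: "(\<lambda>p. real (card (\<D> p)) / real p) \<longlonglongrightarrow> 0"
    and cons: "weighted_consistent w (\<lambda>p c. means (X p) (U p ` \<D> p) c) sig2" and w: "\<And>p. w p \<ge> 1"
    and cand: "\<And>p i. p > 0 \<Longrightarrow> i \<in> I p \<Longrightarrow>
      hybrid_candidate (dim_row (X p)) p (U p) (\<D> p) (sig2 p) (est p i) (rhat p i)"
  shows "convergences_ABC (\<lambda>p. dim_row (X p)) (\<lambda>p c. means (X p) (U p ` \<D> p) c) I est rhat"
proof (rule convergences_from_envelope)
  fix c s2 e :: real assume c: "c > 0" and s2: "s2 > 0" and e: "e > 0"
  define n where "n = (\<lambda>p. dim_row (X p))"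
  define Hc where "Hc = (\<lambda>p. means (X p) (U p ` \<D> p) c)"
  define xi where "xi = (\<lambda>(p::nat) \<eta> D i. (transpose_mat (U p D) *\<^sub>v \<eta>) $ i)"
  define Z where "Z = (\<lambda>p D i x. \<Sum>j<n p. U p D $$ (j, i) * x j)"
  have nd: "dim_row (X p) = n p" and Hd: "means (X p) (U p ` \<D> p) c = Hc p" for p by (simp_all add: n_def Hc_def)
  have U: "U p D \<in> carrier_mat (n p) p" "transpose_mat (U p D) * U p D = 1\<^sub>m p"
    "U p D * (transpose_mat (U p D) * X p) = X p" and Xc: "X p \<in> carrier_mat (n p) p"
    if "p > 0" "D \<in> \<D> p" for p D
    unfolding n_def
    by (rule penalty_basis_properties[OF layout[OF that(1)] basis[OF that(1) dim[OF that(2)]] dim[OF that(2)]])+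
  have \<eta>_dim: "\<eta> \<in> carrier_vec (n p)" if "p > 0" "\<eta> \<in> Hc p" for p \<eta>
    using that(2) unfolding Hc_def means_def n_def by (force intro: carrier_vecI)
  have \<eta>_proj: "U p D *\<^sub>v (transpose_mat (U p D) *\<^sub>v \<eta>) = \<eta>"
    and \<eta>_max: "max_norm (transpose_mat (U p D) *\<^sub>v \<eta>) \<le> c"
    if p: "p > 0" and \<eta>: "\<eta> \<in> Hc p" and D: "D \<in> \<D> p" for p \<eta> D
  proof -
    note U = U[OF p D] and Xc = Xc[OF p D]
    obtain \<mu> where \<mu>: "\<mu> \<in> carrier_vec p" "\<eta> = X p *\<^sub>v \<mu>" and mx: "\<forall>V\<in>U p ` \<D> p. max_norm (transpose_mat V *\<^sub>v (X p *\<^sub>v \<mu>)) \<le> c"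
      using \<eta> Xc unfolding Hc_def means_def by auto
    show "max_norm (transpose_mat (U p D) *\<^sub>v \<eta>) \<le> c" using mx D \<mu>(2) by blast
    have Ut: "transpose_mat (U p D) \<in> carrier_mat p (n p)" using U(1) by simp
    have "transpose_mat (U p D) *\<^sub>v \<eta> = (transpose_mat (U p D) * X p) *\<^sub>v \<mu>"
      unfolding \<mu>(2) by (rule assoc_mult_mat_vec[OF Ut Xc \<mu>(1), symmetric])
    then have "U p D *\<^sub>v (transpose_mat (U p D) *\<^sub>v \<eta>) = (U p D * (transpose_mat (U p D) * X p)) *\<^sub>v \<mu>"
      using assoc_mult_mat_vec[OF U(1) mult_carrier_mat[OF Ut Xc] \<mu>(1)] by simp
    then show "U p D *\<^sub>v (transpose_mat (U p D) *\<^sub>v \<eta>) = \<eta>" unfolding U(3) \<mu>(2) .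
  qed
  have xi_lin: "xi p \<eta> D i = (\<Sum>j<n p. U p D $$ (j, i) * \<eta> $ j)"
    if "p > 0" "\<eta> \<in> Hc p" "D \<in> \<D> p" "i < p" for p \<eta> D i
    using U(1)[OF that(1,3)] \<eta>_dim[OF that(1,2)] that(4) by (auto simp: xi_def scalar_prod_def lessThan_atLeast0)
  have Z_eq: "Z p D i x = (transpose_mat (U p D) *\<^sub>v Matrix.vec (n p) x) $ i"
    if "p > 0" "D \<in> \<D> p" "i < p" for p D i x
    using U(1)[OF that(1,2)] that(3) by (auto simp: Z_def scalar_prod_def lessThan_atLeast0)
  have ortho: "(\<Sum>j<n p. U p D $$ (j, i) * U p D $$ (j, k)) = (if i = k then 1 else 0)"
    if "p > 0" "D \<in> \<D> p" "i < p" "k < p" for p D i k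
  proof -
    have "(transpose_mat (U p D) * U p D) $$ (i, k) = (\<Sum>j<n p. U p D $$ (j, i) * U p D $$ (j, k))"
      using U(1)[OF that(1,2)] that(3,4) by (auto simp: scalar_prod_def lessThan_atLeast0)
    then show ?thesis using U(2)[OF that(1,2)] that(3,4) by simp
  qed
  have Z_lin: "Z p D i = lin \<eta> (\<lambda>j. U p D $$ (j, i))" if "p > 0" "\<eta> \<in> Hc p" for p \<eta> D i
    using \<eta>_dim[OF that] by (auto simp: Z_def lin_def fun_eq_iff)
  \<comment> \<open>Orthonormality of the columns of U is used twice: unit length gives each
    coordinate the variance s2, and orthogonality of distinct columns gives pairwise independence.
    The bound on the means is the max-norm condition imposed for every basis in the family.\<close>
  interpret gaussian_array c s2 "\<lambda>p \<eta>. gauss_law \<eta> s2" Hc \<D> Z xi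
  proof (intro gaussian_array.intro gaussian_noise.intro gaussian_array_axioms.intro)
    fix p :: nat and \<eta> assume p: "p > 0" and \<eta>: "\<eta> \<in> Hc p"
    show "prob_space (gauss_law \<eta> s2)" using s2 by (rule prob_space_gauss_law)
    fix D i assume D: "D \<in> \<D> p" and i: "i < p"
    show "Z p D i \<in> borel_measurable (gauss_law \<eta> s2)" unfolding Z_lin[OF p \<eta>] by (rule lin_measurable)
    have dim\<eta>: "dim_vec \<eta> = n p" using \<eta>_dim[OF p \<eta>] by simp
    show "distr (gauss_law \<eta> s2) borel (Z p D i) = gauss s2 (xi p \<eta> D i)"
      unfolding Z_lin[OF p \<eta>] xi_lin[OF p \<eta> D i]
      using ortho[OF p D i i] by (subst distr_lin[OF s2]) (auto simp: dim\<eta> lin_def power2_eq_square)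
    show "prob_space.indep_var (gauss_law \<eta> s2) borel (Z p D i) borel (Z p D j)" if "j < p" "i \<noteq> j" for j
      unfolding Z_lin[OF p \<eta>] using ortho[OF p D i that(1)] that(2) by (intro indep_lin[OF s2]) (simp add: dim\<eta>)
    have dimxi: "dim_vec (transpose_mat (U p D) *\<^sub>v \<eta>) = p" using U(1)[OF p D] by simp
    have "\<bar>xi p \<eta> D i\<bar> \<le> max_norm (transpose_mat (U p D) *\<^sub>v \<eta>)"
      unfolding max_norm_def xi_def dimxi using i by (intro Max_ge) auto
    also have "\<dots> \<le> c" using p \<eta> D by (rule \<eta>_max)
    finally show "\<bar>xi p \<eta> D i\<bar> \<le> c" .
  qed (use c s2 fin card in auto)
  have S_meas: "(\<lambda>x. sig2 p (Matrix.vec (n p) x)) \<in> borel_measurable (gauss_law \<eta> s2)" if "p > 0" "\<eta> \<in> Hc p" for p \<eta>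
  proof -
    have sets: "sets (gauss_law \<eta> s2) = sets (\<Pi>\<^sub>M j\<in>{..<n p}. borel)"
      unfolding gauss_law_def using \<eta>_dim[OF that] by (intro sets_PiM_cong) auto
    show ?thesis using estimator[OF that(1)] unfolding statistic_def measurable_cong_sets[OF sets refl] nd .
  qed
  have S_cons: "\<forall>\<^sub>F p in sequentially. \<forall>\<eta>\<in>Hc p. (\<integral>\<^sup>+x. ennreal \<bar>sig2 p (Matrix.vec (n p) x) - s2\<bar> \<partial>gauss_law \<eta> s2) \<le> ennreal e"
    if "e > 0" for e :: real
    using weighted_consistent_eventually[OF cons w c s2 that] eventually_gt_at_top[of 0]
  proof eventually_elim
    case (elim p)
    show ?case
    proof
      fix \<eta> assume \<eta>: "\<eta> \<in> Hc p"
      then show "(\<integral>\<^sup>+x. ennreal \<bar>sig2 p (Matrix.vec (n p) x) - s2\<bar> \<partial>gauss_law \<eta> s2) \<le> ennreal e"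
        using elim(1) \<eta>_dim[OF elim(2) \<eta>] by (auto simp: Hc_def expect_def)
    qed
  qed
  have env: "\<forall>\<^sub>F p in sequentially. \<forall>\<eta>\<in>Hc p. \<exists>B. small_envelope (gauss_law \<eta> s2) e B \<and>
    (\<forall>x\<in>space (gauss_law \<eta> s2). \<forall>i\<in>candidates p.
       \<bar>array_loss p \<eta> i x - array_risk p \<eta> i\<bar> \<le> B x \<and>
       \<bar>array_rhat (sig2 p (Matrix.vec (n p) x)) p i x - array_risk p \<eta> i\<bar> \<le> B x)"
    using S_meas S_cons e by (rule risk_envelope)
  show "\<forall>\<^sub>F p in sequentially. p > 0 \<and> (\<forall>\<eta>\<in>means (X p) (U p ` \<D> p) c. dim_vec \<eta> = dim_row (X p) \<and>
      (\<exists>B. small_envelope (gauss_law \<eta> s2) e B \<and> risk_close (dim_row (X p)) (I p) (est p) (rhat p) p \<eta> s2 B))"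
    unfolding nd Hd
    using env eventually_gt_at_top[of 0]
  proof eventually_elim
    case (elim p)
    note p = elim(2)
    show ?case
    proof (intro conjI ballI p)
      fix \<eta> assume \<eta>: "\<eta> \<in> Hc p"
      have dim\<eta>: "dim_vec \<eta> = n p" using \<eta>_dim[OF p \<eta>] by simp
      then show "dim_vec \<eta> = n p" .
      obtain B where B: "small_envelope (gauss_law \<eta> s2) e B"
        "\<And>x i. x \<in> space (gauss_law \<eta> s2) \<Longrightarrow> i \<in> candidates p \<Longrightarrow> \<bar>array_loss p \<eta> i x - array_risk p \<eta> i\<bar> \<le> B x \<and>
           \<bar>array_rhat (sig2 p (Matrix.vec (n p) x)) p i x - array_risk p \<eta> i\<bar> \<le> B x"
        using bspec[OF elim(1) \<eta>] by blast
      have "\<bar>loss p (est p i (Matrix.vec (n p) x)) \<eta> - risk p \<eta> s2 (est p i)\<bar> \<le> B x \<and>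
          \<bar>rhat p i (Matrix.vec (n p) x) - risk p \<eta> s2 (est p i)\<bar> \<le> B x"
        if x: "x \<in> space (gauss_law \<eta> s2)" and i: "i \<in> I p" for x i
      proof -
        obtain D k f t where D: "D \<in> \<D> p" and k: "k \<le> p" and f: "\<forall>i<k. 0 \<le> f i \<and> f i \<le> 1"
          "\<forall>i j. i \<le> j \<and> j < k \<longrightarrow> f j \<le> f i" and t: "0 \<le> t"
          and est: "\<And>y. y \<in> carrier_vec (n p) \<Longrightarrow> est p i y = shrink (U p D) (hybrid_weights p k f t (transpose_mat (U p D) *\<^sub>v y)) y"
          and rhat: "\<And>y. y \<in> carrier_vec (n p) \<Longrightarrow> rhat p i y = hybrid_rhat p (sig2 p y) k f t (transpose_mat (U p D) *\<^sub>v y)"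
          using cand[OF p i] unfolding nd hybrid_candidate_def by blast
        define a where "a = (D, k, f, t)"
        have a: "a \<in> candidates p" using D k f t by (auto simp: a_def candidates_def)
        \<comment> \<open>The identity holds for every x, not only the one at hand, because the risk
          integrates it.\<close>
        have l: "loss p (est p i (Matrix.vec (n p) x)) \<eta> = array_loss p \<eta> a x" for x
        proof -
          define y where "y = Matrix.vec (n p) x"
          have y: "y \<in> carrier_vec (n p)" by (simp add: y_def)
          have "loss p (est p i y) \<eta> = (\<Sum>i<p. (hybrid_weights p k f t (transpose_mat (U p D) *\<^sub>v y) $ i *
              (transpose_mat (U p D) *\<^sub>v y) $ i - (transpose_mat (U p D) *\<^sub>v \<eta>) $ i)\<^sup>2) / real p"
            unfolding est[OF y] by (rule shrink_loss[OF U(1,2)[OF p D] \<eta>_dim[OF p \<eta>] \<eta>_proj[OF p \<eta> D] y])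
          also have "(\<Sum>i<p. (hybrid_weights p k f t (transpose_mat (U p D) *\<^sub>v y) $ i *
              (transpose_mat (U p D) *\<^sub>v y) $ i - (transpose_mat (U p D) *\<^sub>v \<eta>) $ i)\<^sup>2) =
              (\<Sum>i<p. if i < k then ms_loss (f i) (xi p \<eta> D i) (Z p D i x) else st_loss t (xi p \<eta> D i) (Z p D i x))"
            by (intro sum.cong) (auto simp: hybrid_weights_def Z_eq[OF p D] xi_def ms_loss_def st_loss_def y_def)
          also have "\<dots> = (\<Sum>i<k. ms_loss (f i) (xi p \<eta> D i) (Z p D i x)) + (\<Sum>i\<in>{k..<p}. st_loss t (xi p \<eta> D i) (Z p D i x))"
          proof -
            have "{..<p} = {..<k} \<union> {k..<p}" using k by auto
            then show ?thesis by (simp add: sum.union_disjoint ivl_disj_int)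
          qed
          finally show ?thesis by (simp add: array_loss_def a_def y_def)
        qed
        have r: "rhat p i (Matrix.vec (n p) x) = array_rhat (sig2 p (Matrix.vec (n p) x)) p a x"
          using rhat[of "Matrix.vec (n p) x"] k by (auto simp: hybrid_rhat_def array_rhat_def a_def Z_eq[OF p D] intro!: sum.cong arg_cong2[of _ _ _ _ "(+)"])
        have rk: "risk p \<eta> s2 (est p i) = array_risk p \<eta> a"
          unfolding risk_def array_risk_def dim\<eta> l ..
        show ?thesis unfolding l r rk by (rule B(2)[OF x a])
      qed
      then show "\<exists>B. small_envelope (gauss_law \<eta> s2) e B \<and> risk_close (n p) (I p) (est p) (rhat p) p \<eta> s2 B"
        using B(1) by (auto simp: risk_close_def)
    qed
  qed
qed

section \<open>The three candidate classes in hybrid form\<close>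

lemma rhat_MS_sum:
  "real (dim_vec z) * rhat_MS s f z = (\<Sum>i<dim_vec z. (f $ i)\<^sup>2 * s + (1 - f $ i)\<^sup>2 * ((z $ i)\<^sup>2 - s))"
  by (cases "dim_vec z = 0") (auto simp: rhat_MS_def)

text \<open>Multiplication by the dimension matches the weights in the hybrid risk and gives 0 on
  both sides for an empty subvector, where no empirical distribution exists. The distribution
  function at t counts \<bar>z_i\<bar> \<le> t, which for t \<ge> 0 is membership in
  [-t, t].\<close>

lemma rhat_ST_sum:
  assumes "t \<ge> 0"
  shows "real (dim_vec z) * rhat_ST s t z =
    (\<Sum>i<dim_vec z. s * (1 - 2 * indicator {-t..t} (z $ i)) + (min \<bar>z $ i\<bar> t)\<^sup>2)"
proof (cases "dim_vec z = 0")
  case False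
  define d where "d = dim_vec z"
  have d: "d > 0" using False unfolding d_def by (rule neq0_conv[THEN iffD1])
  then have ne: "{..<d} \<noteq> {}" by auto
  have ind: "indicat_real {..t} \<bar>x\<bar> = indicator {-t..t} x" for x using assms by (auto simp: indicator_def)
  have "cdf (measure_pmf (empirical_abs z)) t = measure_pmf.expectation (empirical_abs z) (indicat_real {..t})"
    by (simp add: cdf_def)
  also have "\<dots> = (\<Sum>i<d. indicator {-t..t} (z $ i)) / real d"
    unfolding empirical_abs_def d_def[symmetric] integral_map_pmf integral_pmf_of_set[OF ne finite_lessThan] by (simp add: ind)
  finally have 1: "cdf (measure_pmf (empirical_abs z)) t = (\<Sum>i<d. indicator {-t..t} (z $ i)) / real d" .
  have 2: "measure_pmf.expectation (empirical_abs z) (\<lambda>u. (min u t)\<^sup>2) = (\<Sum>i<d. (min \<bar>z $ i\<bar> t)\<^sup>2) / real d"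
    unfolding empirical_abs_def d_def[symmetric] integral_map_pmf integral_pmf_of_set[OF ne finite_lessThan] by simp
  have "real d * rhat_ST s t z = s * (real d - 2 * (\<Sum>i<d. indicator {-t..t} (z $ i))) + (\<Sum>i<d. (min \<bar>z $ i\<bar> t)\<^sup>2)"
    unfolding rhat_ST_def 1 2 using d by (simp add: field_simps)
  also have "real d - 2 * (\<Sum>i<d. indicator {-t..t} (z $ i)) = (\<Sum>i<d. 1 - 2 * indicator {-t..t} (z $ i))"
    by (simp add: sum_subtractf sum_distrib_left)
  finally show ?thesis by (simp add: d_def sum.distrib sum_distrib_left)
qed simp

lemma MS_as_hybrid:
  assumes "U \<in> carrier_mat n p" "f \<in> F_MS p" "p > 0"
  shows "est_MS U f y = shrink U (hybrid_weights p p (\<lambda>i. f $ i) 0 (transpose_mat U *\<^sub>v y)) y"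
    "rhat_MS s f (transpose_mat U *\<^sub>v y) = hybrid_rhat p s p (\<lambda>i. f $ i) 0 (transpose_mat U *\<^sub>v y)"
proof -
  have "hybrid_weights p p (\<lambda>i. f $ i) 0 z = f" for z
    using assms(2) by (auto simp: hybrid_weights_def F_MS_def)
  then show "est_MS U f y = shrink U (hybrid_weights p p (\<lambda>i. f $ i) 0 (transpose_mat U *\<^sub>v y)) y"
    by (simp add: est_MS_def)
  show "rhat_MS s f (transpose_mat U *\<^sub>v y) = hybrid_rhat p s p (\<lambda>i. f $ i) 0 (transpose_mat U *\<^sub>v y)"
    using assms(1) by (simp add: rhat_MS_def hybrid_rhat_def)
qed

lemma MS_candidate:
  assumes "D \<in> Ds" "V D \<in> carrier_mat n p" "f \<in> F_MS p" "p > 0"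
  shows "hybrid_candidate n p V Ds s (est_MS (V D) f) (\<lambda>y. rhat_MS (s y) f (transpose_mat (V D) *\<^sub>v y))"
  unfolding hybrid_candidate_def using MS_as_hybrid[OF assms(2-4)] assms(1,3)
  by (intro bexI[of _ D] exI[of _ p] exI[of _ "\<lambda>i. f $ i"] exI[of _ 0]) (auto simp: F_MS_def)

lemma ST_as_hybrid:
  assumes "U \<in> carrier_mat n p" "t \<ge> 0" "p > 0"
  shows "est_ST U t y = shrink U (hybrid_weights p 0 f t (transpose_mat U *\<^sub>v y)) y"
    "rhat_ST s t (transpose_mat U *\<^sub>v y) = hybrid_rhat p s 0 f t (transpose_mat U *\<^sub>v y)"
proof -
  have dim: "dim_vec (transpose_mat U *\<^sub>v y) = p" using assms(1) by simp
  show "est_ST U t y = shrink U (hybrid_weights p 0 f t (transpose_mat U *\<^sub>v y)) y"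
    using assms(1) by (simp add: est_ST_def h_ST_def hybrid_weights_def)
  show "rhat_ST s t (transpose_mat U *\<^sub>v y) = hybrid_rhat p s 0 f t (transpose_mat U *\<^sub>v y)"
    using rhat_ST_sum[OF assms(2), of "transpose_mat U *\<^sub>v y" s] assms(3)
    unfolding dim by (simp add: hybrid_rhat_def field_simps lessThan_atLeast0)
qed

lemma ST_candidate:
  assumes "D \<in> Ds" "V D \<in> carrier_mat n p" "t \<ge> 0" "p > 0"
  shows "hybrid_candidate n p V Ds s (est_ST (V D) t) (\<lambda>y. rhat_ST (s y) t (transpose_mat (V D) *\<^sub>v y))"
  unfolding hybrid_candidate_def using ST_as_hybrid[OF assms(2-4), where f="\<lambda>_. 0"] assms(1,3)
  by (intro bexI[of _ D] exI[of _ 0] exI[of _ "\<lambda>_. 0"] exI[of _ t]) auto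

lemma split_index_le: "0 \<le> \<alpha> \<Longrightarrow> \<alpha> \<le> 1 \<Longrightarrow> split_index p \<alpha> \<le> p"
  unfolding split_index_def using mult_right_mono[of \<alpha> 1 "real p"] by (simp add: nat_le_iff floor_le_iff)

lemma HS_as_hybrid:
  assumes "U \<in> carrier_mat n p" "f \<in> carrier_vec (split_index p \<alpha>)" "t \<ge> 0" "0 \<le> \<alpha>" "\<alpha> \<le> 1"
  shows "est_HS U \<alpha> f t y = shrink U (hybrid_weights p (split_index p \<alpha>) (\<lambda>i. f $ i) t (transpose_mat U *\<^sub>v y)) y"
    "rhat_HS s \<alpha> f t (transpose_mat U *\<^sub>v y) = hybrid_rhat p s (split_index p \<alpha>) (\<lambda>i. f $ i) t (transpose_mat U *\<^sub>v y)"
proof -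
  define z where "z = transpose_mat U *\<^sub>v y"
  define k where "k = split_index p \<alpha>"
  have dim: "dim_vec z = p" using assms(1) by (simp add: z_def)
  have k: "k \<le> p" unfolding k_def using assms(4,5) by (rule split_index_le)
  have f: "dim_vec f = k" using assms(2) by (simp add: k_def)
  have last: "vec_last z (p - k) $ i = z $ (k + i)" if "i < p - k" for i
    using that k by (simp add: vec_last_def dim)
  have "f @\<^sub>v h_ST t (vec_last z (p - k)) = hybrid_weights p k (\<lambda>i. f $ i) t z"
  proof (rule eq_vecI)
    fix i assume "i < dim_vec (hybrid_weights p k (\<lambda>i. f $ i) t z)"
    then have i: "i < p" by (simp add: hybrid_weights_def)
    show "(f @\<^sub>v h_ST t (vec_last z (p - k))) $ i = hybrid_weights p k (\<lambda>i. f $ i) t z $ i"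
      using i f k last[of "i - k"] by (auto simp: hybrid_weights_def h_ST_def)
  qed (use f k in \<open>auto simp: hybrid_weights_def h_ST_def\<close>)
  then show "est_HS U \<alpha> f t y = shrink U (hybrid_weights p (split_index p \<alpha>) (\<lambda>i. f $ i) t (transpose_mat U *\<^sub>v y)) y"
    by (simp add: est_HS_def Let_def z_def[symmetric] dim k_def[symmetric])
  have 1: "real k * rhat_MS s f (vec_first z k) = (\<Sum>i<k. (f $ i)\<^sup>2 * s + (1 - f $ i)\<^sup>2 * ((z $ i)\<^sup>2 - s))"
    using rhat_MS_sum[of "vec_first z k" s f] by (simp add: vec_first_def)
  have "real (p - k) * rhat_ST s t (vec_last z (p - k)) =
      (\<Sum>i<p - k. s * (1 - 2 * indicator {-t..t} (z $ (k + i))) + (min \<bar>z $ (k + i)\<bar> t)\<^sup>2)"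
    using rhat_ST_sum[OF assms(3), of "vec_last z (p - k)" s] last by simp
  also have "\<dots> = (\<Sum>i\<in>{k..<p}. s * (1 - 2 * indicator {-t..t} (z $ i)) + (min \<bar>z $ i\<bar> t)\<^sup>2)"
    using k by (intro sum.reindex_bij_witness[of _ "\<lambda>i. i - k" "\<lambda>i. k + i"]) auto
  finally show "rhat_HS s \<alpha> f t (transpose_mat U *\<^sub>v y) = hybrid_rhat p s (split_index p \<alpha>) (\<lambda>i. f $ i) t (transpose_mat U *\<^sub>v y)"
    using 1 by (simp add: rhat_HS_def Let_def z_def[symmetric] dim k_def[symmetric] hybrid_rhat_def)
qed

lemma HS_candidate:
  assumes "D \<in> Ds" "V D \<in> carrier_mat n p" "(f, t) \<in> F_HS p \<alpha>" "0 \<le> \<alpha>" "\<alpha> \<le> 1"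
  shows "hybrid_candidate n p V Ds s (est_HS (V D) \<alpha> f t) (\<lambda>y. rhat_HS (s y) \<alpha> f t (transpose_mat (V D) *\<^sub>v y))"
proof -
  have f: "f \<in> F_MS (split_index p \<alpha>)" and t: "t \<ge> 0" using assms(3) by (auto simp: F_HS_def)
  then have "f \<in> carrier_vec (split_index p \<alpha>)" by (simp add: F_MS_def)
  note eqs = HS_as_hybrid[OF assms(2) this t assms(4,5)]
  show ?thesis
    unfolding hybrid_candidate_def using eqs f t assms(1) split_index_le[OF assms(4,5), of p]
    by (intro bexI[of _ D] exI[of _ "split_index p \<alpha>"] exI[of _ "\<lambda>i. f $ i"] exI[of _ t]) (auto simp: F_MS_def)
qed

text \<open>Since 1 / p \<le> p^(-1/2) and g is eventually at least 1, the ratio is dominated by the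
  assumed null sequence. The separate w allows for the maximum of the two cardinalities in the
  hybrid case.\<close>

lemma card_ratio_tendsto:
  fixes g :: "nat \<Rightarrow> real"
  assumes lim: "(\<lambda>p. real (w p) * real p powr (-1/2) * g p) \<longlonglongrightarrow> 0"
    and g: "\<forall>\<^sub>F p in sequentially. 1 \<le> g p" and le: "\<And>p. d p \<le> w p"
  shows "(\<lambda>p. real (d p) / real p) \<longlonglongrightarrow> 0"
proof (rule Lim_null_comparison[OF _ lim])
  show "\<forall>\<^sub>F p in sequentially. norm (real (d p) / real p) \<le> real (w p) * real p powr (-1/2) * g p"
    using g eventually_gt_at_top[of 0]
  proof eventually_elim
    case (elim p)
    have "real p powr (- 1) \<le> real p powr (-1/2)" using elim(2) by (intro powr_mono) auto
    then have "1 / real p \<le> real p powr (-1/2)" using elim(2) by (simp add: powr_minus_divide)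
    then have "real (d p) * (1 / real p) \<le> real (w p) * real p powr (-1/2)"
      using le[of p] by (intro mult_mono) auto
    also have "\<dots> = real (w p) * real p powr (-1/2) * 1" by simp
    also have "\<dots> \<le> real (w p) * real p powr (-1/2) * g p" using elim(1) by (intro mult_left_mono) auto
    finally show ?case by simp
  qed
qed

text \<open>The bound 3 is the first integer above e, so the logarithm is at least 1 from there
  on.\<close>

lemma eventually_log_powr_ge_1: "\<forall>\<^sub>F p in sequentially. 1 \<le> ln (real p) powr (1/4)"
  using eventually_ge_at_top[of 3]
proof eventually_elim
  case (elim p)
  have "1 \<le> ln (real p)" using elim exp_le by (subst ln_ge_iff) (auto intro: order_trans)
  then show ?case by (rule ge_one_powr_ge_zero) simp
qed

lemma card_ge_1: "finite A \<Longrightarrow> A \<noteq> {} \<Longrightarrow> 1 \<le> card A"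
  by (simp add: Suc_leI card_gt_0_iff)

theorem theorem4p1:
  fixes X :: "nat \<Rightarrow> real mat"
    and U :: "nat \<Rightarrow> real mat \<Rightarrow> real mat"
    and sig2 :: "nat \<Rightarrow> real vec \<Rightarrow> real"
  defines "n \<equiv> \<lambda>p. dim_row (X p)"
    and "H \<equiv> \<lambda>\<D> p c. means (X p) (U p ` \<D> p) c"
    and "z \<equiv> \<lambda>p D y. transpose_mat (U p D) *\<^sub>v y"
  assumes layout: "\<And>p. p > 0 \<Longrightarrow> incidence_matrix p (X p)"
    and basis: "\<And>p D. p > 0 \<Longrightarrow> dim_col D = p \<Longrightarrow> penalty_basis (X p) D (U p D)"
    and estimator: "\<And>p. p > 0 \<Longrightarrow> statistic (n p) (sig2 p)"
  shows
    \<comment> \<open>(a) to (c), monotone shrinkage\<close>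
    "(\<forall>D. (\<forall>p. dim_col (D p) = p) \<and> weighted_consistent (\<lambda>p. 1) (H (\<lambda>p. {D p})) sig2 \<longrightarrow>
        convergences_ABC n (H (\<lambda>p. {D p})) F_MS
          (\<lambda>p f. est_MS (U p (D p)) f)
          (\<lambda>p f y. rhat_MS (sig2 p y) f (z p (D p) y)))
    \<comment> \<open>(a) to (c), soft thresholding\<close>
   \<and> (\<forall>D. (\<forall>p. dim_col (D p) = p) \<and> weighted_consistent (\<lambda>p. 1) (H (\<lambda>p. {D p})) sig2 \<longrightarrow>
        convergences_ABC n (H (\<lambda>p. {D p})) (\<lambda>p. {0..})
          (\<lambda>p t. est_ST (U p (D p)) t)
          (\<lambda>p t y. rhat_ST (sig2 p y) t (z p (D p) y)))
    \<comment> \<open>(d), monotone shrinkage\<close>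
   \<and> (\<forall>\<D>. (\<forall>p. finite (\<D> p) \<and> \<D> p \<noteq> {} \<and> (\<forall>D\<in>\<D> p. dim_col D = p)) \<and>
        (\<lambda>p. real (card (\<D> p)) * real p powr (-1/2)) \<longlonglongrightarrow> 0 \<and>
        weighted_consistent (\<lambda>p. card (\<D> p)) (H \<D>) sig2 \<longrightarrow>
        convergences_ABC n (H \<D>) (\<lambda>p. \<D> p \<times> F_MS p)
          (\<lambda>p (D, f). est_MS (U p D) f)
          (\<lambda>p (D, f) y. rhat_MS (sig2 p y) f (z p D y)))
    \<comment> \<open>(d), soft thresholding\<close>
   \<and> (\<forall>\<D>. (\<forall>p. finite (\<D> p) \<and> \<D> p \<noteq> {} \<and> (\<forall>D\<in>\<D> p. dim_col D = p)) \<and>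
        (\<lambda>p. real (card (\<D> p)) * real p powr (-1/2) * ln (real p) powr (1/4)) \<longlonglongrightarrow> 0 \<and>
        weighted_consistent (\<lambda>p. card (\<D> p)) (H \<D>) sig2 \<longrightarrow>
        convergences_ABC n (H \<D>) (\<lambda>p. \<D> p \<times> {0..})
          (\<lambda>p (D, t). est_ST (U p D) t)
          (\<lambda>p (D, t) y. rhat_ST (sig2 p y) t (z p D y)))
    \<comment> \<open>(e)\<close>
   \<and> (\<forall>\<D> \<A>. (\<forall>p. finite (\<D> p) \<and> \<D> p \<noteq> {} \<and> (\<forall>D\<in>\<D> p. dim_col D = p)) \<and>
        (\<forall>p. finite (\<A> p) \<and> \<A> p \<noteq> {} \<and> \<A> p \<subseteq> {0..1}) \<and>
        (\<lambda>p. real (max (card (\<A> p)) (card (\<D> p))) * real p powr (-1/2) * ln (real p) powr (1/4))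
          \<longlonglongrightarrow> 0 \<and>
        weighted_consistent (\<lambda>p. max (card (\<A> p)) (card (\<D> p))) (H \<D>) sig2 \<longrightarrow>
        convergences_ABC n (H \<D>) (\<lambda>p. \<D> p \<times> (SIGMA \<alpha>:\<A> p. F_HS p \<alpha>))
          (\<lambda>p (D, \<alpha>, f, t). est_HS (U p D) \<alpha> f t)
          (\<lambda>p (D, \<alpha>, f, t) y. rhat_HS (sig2 p y) \<alpha> f t (z p D y)))"
proof -
  have U: "U p D \<in> carrier_mat (n p) p" if "p > 0" "dim_col D = p" for p :: nat and D
    unfolding n_def using penalty_basis_properties(2)[OF layout[OF that(1)] basis[OF that] that(2)] .
  have single: "(\<lambda>p. real (card {D p}) / real p) \<longlonglongrightarrow> 0" for D :: "nat \<Rightarrow> real mat"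
    using lim_inverse_n' by simp
  \<comment> \<open>The index type stays generic, so this one fact serves weight vectors,
    thresholds, pairs and quadruples alike; each part of the theorem only has to exhibit its
    candidates in hybrid form.\<close>
  have core: "convergences_ABC n (H \<D>) I est rhat"
    if "\<And>p. finite (\<D> p)" "\<And>p D. D \<in> \<D> p \<Longrightarrow> dim_col D = p" "(\<lambda>p. real (card (\<D> p)) / real p) \<longlonglongrightarrow> 0"
      "weighted_consistent w (H \<D>) sig2" "\<And>p. w p \<ge> 1"
      "\<And>p i. p > 0 \<Longrightarrow> i \<in> I p \<Longrightarrow> hybrid_candidate (n p) p (U p) (\<D> p) (sig2 p) (est p i) (rhat p i)"
    for \<D> :: "nat \<Rightarrow> real mat set" and w and I :: "nat \<Rightarrow> 'i set" and est rhat
    unfolding n_def H_def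
    by (rule hybrid_convergences[OF layout basis estimator[unfolded n_def] that(1-3) that(4)[unfolded H_def] that(5) that(6)[unfolded n_def]])
  show ?thesis
  proof (intro conjI allI impI, goal_cases)
    case (1 D)
    then have dim: "dim_col (D p) = p" and cons: "weighted_consistent (\<lambda>p. 1) (H (\<lambda>p. {D p})) sig2" for p :: nat by auto
    show ?case unfolding z_def
    proof (rule core[OF _ _ single cons])
      fix p :: nat and f assume "p > 0" "f \<in> F_MS p"
      then show "hybrid_candidate (n p) p (U p) {D p} (sig2 p) (est_MS (U p (D p)) f)
          (\<lambda>y. rhat_MS (sig2 p y) f (transpose_mat (U p (D p)) *\<^sub>v y))"
        using dim by (intro MS_candidate U) auto
    qed (use dim in auto)
  next
    case (2 D)
    then have dim: "dim_col (D p) = p" and cons: "weighted_consistent (\<lambda>p. 1) (H (\<lambda>p. {D p})) sig2" for p :: nat by auto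
    show ?case unfolding z_def
    proof (rule core[OF _ _ single cons])
      fix p :: nat and t :: real assume "p > 0" "t \<in> {0..}"
      then show "hybrid_candidate (n p) p (U p) {D p} (sig2 p) (est_ST (U p (D p)) t)
          (\<lambda>y. rhat_ST (sig2 p y) t (transpose_mat (U p (D p)) *\<^sub>v y))"
        using dim by (intro ST_candidate U) auto
    qed (use dim in auto)
  next
    case (3 \<D>)
    then have \<D>: "finite (\<D> p)" "\<D> p \<noteq> {}" "\<And>D. D \<in> \<D> p \<Longrightarrow> dim_col D = p"
      and lim: "(\<lambda>p. real (card (\<D> p)) * real p powr (-1/2)) \<longlonglongrightarrow> 0"
      and cons: "weighted_consistent (\<lambda>p. card (\<D> p)) (H \<D>) sig2" for p :: nat by auto
    \<comment> \<open>Monotone shrinkage has no logarithmic factor, so g is the constant 1.\<close>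
    have card: "(\<lambda>p. real (card (\<D> p)) / real p) \<longlonglongrightarrow> 0"
      by (rule card_ratio_tendsto[where w="\<lambda>p. card (\<D> p)" and g="\<lambda>_. 1"]) (use lim in simp_all)
    show ?case unfolding z_def
    proof (rule core[OF \<D>(1) \<D>(3) card cons card_ge_1[OF \<D>(1,2)]])
      fix p :: nat and i assume p: "p > 0" and "i \<in> \<D> p \<times> F_MS p"
      then obtain D f where i: "i = (D, f)" "D \<in> \<D> p" "f \<in> F_MS p" by auto
      show "hybrid_candidate (n p) p (U p) (\<D> p) (sig2 p) (case i of (D, f) \<Rightarrow> est_MS (U p D) f)
          (case i of (D, f) \<Rightarrow> \<lambda>y. rhat_MS (sig2 p y) f (transpose_mat (U p D) *\<^sub>v y))"
        unfolding i(1) prod.case using p i \<D>(3) by (intro MS_candidate U) auto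
    qed
  next
    case (4 \<D>)
    then have \<D>: "finite (\<D> p)" "\<D> p \<noteq> {}" "\<And>D. D \<in> \<D> p \<Longrightarrow> dim_col D = p"
      and lim: "(\<lambda>p. real (card (\<D> p)) * real p powr (-1/2) * ln (real p) powr (1/4)) \<longlonglongrightarrow> 0"
      and cons: "weighted_consistent (\<lambda>p. card (\<D> p)) (H \<D>) sig2" for p :: nat by auto
    have card: "(\<lambda>p. real (card (\<D> p)) / real p) \<longlonglongrightarrow> 0"
      by (rule card_ratio_tendsto[OF lim eventually_log_powr_ge_1]) simp
    show ?case unfolding z_def
    proof (rule core[OF \<D>(1) \<D>(3) card cons card_ge_1[OF \<D>(1,2)]])
      fix p :: nat and i assume p: "p > 0" and "i \<in> \<D> p \<times> {0::real..}"
      then obtain D t where i: "i = (D, t)" "D \<in> \<D> p" "t \<ge> 0" by auto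
      show "hybrid_candidate (n p) p (U p) (\<D> p) (sig2 p) (case i of (D, t) \<Rightarrow> est_ST (U p D) t)
          (case i of (D, t) \<Rightarrow> \<lambda>y. rhat_ST (sig2 p y) t (transpose_mat (U p D) *\<^sub>v y))"
        unfolding i(1) prod.case using p i \<D>(3) by (intro ST_candidate U) auto
    qed
  next
    case (5 \<D> \<A>)
    then have \<D>: "finite (\<D> p)" "\<D> p \<noteq> {}" "\<And>D. D \<in> \<D> p \<Longrightarrow> dim_col D = p"
      and \<A>: "\<A> p \<subseteq> {0..1}"
      and lim: "(\<lambda>p. real (max (card (\<A> p)) (card (\<D> p))) * real p powr (-1/2) * ln (real p) powr (1/4)) \<longlonglongrightarrow> 0"
      and cons: "weighted_consistent (\<lambda>p. max (card (\<A> p)) (card (\<D> p))) (H \<D>) sig2" for p :: nat by auto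
    have card: "(\<lambda>p. real (card (\<D> p)) / real p) \<longlonglongrightarrow> 0"
      by (rule card_ratio_tendsto[OF lim eventually_log_powr_ge_1]) simp
    show ?case unfolding z_def
    \<comment> \<open>The consistency weight is the maximum of both cardinalities; it is at least 1
      because the set of penalty matrices is nonempty.\<close>
    proof (rule core[OF \<D>(1) \<D>(3) card cons max.coboundedI2[OF card_ge_1[OF \<D>(1,2)]]])
      fix p :: nat and i assume p: "p > 0" and "i \<in> \<D> p \<times> (SIGMA \<alpha>:\<A> p. F_HS p \<alpha>)"
      then obtain D \<alpha> f t where i: "i = (D, \<alpha>, f, t)" "D \<in> \<D> p" "\<alpha> \<in> \<A> p" "(f, t) \<in> F_HS p \<alpha>" by auto
      show "hybrid_candidate (n p) p (U p) (\<D> p) (sig2 p) (case i of (D, \<alpha>, f, t) \<Rightarrow> est_HS (U p D) \<alpha> f t)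
          (case i of (D, \<alpha>, f, t) \<Rightarrow> \<lambda>y. rhat_HS (sig2 p y) \<alpha> f t (transpose_mat (U p D) *\<^sub>v y))"
        unfolding i(1) prod.case using p i \<D>(3) \<A>[of p] by (intro HS_candidate U) auto
    qed
  qed
qed

end
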